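(* Let $P(X)\in\mathbb{Z}[X]$ be a Borwein polynomial of degree at most $8$. If $P(X)$ divides (in $\mathbb{Z}[X]$) some Newman polynomial, then $P(X)$ also divides (in $\mathbb{Z}[X]$) some Littlewood polynomial.
   Context: A polynomial $P(X)=a_dX^d+\dots+a_1X+a_0\in\mathbb{Z}[X]$ is a Borwein polynomial if all $a_j\in\{-1,0,1\}$, $a_d\neq 0$ and $P(0)=a_0\neq 0$. It is a Littlewood polynomial if all $a_j\in\{-1,1\}$. It is a Newman polynomial if all $a_j\in\{0,1\}$, $a_d\ne 0$ and $P(0)=1$. *)

theory Defs
  imports "HOL-Computational_Algebra.Polynomial"
begin

definition borwein_poly :: "int poly \<Rightarrow> bool" where
  "borwein_poly P \<longleftrightarrow>
     (\<forall>j\<le>degree P. coeff P j \<in> {-1, 0, 1}) \<and> lead_coeff P \<noteq> 0 \<and> poly P 0 \<noteq> 0"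

(* The zero polynomial is excluded: its coefficient at index 0 = degree 0 is 0. *)
definition littlewood_poly :: "int poly \<Rightarrow> bool" where
  "littlewood_poly P \<longleftrightarrow> (\<forall>j\<le>degree P. coeff P j \<in> {-1, 1})"

definition newman_poly :: "int poly \<Rightarrow> bool" where
  "newman_poly P \<longleftrightarrow>
     (\<forall>j\<le>degree P. coeff P j \<in> {0, 1}) \<and> lead_coeff P \<noteq> 0 \<and> poly P 0 = 1"

end

theory Submission
  imports Defs "HOL-Computational_Algebra.Fundamental_Theorem_Algebra"
begin

text \<open>
  Up to sign \<open>P(0) = 1\<close>, and if the leading coefficient is -1 then \<open>P\<close> has a positive root, which no Newman
  polynomial has. The remaining finitely many polynomials, up to reciprocals, are settled one by one: either
  \<open>P\<close> takes a nonpositive value on the positive axis, or a Littlewood multiple is exhibited, or a finite search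
  shows that \<open>P\<close> has no Newman multiple.

  The search reads the coefficients \<open>n\<^sub>0, n\<^sub>1, \<dots>\<close> of a hypothetical Newman multiple \<open>N\<close> and keeps the residue
  \<open>C\<^sub>k\<close> modulo \<open>P\<close> of the tail \<open>N\<^sub>k = n\<^sub>k + n\<^sub>k\<^sub>+\<^sub>1 X + \<dots>\<close>. At a root \<open>a\<close> of \<open>P\<close> inside the unit disc,
  \<open>C\<^sub>k(a) = N\<^sub>k(a)\<close> satisfies \<open>\<bar>2 (1 - a) N\<^sub>k(a) - 1\<bar> \<le> \<bar>1 - a\<bar> / (1 - \<bar>a\<bar>)\<close>, so all residues violating this bound
  can be discarded. If the remaining ones form a finite set that avoids 0, there is no Newman multiple, since
  the residues end in 0. The roots enter through fixed point approximations, certified by the fact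
  that some root of \<open>p\<close> lies within \<open>deg p \<bar>p(z) / p'(z)\<bar>\<close> of \<open>z\<close>.
\<close>

section \<open>Evaluation at complex roots\<close>

text \<open>Why the set of surviving residues can be finite: X^k C_k is congruent to -(n_0 + ... +
  n_(k-1) X^(k-1)) modulo P, so at a root a with |a| > 1 the value C_k(a) is at most 1 / (|a| - 1)
  in norm without any pruning. Exponential growth comes only from the roots inside the disc, where
  the tail bound stops it. If P is squarefree without roots on the unit circle, the bounds at all
  roots together leave finitely many integer residues; a root on the circle yields neither bound,
  and the search has to die out by means of the others. Passing to the reciprocal polynomial swaps
  inner and outer roots and reads N from its leading end, so a polynomial can be searched from
  either end. Conjugate roots impose the same condition, so one of each pair is recorded, and most
  searches end with a single root. The same carries, fed with digits -1 and 1, verify Littlewood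
  multiples: digits that bring the carry back to 0 spell a multiple of P. The tests are evaluated by
  rewriting, hence on integers only, with quotients and square roots cleared.\<close>

lemma pderiv_prod_linear_bound:
  fixes A :: "complex multiset"
  assumes "\<And>a. a \<in># A \<Longrightarrow> r \<le> norm (z - a)"
  shows "r * norm (poly (pderiv (\<Prod>a\<in>#A. [:-a, 1:])) z)
    \<le> size A * norm (poly (\<Prod>a\<in>#A. [:-a, 1:]) z)"
  using assms
proof (induction A)
  case empty
  then show ?case by simp
next
  case (add a A)
  define q where "q = (\<Prod>a\<in>#A. [:-a, 1:])"
  have IH: "r * norm (poly (pderiv q) z) \<le> size A * norm (poly q z)"
    unfolding q_def using add by simp
  have ra: "r \<le> norm (z - a)"
    using add.prems by simp
  \<comment> \<open>Product rule: the logarithmic derivative gains the term 1 / (z - a), of norm at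
    most 1 / r. Multiplying out instead of dividing keeps the induction valid when z is a
    root.\<close>
  have eq: "poly (pderiv ([:-a, 1:] * q)) z = poly q z + (z - a) * poly (pderiv q) z"
    unfolding pderiv_mult by (simp add: pderiv_pCons algebra_simps)
  show ?case
  proof (cases "r \<ge> 0")
    case True
    have "r * norm (poly (pderiv ([:-a, 1:] * q)) z)
        \<le> r * (norm (poly q z) + norm (z - a) * norm (poly (pderiv q) z))"
      unfolding eq using True norm_triangle_ineq[of "poly q z" "(z - a) * poly (pderiv q) z"]
      by (intro mult_left_mono) (auto simp: norm_mult)
    also have "\<dots> = r * norm (poly q z) + norm (z - a) * (r * norm (poly (pderiv q) z))"
      by (simp add: algebra_simps)
    also have "\<dots> \<le> norm (z - a) * norm (poly q z) + norm (z - a) * (size A * norm (poly q z))"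
      using ra IH by (intro add_mono mult_right_mono mult_left_mono) auto
    also have "\<dots> = size (add_mset a A) * (norm (z - a) * norm (poly q z))"
      by (simp add: distrib_right)
    also have "norm (z - a) * norm (poly q z) = norm (poly ([:-a, 1:] * q) z)"
      unfolding norm_mult[symmetric] by (simp add: left_diff_distrib)
    finally show ?thesis
      by (simp only: q_def image_mset_add_mset prod_mset.add_mset)
  next
    case False
    then have "r * norm (poly (pderiv (\<Prod>a\<in>#add_mset a A. [:-a, 1:])) z) \<le> 0"
      by (intro mult_nonpos_nonneg norm_ge_zero) simp
    also have "0 \<le> size (add_mset a A) * norm (poly (\<Prod>a\<in>#add_mset a A. [:-a, 1:]) z)"
      by (intro mult_nonneg_nonneg of_nat_0_le_iff norm_ge_zero)
    finally show ?thesis .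
  qed
qed

text \<open>Take r to be the distance from z to the nearest root: the logarithmic derivative is then
  a sum of \<open>degree p\<close> terms of norm at most 1 / r. The leading coefficient scales both
  sides equally.\<close>

lemma exists_root_near:
  fixes p :: "complex poly"
  assumes "degree p > 0"
  obtains a where "poly p a = 0"
    "norm (z - a) * norm (poly (pderiv p) z) \<le> degree p * norm (poly p z)"
proof -
  have "p \<noteq> 0" using assms by auto
  obtain A where A: "size A = degree p" "p = smult (lead_coeff p) (\<Prod>x\<in>#A. [:-x, 1:])"
    using alg_closed_imp_factorization[OF \<open>p \<noteq> 0\<close>] by blast
  let ?R = "{x. poly p x = 0}"
  have fin: "finite ?R" and ne: "?R \<noteq> {}"
    using poly_roots_finite[OF \<open>p \<noteq> 0\<close>] fundamental_theorem_of_algebra[of p] assms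
    by (auto simp: constant_degree)
  define a where "a = arg_min_on (\<lambda>x. norm (z - x)) ?R"
  have a: "poly p a = 0" and amin: "\<And>x. poly p x = 0 \<Longrightarrow> norm (z - a) \<le> norm (z - x)"
    using arg_min_if_finite(1)[OF fin ne, of "\<lambda>x. norm (z - x)"]
      arg_min_least[OF fin ne, of _ "\<lambda>x. norm (z - x)"]
    by (auto simp: a_def)
  have root: "poly p x = 0" if "x \<in># A" for x
  proof -
    have "poly (\<Prod>x\<in>#A. [:-x, 1:]) x = 0"
      using that by (auto simp: poly_prod_mset prod_mset_zero_iff)
    then show ?thesis by (subst A(2)) simp
  qed
  let ?q = "\<Prod>x\<in>#A. [:-x, 1:]"
  have "norm (z - a) * norm (poly (pderiv ?q) z) \<le> size A * norm (poly ?q z)"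
    by (rule pderiv_prod_linear_bound) (auto intro: amin root)
  then have "norm (lead_coeff p) * (norm (z - a) * norm (poly (pderiv ?q) z))
      \<le> norm (lead_coeff p) * (size A * norm (poly ?q z))"
    by (intro mult_left_mono) auto
  also have "norm (lead_coeff p) * (norm (z - a) * norm (poly (pderiv ?q) z))
      = norm (z - a) * norm (poly (pderiv (smult (lead_coeff p) ?q)) z)"
    by (simp add: pderiv_smult norm_mult)
  also have "norm (lead_coeff p) * (size A * norm (poly ?q z))
      = degree p * norm (poly (smult (lead_coeff p) ?q) z)"
    by (simp add: norm_mult A(1))
  finally show ?thesis
    using that[OF a] A(2) by simp
qed

section \<open>Integer polynomials at real and complex points\<close>

definition ieval :: "int poly \<Rightarrow> 'a :: {idom, ring_char_0} \<Rightarrow> 'a" where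
  "ieval p x = poly (map_poly of_int p) x"

lemma ieval_0 [simp]: "ieval 0 x = 0"
  by (simp add: ieval_def)

lemma ieval_pCons [simp]: "ieval (pCons a p) x = of_int a + x * ieval p x"
  by (simp add: ieval_def map_poly_pCons)

lemma ieval_add [simp]: "ieval (p + q) x = ieval p x + ieval q x"
  by (induction p q rule: poly_induct2) (simp_all add: algebra_simps)

lemma ieval_smult [simp]: "ieval (smult c p) x = of_int c * ieval p x"
  by (induction p) (simp_all add: algebra_simps)

lemma ieval_diff [simp]: "ieval (p - q) x = ieval p x - ieval q x"
  using ieval_add[of "p - q" q x] by simp

lemma ieval_mult [simp]: "ieval (p * q) x = ieval p x * ieval q x"
  by (induction p) (simp_all add: algebra_simps)

lemma ieval_dvd: "p dvd q \<Longrightarrow> ieval p x = 0 \<Longrightarrow> ieval q x = 0"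
  by (auto elim!: dvdE)

lemma map_poly_of_int_pderiv:
  "map_poly (of_int :: int \<Rightarrow> 'a :: {idom, ring_char_0}) (pderiv p) = pderiv (map_poly of_int p)"
  by (simp add: poly_eq_iff coeff_pderiv coeff_map_poly)

lemma exists_ieval_root_near:
  fixes z :: complex
  assumes "degree p > 0"
  obtains a where "ieval p a = 0"
    "norm (z - a) * norm (ieval (pderiv p) z) \<le> degree p * norm (ieval p z)"
proof -
  have "degree (map_poly of_int p :: complex poly) = degree p"
    by (rule degree_map_poly) auto
  with exists_root_near[of "map_poly of_int p :: complex poly" z] assms that show ?thesis
    by (auto simp: ieval_def map_poly_of_int_pderiv)
qed

text \<open>
  Centring the digits, \<open>2n - 1 = \<plusminus>1\<close>, makes this disc half as large as the one given by the triangle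
  inequality for \<open>p(a)\<close> itself; with the larger disc the searches below become far bigger.
\<close>

lemma zero_one_poly_eval_bound:
  fixes a :: complex
  assumes "\<And>i. coeff p i \<in> {0, 1}" and "norm a < 1"
  shows "norm (2 * (1 - a) * ieval p a - 1) \<le> norm (1 - a) / (1 - norm a)"
  using assms(1)
proof (induction p)
  case 0
  \<comment> \<open>The empty digit string has centred value -1, so the radius must be at least
    1.\<close>
  have "1 - norm a \<le> norm (1 - a)"
    using norm_triangle_ineq2[of 1 a] by simp
  then show ?case using assms(2) by simp
next
  case (pCons c p)
  have "coeff p i \<in> {0, 1}" for i
    using pCons.prems[of "Suc i"] by simp
  then have IH: "norm (2 * (1 - a) * ieval p a - 1) \<le> norm (1 - a) / (1 - norm a)"
    by (rule pCons.IH)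
  have c: "c = 0 \<or> c = 1" using pCons.prems[of 0] by simp
  \<comment> \<open>Prepending a digit c maps the centred value s to a s + (1 - a)(2 c - 1), where
    |2 c - 1| = 1. The radius r is the fixed point of r -> |a| r + |1 - a|, so the disc is mapped
    into itself.\<close>
  have eq: "2 * (1 - a) * ieval (pCons c p) a - 1
      = a * (2 * (1 - a) * ieval p a - 1) + (1 - a) * (2 * of_int c - 1)"
    by (simp add: algebra_simps)
  have "norm (2 * (1 - a) * ieval (pCons c p) a - 1)
      \<le> norm a * norm (2 * (1 - a) * ieval p a - 1) + norm (1 - a)"
    unfolding eq using norm_triangle_ineq[of "a * (2 * (1 - a) * ieval p a - 1)" "(1 - a) * (2 * of_int c - 1)"] c
    by (auto simp: norm_mult)
  also have "\<dots> \<le> norm a * (norm (1 - a) / (1 - norm a)) + norm (1 - a)"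
    using IH by (intro add_right_mono mult_left_mono) auto
  also have "\<dots> = norm (1 - a) / (1 - norm a)"
    using assms(2) by (simp add: field_simps)
  finally show ?case .
qed

lemma newman_coeff: "newman_poly N \<Longrightarrow> coeff N i \<in> {0, 1}"
  using coeff_eq_0[of N i] unfolding newman_poly_def by (cases "i \<le> degree N") auto

text \<open>Strictness comes from the constant term 1. This refutes every P that has a positive
  root.\<close>

lemma newman_eval_pos:
  fixes x :: real
  assumes "newman_poly N" "x \<ge> 0"
  shows "ieval N x > 0"
proof -
  have *: "ieval p x \<ge> 0" if "\<And>i. coeff p i \<in> {0, 1}" for p
    using that
  proof (induction p)
    case (pCons c p)
    have "coeff p i \<in> {0, 1}" for i
      using pCons.prems[of "Suc i"] by simp
    then have "ieval p x \<ge> 0" by (rule pCons.IH)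
    moreover have "c \<ge> 0" using pCons.prems[of 0] by auto
    ultimately show ?case using assms(2) by simp
  qed simp
  obtain q where N: "N = pCons 1 q"
    using assms(1) by (cases N) (auto simp: newman_poly_def)
  have "coeff q i \<in> {0, 1}" for i
    using newman_coeff[OF assms(1), of "Suc i"] by (simp add: N)
  then show ?thesis using *[of q] assms(2) by (simp add: N add_pos_nonneg)
qed

section \<open>Carries of the division by a polynomial with constant term 1\<close>

text \<open>The shorter list counts as padded with zeros, and zeros at the end are kept. Every carry
  after the first digit therefore has exactly the length of \<open>bs\<close>, so that equality of
  lists, on which the search relies, is equality of residues.\<close>

fun sub_scaled :: "int \<Rightarrow> int list \<Rightarrow> int list \<Rightarrow> int list" where
  "sub_scaled k cs [] = cs"
| "sub_scaled k [] (b # bs) = - (k * b) # sub_scaled k [] bs"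
| "sub_scaled k (c # cs) (b # bs) = (c - k * b) # sub_scaled k cs bs"

lemma Poly_sub_scaled: "Poly (sub_scaled k cs bs) = Poly cs - smult k (Poly bs)"
  by (induction k cs bs rule: sub_scaled.induct) simp_all

lemma length_sub_scaled: "length (sub_scaled k cs bs) = max (length cs) (length bs)"
  by (induction k cs bs rule: sub_scaled.induct) simp_all

text \<open>
  For \<open>P = 1 + X B\<close>, the carry after reading the digit \<open>n\<close> is \<open>(C - n - (C(0) - n) P) / X\<close>; it is the
  residue of \<open>(C - n) / X\<close> modulo \<open>P\<close>.
\<close>

fun carry :: "int list \<Rightarrow> int \<Rightarrow> int list \<Rightarrow> int list" where
  "carry bs n [] = sub_scaled (- n) [] bs"
| "carry bs n (c # cs) = sub_scaled (c - n) cs bs"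

lemma carry_dvd: "Poly (1 # bs) dvd [:n:] + pCons 0 (Poly (carry bs n cs)) - Poly cs"
proof -
  \<comment> \<open>k is the constant term of the old carry minus the digit, which makes C - n - k P
    divisible by X; the empty list has constant term 0.\<close>
  obtain k where "[:n:] + pCons 0 (Poly (carry bs n cs)) - Poly cs = smult (- k) (Poly (1 # bs))"
  proof (cases cs)
    case Nil
    then show ?thesis by (intro that[of "- n"]) (simp add: Poly_sub_scaled)
  next
    case (Cons c ds)
    then show ?thesis by (intro that[of "c - n"]) (simp add: Poly_sub_scaled flip: smult_minus_left)
  qed
  then show ?thesis
    by (simp only: dvd_smult dvd_refl)
qed

lemma length_carry: "length cs \<le> length bs \<Longrightarrow> length (carry bs n cs) \<le> length bs"
  by (cases cs) (simp_all add: length_sub_scaled)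

lemma length_fold_carry: "length (fold (carry bs) ns []) \<le> length bs"
  by (induction ns rule: rev_induct) (simp_all add: length_carry)

text \<open>The invariant of the division. It serves twice: compared with a Newman multiple it
  identifies the carry with the tail, and when the carry is 0 it certifies that the digits
  themselves form a multiple of P.\<close>

lemma fold_carry_dvd:
  "Poly (1 # bs) dvd Poly ns + monom 1 (length ns) * Poly (fold (carry bs) ns [])"
proof (induction ns rule: rev_induct)
  case Nil
  then show ?case by simp
next
  case (snoc n ns)
  let ?C = "fold (carry bs) ns []"
  \<comment> \<open>The new digit changes the sum by X^k (n + X C' - C), where C' is the new carry;
    by \<open>carry_dvd\<close> this is a multiple of P.\<close>
  have "Poly (ns @ [n]) + monom 1 (length (ns @ [n])) * Poly (carry bs n ?C)
     = (Poly ns + monom 1 (length ns) * Poly ?C)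
       + monom 1 (length ns) * ([:n:] + pCons 0 (Poly (carry bs n ?C)) - Poly ?C)"
    by (simp add: Poly_snoc monom_Suc algebra_simps smult_monom)
  then show ?case
    using snoc carry_dvd[of bs n ?C] by (simp add: dvd_add)
qed

text \<open>The constant term 1 makes X a unit modulo P: multiply 1 = P - X B by X^k q, so that the
  last product contains the given multiple X^(k+1) q.\<close>

lemma dvd_monom_mult_cancel:
  assumes "Poly (1 # bs) dvd monom 1 k * q"
  shows "Poly (1 # bs) dvd (q :: int poly)"
  using assms
proof (induction k)
  case 0
  then show ?case by simp
next
  case (Suc k)
  let ?P = "Poly (1 # bs)" and ?r = "monom 1 k * q"
  have "?r = ?P * ?r - Poly bs * (monom 1 (Suc k) * q)"
    by (simp add: monom_Suc)
  moreover have "?P dvd \<dots>"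
    using Suc.prems by (meson dvd_diff dvd_mult dvd_triv_left)
  ultimately show ?case using Suc.IH by simp
qed

lemma poly_cutoff_shift:
  "(N :: int poly) = Poly (map (coeff N) [0..<k]) + monom 1 k * poly_shift k N"
  by (auto simp: poly_eq_iff coeff_monom_mult coeff_poly_shift nth_default_def)

text \<open>Both N and the digits continued by X^k times the carry are multiples of P; they differ
  by X^k (C_k - N_k), and X^k cancels. Hence carry and tail take the same value at every root of
  P.\<close>

lemma carry_tail_dvd:
  assumes "Poly (1 # bs) dvd N"
  shows "Poly (1 # bs) dvd Poly (fold (carry bs) (map (coeff N) [0..<k]) []) - poly_shift k N"
proof (rule dvd_monom_mult_cancel)
  let ?P = "Poly (1 # bs)" and ?C = "fold (carry bs) (map (coeff N) [0..<k]) []"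
  have "monom 1 k * (Poly ?C - poly_shift k N)
     = (Poly (map (coeff N) [0..<k]) + monom 1 k * Poly ?C) - N"
    using poly_cutoff_shift[of N k] by (simp add: algebra_simps)
  also have "?P dvd \<dots>"
    using fold_carry_dvd[of bs "map (coeff N) [0..<k]"] assms by (intro dvd_diff) auto
  finally show "?P dvd monom 1 k * (Poly ?C - poly_shift k N)" .
qed

section \<open>Fixed point arithmetic\<close>

text \<open>This is 2^20. The common denominator makes integer linear combinations exact, so only
  products need rounding.\<close>

definition scale :: int where "scale = 1048576"

lemma scale_pos: "scale > 0"
  by (simp add: scale_def)

definition approx :: "int \<times> int \<Rightarrow> complex" where
  "approx w = Complex (of_int (fst w) / of_int scale) (of_int (snd w) / of_int scale)"

lemma approx_lin:
  "approx (c * u + x, c * v + y) = of_int c * approx (u, v) + approx (x, y)"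
  by (simp add: approx_def complex_eq_iff add_divide_distrib)

text \<open>
  With \<open>z = approx (p, q)\<close>, the \<open>i\<close>-th entry of \<open>table p q w bs\<close> is \<open>w z\<^sup>i\<close> up to rounding; \<open>bs\<close> serves only
  as a counter. If the \<open>i\<close>-th entry is off by at most \<open>e + i t\<close> units, then \<open>dot_error e t cs\<close> bounds the error
  of the linear combination with coefficients \<open>cs\<close>.
\<close>

fun table :: "int \<Rightarrow> int \<Rightarrow> int \<times> int \<Rightarrow> 'a list \<Rightarrow> (int \<times> int) list" where
  "table p q w [] = [w]"
| "table p q (u, v) (b # bs) =
     (u, v) # table p q ((u * p - v * q) div scale, (u * q + v * p) div scale) bs"

fun dot_fst :: "int list \<Rightarrow> (int \<times> int) list \<Rightarrow> int" where
  "dot_fst (c # cs) ((u, v) # ws) = c * u + dot_fst cs ws"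
| "dot_fst _ _ = 0"

fun dot_snd :: "int list \<Rightarrow> (int \<times> int) list \<Rightarrow> int" where
  "dot_snd (c # cs) ((u, v) # ws) = c * v + dot_snd cs ws"
| "dot_snd _ _ = 0"

fun dot_error :: "int \<Rightarrow> int \<Rightarrow> int list \<Rightarrow> int" where
  "dot_error e t [] = 0"
| "dot_error e t (c # cs) = \<bar>c\<bar> * e + dot_error (e + t) t cs"

text \<open>\<open>div\<close> moves each coordinate by at most one unit, and the norm is estimated
  by the sum of the two coordinates, hence 2.\<close>

lemma approx_mult_div:
  "norm (approx ((u * p - v * q) div scale, (u * q + v * p) div scale) - approx (u, v) * approx (p, q))
    \<le> 2 / of_int scale"
proof -
  have S: "real_of_int scale > 0" using scale_pos by simp
  have div: "\<bar>real_of_int (x div scale) - of_int x / of_int scale\<bar> \<le> 1" for x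
    unfolding floor_divide_of_int_eq[symmetric, where ?'a = real] by linarith
  let ?d = "approx ((u * p - v * q) div scale, (u * q + v * p) div scale) - approx (u, v) * approx (p, q)"
  have "Re ?d = (of_int ((u * p - v * q) div scale) - of_int (u * p - v * q) / of_int scale) / of_int scale"
    "Im ?d = (of_int ((u * q + v * p) div scale) - of_int (u * q + v * p) / of_int scale) / of_int scale"
    using S by (simp_all add: approx_def field_simps)
  moreover have "\<bar>(of_int (x div scale) - of_int x / of_int scale) / of_int scale\<bar> \<le> 1 / real_of_int scale" for x
    unfolding abs_divide using div[of x] S by (intro frac_le) auto
  ultimately have "\<bar>Re ?d\<bar> \<le> 1 / of_int scale" "\<bar>Im ?d\<bar> \<le> 1 / of_int scale"
    by metis+
  then show ?thesis
    using cmod_le[of ?d] by simp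
qed

text \<open>Passing to the next power costs 2 units of rounding, does not enlarge the old error
  since |z| <= 1, and adds |W| times the error D of the point, at most 4 D; hence the increment 4 D
  + 2. The bound 4 fits the start value 2 (1 - a) and survives the replacement of W by W a in the
  induction. The table has one entry more than \<open>bs\<close>; \<open>dot_fst\<close> and
  \<open>dot_snd\<close> would silently cut off a longer \<open>cs\<close>, which the length
  condition prevents.\<close>

lemma table_error:
  fixes W a :: complex
  assumes "norm (approx w - W) \<le> of_int e / of_int scale" "norm W \<le> 4"
    and pq: "norm (approx (p, q) - a) \<le> of_int D / of_int scale" "norm (approx (p, q)) \<le> 1"
    and a: "norm a \<le> 1"
    and "length cs \<le> Suc (length bs)"
  shows "norm (approx (dot_fst cs (table p q w bs), dot_snd cs (table p q w bs)) - W * ieval (Poly cs) a)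
    \<le> of_int (dot_error e (4 * D + 2) cs) / of_int scale"
  using assms(1,2,6)
proof (induction bs arbitrary: w W e cs)
  case Nil
  obtain u v where w: "w = (u, v)" by fastforce
  show ?case
  proof (cases cs)
    case Nil
    then show ?thesis by (simp add: approx_def complex_eq_iff)
  next
    case (Cons c ds)
    then have cs: "cs = [c]" using Nil.prems(3) by simp
    have "approx (c * u, c * v) - W * of_int c = of_int c * (approx w - W)"
      using approx_lin[of c u 0 v 0] by (simp add: w approx_def complex_eq_iff algebra_simps)
    then show ?thesis
      using mult_left_mono[OF Nil.prems(1), of "\<bar>of_int c\<bar>"] by (simp add: cs w norm_mult)
  qed
next
  case (Cons b bs)
  obtain u v where w: "w = (u, v)" by fastforce
  define w' where "w' = ((u * p - v * q) div scale, (u * q + v * p) div scale)"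
  have S: "real_of_int scale > 0" using scale_pos by simp
  show ?case
  proof (cases cs)
    case Nil
    then show ?thesis by (simp add: approx_def complex_eq_iff)
  next
    case cs: (Cons c ds)
    \<comment> \<open>Rounding error, propagated old error and error of the point, in this
      order.\<close>
    have "approx w' - W * a = (approx w' - approx w * approx (p, q))
        + (approx w - W) * approx (p, q) + W * (approx (p, q) - a)"
      by (simp add: algebra_simps)
    also have "norm \<dots> \<le> norm (approx w' - approx w * approx (p, q))
        + norm ((approx w - W) * approx (p, q)) + norm (W * (approx (p, q) - a))"
      by (intro order_trans[OF norm_triangle_ineq] add_right_mono norm_triangle_ineq)
    also have "\<dots> \<le> 2 / of_int scale + (of_int e / of_int scale) * 1 + 4 * (of_int D / of_int scale)"
      unfolding norm_mult
      using approx_mult_div[of u p v q] Cons.prems(1,2) pq order_trans[OF norm_ge_zero Cons.prems(1)]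
      by (intro add_mono mult_mono) (auto simp: w w'_def)
    also have "\<dots> = of_int (e + (4 * D + 2)) / of_int scale"
      by (simp add: add_divide_distrib)
    finally have 1: "norm (approx w' - W * a) \<le> of_int (e + (4 * D + 2)) / of_int scale" .
    have 2: "norm (W * a) \<le> 4"
      using mult_mono[OF Cons.prems(2) a] by (simp add: norm_mult)
    let ?T = "table p q w' bs"
    have IH: "norm (approx (dot_fst ds ?T, dot_snd ds ?T) - W * a * ieval (Poly ds) a)
        \<le> of_int (dot_error (e + (4 * D + 2)) (4 * D + 2) ds) / of_int scale"
      using Cons.prems(3) by (intro Cons.IH[OF 1 2]) (simp add: cs)
    have "approx (dot_fst cs (table p q w (b # bs)), dot_snd cs (table p q w (b # bs))) - W * ieval (Poly cs) a
        = of_int c * (approx w - W) + (approx (dot_fst ds ?T, dot_snd ds ?T) - W * a * ieval (Poly ds) a)"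
      by (simp add: cs w w'_def approx_lin algebra_simps)
    also have "norm \<dots> \<le> \<bar>of_int c\<bar> * norm (approx w - W)
        + norm (approx (dot_fst ds ?T, dot_snd ds ?T) - W * a * ieval (Poly ds) a)"
      by (intro order_trans[OF norm_triangle_ineq]) (simp add: norm_mult)
    also have "\<dots> \<le> \<bar>of_int c\<bar> * (of_int e / of_int scale)
        + of_int (dot_error (e + (4 * D + 2)) (4 * D + 2) ds) / of_int scale"
      using Cons.prems(1) IH by (intro add_mono mult_left_mono) auto
    also have "\<dots> = of_int (dot_error e (4 * D + 2) cs) / of_int scale"
      by (simp add: cs add_divide_distrib)
    finally show ?thesis .
  qed
qed

text \<open>Called with k = 1 on the B of P = 1 + X B, it yields P' = B + X B'; the general k
  carries the recursion.\<close>

fun pderiv_list :: "int \<Rightarrow> int list \<Rightarrow> int list" where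
  "pderiv_list k [] = []"
| "pderiv_list k (b # bs) = k * b # pderiv_list (k + 1) bs"

lemma Poly_pderiv_list:
  "Poly (pderiv_list k bs) = smult k (Poly bs) + pCons 0 (pderiv (Poly bs))"
  by (induction k bs rule: pderiv_list.induct)
    (simp_all add: pderiv_pCons smult_add_left algebra_simps)

lemma length_pderiv_list [simp]: "length (pderiv_list k bs) = length bs"
  by (induction k bs rule: pderiv_list.induct) simp_all

section \<open>Certified roots\<close>

text \<open>
  In units of \<open>1 / scale\<close>, the data \<open>(p, q, D, h, R)\<close> describe a root \<open>a\<close> at distance at most \<open>D\<close> from
  \<open>p + i q\<close>, with \<open>\<bar>a\<bar> \<le> h\<close> and \<open>\<bar>1 - a\<bar> / (1 - \<bar>a\<bar>) \<le> R\<close>. The table starts from \<open>2 (1 - z)\<close>, so that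
  its linear combinations are directly the quantities bounded for polynomials with digits 0 and 1.
\<close>

type_synonym root_data = "int \<times> int \<times> int \<times> int \<times> int"

definition root_table :: "int \<Rightarrow> int \<Rightarrow> int list \<Rightarrow> (int \<times> int) list" where
  "root_table p q bs = table p q (2 * scale - 2 * p, - 2 * q) bs"

text \<open>Tests deg P |W P(z)| <= D |W P'(z)|: the factor W = 2 (1 - z) of the table cancels, so
  one table serves here and in the search. The upper bound takes the sum of the coordinates, the
  lower bound the larger of them, each corrected by the rounding error; the parameters 0 and 2
  express that z itself is exact. A root near z is certified to exist, not to be the only
  one.\<close>

definition root_isolated :: "int list \<Rightarrow> int \<Rightarrow> (int \<times> int) list \<Rightarrow> bool" where
  "root_isolated bs D ws \<longleftrightarrow>
    (let cs = 1 # bs; ds = pderiv_list 1 bs;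
         m = max \<bar>dot_fst ds ws\<bar> \<bar>dot_snd ds ws\<bar> - dot_error 0 2 ds
     in 0 < m \<and>
        int (length bs) * scale * (\<bar>dot_fst cs ws\<bar> + \<bar>dot_snd cs ws\<bar> + dot_error 0 2 cs) \<le> D * m)"

text \<open>The third condition says |z| <= h - D, whence |a| <= h. The last two say |1 - z| + D <=
  R (1 - h) when read as real numbers, which gives |1 - a| <= R (1 - |a|). The comparison is squared
  to avoid roots, and \<open>scale * D \<le> R * (scale - h)\<close> ensures that the number squared
  on the right is nonnegative.\<close>

fun valid_root :: "int list \<Rightarrow> root_data \<Rightarrow> bool" where
  "valid_root bs (p, q, D, h, R) \<longleftrightarrow>
     D \<le> h \<and> h < scale \<and> p * p + q * q \<le> (h - D) * (h - D) \<and>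
     root_isolated bs D (root_table p q bs) \<and>
     scale * D \<le> R * (scale - h) \<and>
     ((scale - p) * (scale - p) + q * q) * (scale * scale)
       \<le> (R * (scale - h) - scale * D) * (R * (scale - h) - scale * D)"

lemma degree_Poly_last:
  assumes "last (1 # bs) \<noteq> (0 :: int)"
  shows "degree (Poly (1 # bs)) = length bs"
proof (rule antisym)
  show "degree (Poly (1 # bs)) \<le> length bs"
    by (rule degree_le) (auto simp: nth_default_def simp del: Poly.simps)
  have "coeff (Poly (1 # bs)) (length bs) = last (1 # bs)"
    by (subst last_conv_nth) (simp_all add: nth_default_def del: Poly.simps)
  then show "length bs \<le> degree (Poly (1 # bs))"
    using assms by (intro le_degree) simp
qed

lemma norm_approx_le:
  assumes "u * u + v * v \<le> r * r" "0 \<le> r"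
  shows "norm (approx (u, v)) \<le> of_int r / of_int scale"
proof -
  have S: "real_of_int scale > 0" using scale_pos by simp
  have "real_of_int (u * u + v * v) \<le> of_int (r * r)"
    using assms(1) by (simp only: of_int_le_iff)
  then have "norm (approx (u, v)) \<le> sqrt ((of_int r / of_int scale)\<^sup>2)"
    using S by (simp add: approx_def cmod_def power2_eq_square divide_right_mono flip: add_divide_distrib)
  then show ?thesis using assms(2) S by simp
qed

lemma valid_rootE:
  assumes "valid_root bs (p, q, D, h, R)" and last: "last (1 # bs) \<noteq> 0" and "bs \<noteq> []"
  obtains a where "ieval (Poly (1 # bs)) a = 0" "norm (approx (p, q) - a) \<le> of_int D / of_int scale"
    "norm (approx (p, q)) \<le> 1" "norm a < 1" "norm (1 - a) / (1 - norm a) \<le> of_int R / of_int scale"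
proof -
  have S: "real_of_int scale > 0" using scale_pos by simp
  define z where "z = approx (p, q)"
  define ws where "ws = root_table p q bs"
  define ds where "ds = pderiv_list 1 bs"
  define m where "m = max \<bar>dot_fst ds ws\<bar> \<bar>dot_snd ds ws\<bar> - dot_error 0 2 ds"
  define f where "f = \<bar>dot_fst (1 # bs) ws\<bar> + \<bar>dot_snd (1 # bs) ws\<bar> + dot_error 0 2 (1 # bs)"
  have h: "D \<le> h" "h < scale" "p * p + q * q \<le> (h - D) * (h - D)"
    and m: "0 < m" "int (length bs) * scale * f \<le> D * m"
    and R: "scale * D \<le> R * (scale - h)"
      "((scale - p) * (scale - p) + q * q) * (scale * scale)
       \<le> (R * (scale - h) - scale * D) * (R * (scale - h) - scale * D)"
    using assms(1)
    by (auto simp: root_isolated_def Let_def ws_def ds_def m_def f_def simp del: dot_fst.simps dot_snd.simps dot_error.simps)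
  have z: "norm z \<le> of_int (h - D) / of_int scale"
    unfolding z_def using h by (intro norm_approx_le) auto
  have f0: "f \<ge> 0"
  proof -
    have "0 \<le> e \<Longrightarrow> 0 \<le> dot_error e 2 cs" for e cs
      by (induction cs arbitrary: e) auto
    then show ?thesis unfolding f_def by (simp only: add_nonneg_nonneg abs_ge_zero)
  qed
  \<comment> \<open>The sign of D follows from the isolation test: 0 <= deg P * scale * f <= D * m
    with m > 0.\<close>
  have D: "0 \<le> D"
  proof -
    have "0 \<le> D * m" using m f0 scale_pos by (intro order_trans[OF _ m(2)]) simp
    then show ?thesis using m(1) by (simp add: zero_le_mult_iff)
  qed
  have "of_int (h - D) / of_int scale < (1 :: real)"
    using h D S by (simp add: field_simps)
  with z have z1: "norm z < 1" by simp
  define W where "W = 2 * (1 - z)"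
  have "norm W = 2 * norm (1 - z)"
    by (simp only: W_def norm_mult norm_numeral)
  then have W4: "norm W \<le> 4"
    using norm_triangle_ineq4[of 1 z] z1 by simp
  have W: "approx (2 * scale - 2 * p, - 2 * q) = W"
    using S by (simp add: approx_def z_def W_def complex_eq_iff diff_divide_distrib)
  \<comment> \<open>The table error for a = z: start value and point are exact, so only rounding
    remains.\<close>
  have err: "norm (approx (dot_fst cs ws, dot_snd cs ws) - W * ieval (Poly cs) z)
      \<le> of_int (dot_error 0 2 cs) / of_int scale" if "length cs \<le> Suc (length bs)" for cs
  proof -
    have "norm (approx (dot_fst cs ws, dot_snd cs ws) - W * ieval (Poly cs) z)
        \<le> of_int (dot_error 0 (4 * 0 + 2) cs) / of_int scale"
      unfolding ws_def root_table_def
    proof (rule table_error)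
      show "norm (approx (2 * scale - 2 * p, - 2 * q) - W) \<le> of_int 0 / of_int scale"
        unfolding W by simp
      show "norm (approx (p, q) - z) \<le> of_int 0 / of_int scale"
        by (simp add: z_def)
    qed (use W4 z1 that in \<open>auto simp: z_def\<close>)
    then show ?thesis by simp
  qed
  have "norm (W * ieval (Poly (1 # bs)) z)
      \<le> norm (approx (dot_fst (1 # bs) ws, dot_snd (1 # bs) ws)) + of_int (dot_error 0 2 (1 # bs)) / of_int scale"
    using err[of "1 # bs"] norm_triangle_ineq3[of "approx (dot_fst (1 # bs) ws, dot_snd (1 # bs) ws)" "W * ieval (Poly (1 # bs)) z"]
    unfolding abs_le_iff length_Cons by linarith
  also have "norm (approx (dot_fst (1 # bs) ws, dot_snd (1 # bs) ws))
      \<le> (\<bar>of_int (dot_fst (1 # bs) ws)\<bar> + \<bar>of_int (dot_snd (1 # bs) ws)\<bar>) / of_int scale"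
    using S by (intro order_trans[OF cmod_le]) (simp add: approx_def add_divide_distrib abs_divide)
  finally have F: "norm (W * ieval (Poly (1 # bs)) z) \<le> of_int f / of_int scale"
    by (simp add: f_def add_divide_distrib del: dot_fst.simps dot_snd.simps dot_error.simps)
  have pd: "Poly ds = pderiv (Poly (1 # bs))"
    by (simp add: ds_def Poly_pderiv_list pderiv_pCons)
  have "of_int (max \<bar>dot_fst ds ws\<bar> \<bar>dot_snd ds ws\<bar>) / of_int scale \<le> norm (approx (dot_fst ds ws, dot_snd ds ws))"
    using abs_Re_le_cmod[of "approx (dot_fst ds ws, dot_snd ds ws)"]
      abs_Im_le_cmod[of "approx (dot_fst ds ws, dot_snd ds ws)"] S
    by (auto simp: approx_def max_def abs_divide)
  also have "\<dots> \<le> norm (W * ieval (Poly ds) z) + of_int (dot_error 0 2 ds) / of_int scale"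
    using err[of ds] norm_triangle_ineq2[of "approx (dot_fst ds ws, dot_snd ds ws)" "W * ieval (Poly ds) z"]
    by (simp add: ds_def)
  finally have G: "of_int m / of_int scale \<le> norm (W * ieval (pderiv (Poly (1 # bs))) z)"
    unfolding pd by (simp only: m_def of_int_diff diff_divide_distrib)
  obtain a where a: "ieval (Poly (1 # bs)) a = 0"
    "norm (z - a) * norm (ieval (pderiv (Poly (1 # bs))) z) \<le> length bs * norm (ieval (Poly (1 # bs)) z)"
    using exists_ieval_root_near[of "Poly (1 # bs)" z] degree_Poly_last[OF last] \<open>bs \<noteq> []\<close>
    by (auto simp del: Poly.simps)
  \<comment> \<open>The root estimate is multiplied by |W|, so that P(z) and P'(z) appear in the
    form in which the table bounds them; positivity of m then permits the division.\<close>
  have "norm (z - a) * (of_int m / of_int scale)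
      \<le> norm (z - a) * norm (W * ieval (pderiv (Poly (1 # bs))) z)"
    using G by (intro mult_left_mono) auto
  also have "\<dots> = norm W * (norm (z - a) * norm (ieval (pderiv (Poly (1 # bs))) z))"
    by (simp only: norm_mult ac_simps)
  also have "\<dots> \<le> norm W * (length bs * norm (ieval (Poly (1 # bs)) z))"
    using a(2) by (intro mult_left_mono) auto
  also have "\<dots> = length bs * norm (W * ieval (Poly (1 # bs)) z)"
    by (simp only: norm_mult ac_simps)
  also have "\<dots> \<le> length bs * (of_int f / of_int scale)"
    using F by (intro mult_left_mono) auto
  finally have "norm (z - a) * of_int m * of_int scale \<le> real_of_int (int (length bs) * scale * f)"
    using S by (simp add: field_simps)
  also have "\<dots> \<le> of_int (D * m)"
    using m(2) by (simp only: of_int_le_iff)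
  finally have "(norm (z - a) * of_int scale) * of_int m \<le> of_int D * of_int m"
    by (simp add: ac_simps)
  then have za: "norm (z - a) \<le> of_int D / of_int scale"
    using m(1) S by (simp add: field_simps)
  have "norm a \<le> norm z + norm (z - a)"
    using norm_triangle_ineq4[of z "z - a"] by simp
  with z za have na: "norm a \<le> of_int h / of_int scale"
    by (simp add: diff_divide_distrib)
  then have a1: "norm a < 1"
    using h(2) S by (smt (verit) divide_less_eq_1_pos of_int_less_iff)
  \<comment> \<open>In real terms k / scale^2 is R (1 - h) - D. The extra factor
    \<open>scale\<close> in both coordinates below turns the comparison of squares in
    \<open>valid_root\<close> into an instance of \<open>norm_approx_le\<close> with radius
    k.\<close>
  define k where "k = R * (scale - h) - scale * D"
  have "norm (approx ((scale - p) * scale, q * scale)) \<le> of_int k / of_int scale"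
    using R by (intro norm_approx_le) (simp_all add: k_def algebra_simps)
  moreover have "norm (approx ((scale - p) * scale, q * scale)) = of_int scale * norm (1 - z)"
  proof -
    \<comment> \<open>Conjugation accounts for the sign of q in 1 - z and leaves the norm
      unchanged.\<close>
    have "approx ((scale - p) * scale, q * scale) = of_int scale * cnj (1 - z)"
      using S by (simp add: approx_def z_def complex_eq_iff field_simps)
    then show ?thesis
      using S by (simp only: norm_mult complex_mod_cnj norm_of_int abs_of_pos)
  qed
  ultimately have "of_int scale * norm (1 - z) \<le> of_int k / of_int scale"
    by simp
  moreover have "norm (1 - a) * of_int scale \<le> (norm (1 - z) + norm (z - a)) * of_int scale"
    using norm_triangle_ineq[of "1 - z" "z - a"] S by (intro mult_right_mono) auto
  moreover have "norm (z - a) * of_int scale \<le> of_int D"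
    using za S by (simp add: field_simps)
  ultimately have "norm (1 - a) * of_int scale \<le> of_int k / of_int scale + of_int D"
    unfolding distrib_right by (simp only: mult.commute)
  also have "\<dots> = of_int R * (1 - of_int h / of_int scale)"
    using S by (simp add: k_def field_simps)
  also have "\<dots> \<le> of_int R * (1 - norm a)"
  proof -
    have "0 \<le> R * (scale - h)" using R(1) D scale_pos by (smt (verit) mult_nonneg_nonneg)
    then have "0 \<le> R" using h(2) by (simp add: zero_le_mult_iff)
    then show ?thesis using na by (intro mult_left_mono) auto
  qed
  finally have "norm (1 - a) / (1 - norm a) \<le> of_int R / of_int scale"
    using a1 S by (simp add: field_simps)
  then show ?thesis
    using that[OF a(1)] za z1 a1 by (simp add: z_def)
qed

section \<open>Exhaustive search for Newman multiples\<close>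

text \<open>A residue is discarded only if its computed value lies outside the disc enlarged by the
  full error, so rounding can prolong a search but never lose a tail. The initial error is 2 D
  because 2 (1 - z) may be that far from 2 (1 - a).\<close>

fun escapes :: "((int \<times> int) list \<times> int \<times> int) list \<Rightarrow> int list \<Rightarrow> bool" where
  "escapes [] cs = False"
| "escapes ((ws, D, R) # rs) cs =
    (let x = dot_fst cs ws - scale; y = dot_snd cs ws; r = R + dot_error (2 * D) (4 * D + 2) cs
     in if r * r < x * x + y * y then True else escapes rs cs)"

fun prune_data :: "int list \<Rightarrow> root_data \<Rightarrow> (int \<times> int) list \<times> int \<times> int" where
  "prune_data bs (p, q, D, h, R) = (root_table p q bs, D, R)"

text \<open>At a root of P the carry and the tail take the same value, so the disc for 0-1
  polynomials constrains the known carry although the tail is unknown.\<close>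

lemma not_escapes:
  assumes "\<forall>r\<in>set rs. valid_root bs r" and "last (1 # bs) \<noteq> 0" "bs \<noteq> []"
    and "length cs \<le> length bs" and "Poly (1 # bs) dvd Poly cs - N"
    and "\<And>i. coeff N i \<in> {0, 1}"
  shows "\<not> escapes (map (prune_data bs) rs) cs"
  using assms(1)
proof (induction rs)
  case Nil
  then show ?case by simp
next
  case (Cons r rs)
  obtain p q D h R where r: "r = (p, q, D, h, R)" by (cases r) auto
  have S: "real_of_int scale > 0" using scale_pos by simp
  have "valid_root bs (p, q, D, h, R)" using Cons.prems by (simp add: r)
  then obtain a where a: "ieval (Poly (1 # bs)) a = 0"
    "norm (approx (p, q) - a) \<le> of_int D / of_int scale"
    "norm (approx (p, q)) \<le> 1" "norm a < 1"
    "norm (1 - a) / (1 - norm a) \<le> of_int R / of_int scale"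
    using assms(2,3) by (rule valid_rootE)
  have "ieval (Poly cs - N) a = 0" using assms(5) a(1) by (rule ieval_dvd)
  then have N: "ieval N a = ieval (Poly cs) a" by simp
  define W where "W = 2 * (1 - a)"
  have "norm W = 2 * norm (1 - a)"
    by (simp only: W_def norm_mult norm_numeral)
  then have W4: "norm W \<le> 4"
    using norm_triangle_ineq4[of 1 a] a(4) by simp
  have "approx (2 * scale - 2 * p, - 2 * q) - W = - 2 * (approx (p, q) - a)"
    using S by (simp add: approx_def W_def complex_eq_iff diff_divide_distrib)
  then have "norm (approx (2 * scale - 2 * p, - 2 * q) - W) = 2 * norm (approx (p, q) - a)"
    by (simp only: norm_mult) simp
  also have "\<dots> \<le> of_int (2 * D) / of_int scale" using a(2) by simp
  finally have W: "norm (approx (2 * scale - 2 * p, - 2 * q) - W) \<le> of_int (2 * D) / of_int scale" .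
  define ws where "ws = root_table p q bs"
  define E where "E = dot_error (2 * D) (4 * D + 2) cs"
  have err: "norm (approx (dot_fst cs ws, dot_snd cs ws) - W * ieval (Poly cs) a) \<le> of_int E / of_int scale"
    unfolding ws_def root_table_def E_def using a(4) assms(4)
    by (intro table_error[OF W W4 a(2,3)]) auto
  have bound: "norm (W * ieval (Poly cs) a - 1) \<le> of_int R / of_int scale"
    using zero_one_poly_eval_bound[OF assms(6) a(4)] a(5) by (simp only: N W_def)
  define x y where "x = dot_fst cs ws - scale" and "y = dot_snd cs ws"
  \<comment> \<open>Evaluation error plus centred value of the tail: the triangle inequality gives
    the radius R + E of the test.\<close>
  have "approx (x, y) = (approx (dot_fst cs ws, dot_snd cs ws) - W * ieval (Poly cs) a)
      + (W * ieval (Poly cs) a - 1)"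
    using S by (simp add: approx_def x_def y_def complex_eq_iff diff_divide_distrib)
  then have "norm (approx (x, y)) \<le> of_int E / of_int scale + of_int R / of_int scale"
    using err bound norm_triangle_ineq by (smt (verit))
  also have "\<dots> = of_int (R + E) / of_int scale" by (simp add: add_divide_distrib)
  finally have "(norm (approx (x, y)))\<^sup>2 \<le> (of_int (R + E) / of_int scale)\<^sup>2"
    by (intro power_mono) auto
  then have "real_of_int (x * x + y * y) \<le> of_int ((R + E) * (R + E))"
    using S unfolding approx_def cmod_power2
    by (simp add: power2_eq_square divide_le_cancel flip: add_divide_distrib)
  then have "x * x + y * y \<le> (R + E) * (R + E)" by (simp only: of_int_le_iff)
  then show ?case
    using Cons by (simp add: r Let_def x_def y_def ws_def E_def)
qed

text \<open>Depth-first search with fuel n, one unit for each state taken from the worklist,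
  repeated ones included. Running out of fuel yields False, so only the answer True carries
  information and the bound in a certificate needs no justification.\<close>

fun explore :: "('a \<Rightarrow> 'a list) \<Rightarrow> ('a \<Rightarrow> bool) \<Rightarrow> nat \<Rightarrow> 'a list \<Rightarrow> 'a list \<Rightarrow> bool" where
  "explore nxt final n vs [] = True"
| "explore nxt final 0 vs (s # ss) = False"
| "explore nxt final (Suc n) vs (s # ss) =
    (if s \<in> set vs then explore nxt final n vs ss
     else if final s then False else explore nxt final n (s # vs) (nxt s @ ss))"

text \<open>The invariant is that successors of visited states are visited or pending. Once nothing
  is pending, the visited states are closed under successors and contain no final state.\<close>

lemma explore_closed:
  assumes "explore nxt final n vs ss"
    and "\<forall>v\<in>set vs. \<not> final v \<and> set (nxt v) \<subseteq> set vs \<union> set ss"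
  shows "\<exists>V. set vs \<union> set ss \<subseteq> V \<and> (\<forall>v\<in>V. \<not> final v \<and> set (nxt v) \<subseteq> V)"
  using assms
proof (induction nxt final n vs ss rule: explore.induct)
  case (1 nxt final n vs)
  then show ?case by (intro exI[of _ "set vs"]) auto
next
  case (2 nxt final vs s ss)
  then show ?case by simp
next
  case (3 nxt final n vs s ss)
  show ?case
  proof (cases "s \<in> set vs")
    case True
    with 3 have "\<exists>V. set vs \<union> set ss \<subseteq> V \<and> (\<forall>v\<in>V. \<not> final v \<and> set (nxt v) \<subseteq> V)"
      by (intro "3.IH"(1)) auto
    then obtain V where "set vs \<union> set ss \<subseteq> V" "\<forall>v\<in>V. \<not> final v \<and> set (nxt v) \<subseteq> V" by blast
    with True show ?thesis by (intro exI[of _ V]) auto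
  next
    case False
    with 3 have "\<exists>V. set (s # vs) \<union> set (nxt s @ ss) \<subseteq> V \<and> (\<forall>v\<in>V. \<not> final v \<and> set (nxt v) \<subseteq> V)"
      by (intro "3.IH"(2)) (auto split: if_splits)
    then obtain V where "set (s # vs) \<union> set (nxt s @ ss) \<subseteq> V" "\<forall>v\<in>V. \<not> final v \<and> set (nxt v) \<subseteq> V"
      by blast
    then show ?thesis by (intro exI[of _ V]) auto
  qed
qed

text \<open>The start is the carry after the digit 1, the constant term of a Newman polynomial. The
  zero residue before any digit is itself final, so the search cannot begin there.\<close>

definition no_newman :: "int list \<Rightarrow> nat \<Rightarrow> root_data list \<Rightarrow> bool" where
  "no_newman bs n rs \<longleftrightarrow> list_all (valid_root bs) rs \<and>
    (let ds = map (prune_data bs) rs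
     in explore (\<lambda>cs. filter (\<lambda>cs. \<not> escapes ds cs) [carry bs 0 cs, carry bs 1 cs])
          (list_all (\<lambda>c. c = 0)) n [] [carry bs 1 []])"

text \<open>The carries of N form a path inside the closed set, since its digits are 0 or 1 and no
  carry of an actual multiple escapes. After the last digit the tail is 0, so P divides a carry of
  smaller degree; that carry is 0, a final state.\<close>

lemma no_newman_sound:
  assumes "no_newman bs n rs" and bs: "last (1 # bs) \<noteq> 0" "bs \<noteq> []" and "newman_poly N"
  shows "\<not> Poly (1 # bs) dvd N"
proof
  assume dvd: "Poly (1 # bs) dvd N"
  let ?nxt = "\<lambda>cs. filter (\<lambda>cs. \<not> escapes (map (prune_data bs) rs) cs) [carry bs 0 cs, carry bs 1 cs]"
  let ?final = "list_all (\<lambda>c. c = (0 :: int))"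
  obtain V where V: "carry bs 1 [] \<in> V" "\<And>v. v \<in> V \<Longrightarrow> \<not> ?final v \<and> set (?nxt v) \<subseteq> V"
    using explore_closed[of ?nxt ?final n "[]" "[carry bs 1 []]"] assms(1)
    by (auto simp: no_newman_def Let_def)
  have valid: "\<forall>r\<in>set rs. valid_root bs r"
    using assms(1) by (simp add: no_newman_def list_all_iff)
  define C where "C k = fold (carry bs) (map (coeff N) [0..<k]) []" for k
  have C_Suc: "C (Suc k) = carry bs (coeff N k) (C k)" for k
    by (simp add: C_def)
  have C_dvd: "Poly (1 # bs) dvd Poly (C k) - poly_shift k N" for k
    unfolding C_def using dvd by (rule carry_tail_dvd)
  have len: "length (C k) \<le> length bs" for k
    by (simp add: C_def length_fold_carry)
  \<comment> \<open>The index starts at \<open>Suc k\<close> because \<open>C 0\<close> is the empty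
    list, a final state and hence outside V.\<close>
  have C_V: "C (Suc k) \<in> V" for k
  proof (induction k)
    case 0
    have "coeff N 0 = 1" using assms(4) by (simp add: newman_poly_def poly_0_coeff_0)
    then show ?case using V(1) by (simp add: C_def)
  next
    case (Suc k)
    have "\<not> escapes (map (prune_data bs) rs) (C (Suc (Suc k)))"
      using newman_coeff[OF assms(4)]
      by (intro not_escapes[OF valid bs len C_dvd]) (auto simp: coeff_poly_shift)
    then have "C (Suc (Suc k)) \<in> set (?nxt (C (Suc k)))"
      using newman_coeff[OF assms(4), of "Suc k"] unfolding C_Suc[of "Suc k"] by auto
    then show ?case using V(2)[OF Suc] by blast
  qed
  have "poly_shift (Suc (degree N)) N = 0"
    by (simp add: poly_eq_iff coeff_poly_shift coeff_eq_0)
  then have "Poly (1 # bs) dvd Poly (C (Suc (degree N)))"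
    using C_dvd[of "Suc (degree N)"] by simp
  moreover have "degree (Poly (C (Suc (degree N)))) < degree (Poly (1 # bs))"
  proof -
    have "degree (Poly (C (Suc (degree N)))) \<le> length bs - 1"
      using len[of "Suc (degree N)"] by (intro degree_le) (auto simp: nth_default_def)
    then show ?thesis
      using bs(2) unfolding degree_Poly_last[OF bs(1)] by (cases bs) auto
  qed
  ultimately have "Poly (C (Suc (degree N))) = 0"
    using dvd_imp_degree_le by (metis not_le)
  then have "?final (C (Suc (degree N)))"
    by (auto simp: Poly_eq_0 list_all_iff)
  then show False using V(2)[OF C_V] by blast
qed

section \<open>Littlewood multiples\<close>

text \<open>The leading binary digit of the numeral only marks the end of the coefficient list.\<close>

fun littlewood_digits :: "num \<Rightarrow> int list" where
  "littlewood_digits num.One = []"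
| "littlewood_digits (num.Bit0 n) = - 1 # littlewood_digits n"
| "littlewood_digits (num.Bit1 n) = 1 # littlewood_digits n"

text \<open>Decodes and divides in one pass; the lowest bit of the numeral is the constant term of
  the multiple.\<close>

fun run_carry :: "int list \<Rightarrow> num \<Rightarrow> int list \<Rightarrow> int list" where
  "run_carry bs num.One cs = cs"
| "run_carry bs (num.Bit0 n) cs = run_carry bs n (carry bs (- 1) cs)"
| "run_carry bs (num.Bit1 n) cs = run_carry bs n (carry bs 1 cs)"

lemma run_carry_eq: "run_carry bs n cs = fold (carry bs) (littlewood_digits n) cs"
  by (induction bs n cs rule: run_carry.induct) simp_all

lemma littlewood_digits_set: "set (littlewood_digits n) \<subseteq> {-1, 1}"
  by (induction n rule: littlewood_digits.induct) auto

lemma littlewood_Poly: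
  assumes "set ds \<subseteq> {-1, 1}" "ds \<noteq> []"
  shows "littlewood_poly (Poly ds)"
proof -
  have "degree (Poly ds) \<le> length ds - 1"
    by (rule degree_le) (auto simp: nth_default_def)
  then have "coeff (Poly ds) j \<in> {-1, 1}" if "j \<le> degree (Poly ds)" for j
  proof -
    have "j < length ds"
      using that \<open>degree (Poly ds) \<le> length ds - 1\<close> assms(2) by (cases ds) auto
    then have "ds ! j \<in> {-1, 1}"
      using assms(1) nth_mem by blast
    with \<open>j < length ds\<close> show ?thesis by (simp add: nth_default_def)
  qed
  then show ?thesis by (simp add: littlewood_poly_def)
qed

text \<open>Certificates contain decimal integer literals. A positive one is represented for
  evaluation as \<open>Int.Pos\<close> of exactly the wanted binary numeral, so the conversion costs
  nothing.\<close>

definition num_of_int :: "int \<Rightarrow> num" where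
  "num_of_int k = num_of_nat (nat k)"

lemma num_of_int_Pos [code]: "num_of_int (Int.Pos n) = n"
  by (simp add: num_of_int_def num_of_nat_numeral_eq)

text \<open>\<open>num.One\<close> stands for the empty digit list, whose polynomial 0 is divisible
  by everything but is not a Littlewood polynomial.\<close>

definition has_littlewood :: "int list \<Rightarrow> num \<Rightarrow> bool" where
  "has_littlewood bs n \<longleftrightarrow> n \<noteq> num.One \<and> list_all (\<lambda>c. c = 0) (run_carry bs n [])"

lemma has_littlewood_sound:
  assumes "has_littlewood bs n"
  shows "\<exists>L. littlewood_poly L \<and> Poly (1 # bs) dvd L"
proof -
  let ?ds = "littlewood_digits n"
  have "?ds \<noteq> []" using assms by (cases n) (auto simp: has_littlewood_def)
  then have "littlewood_poly (Poly ?ds)"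
    by (intro littlewood_Poly littlewood_digits_set)
  moreover have "Poly (fold (carry bs) ?ds []) = 0"
    using assms replicate_eqI[of "run_carry bs n []" "length (run_carry bs n [])" 0]
    unfolding has_littlewood_def run_carry_eq list_all_iff Poly_eq_0 by blast
  then have "Poly (1 # bs) dvd Poly ?ds"
    using fold_carry_dvd[of bs ?ds] by (simp del: Poly.simps)
  ultimately show ?thesis by blast
qed

section \<open>Positive roots\<close>

text \<open>For a list of length l > 0 this is q^(l - 1) times the value at p / q, so the sign at a
  positive rational is decided in integers.\<close>

fun homogenized :: "int \<Rightarrow> int \<Rightarrow> int list \<Rightarrow> int" where
  "homogenized p q [] = 0"
| "homogenized p q (b # bs) = b * q ^ length bs + p * homogenized p q bs"

text \<open>The extra factor q makes the exponent equal to \<open>length bs\<close>, for which the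
  Horner step goes through uniformly.\<close>

lemma ieval_homogenized:
  assumes "q > 0"
  shows "of_int (homogenized p q bs) * of_int q = of_int q ^ length bs * ieval (Poly bs) (of_int p / of_int q :: real)"
proof (induction bs)
  case Nil
  then show ?case by simp
next
  case (Cons b bs)
  have "of_int (homogenized p q (b # bs)) * of_int q
      = of_int b * of_int q ^ Suc (length bs) + of_int p * (of_int (homogenized p q bs) * real_of_int q)"
    by (simp add: distrib_right)
  also have "\<dots> = of_int q ^ Suc (length bs) * (of_int b + (of_int p / of_int q) * ieval (Poly bs) (of_int p / of_int q))"
    unfolding Cons.IH using assms by (simp add: distrib_left)
  finally show ?case by simp
qed

text \<open>P(0) = 1 is positive, so a nonpositive value further right forces a root in the interval
  from 0 to p / q, where Newman polynomials are positive.\<close>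

lemma homogenized_sound:
  assumes "homogenized p q (1 # bs) \<le> 0" "p > 0" "q > 0" "newman_poly N"
  shows "\<not> Poly (1 # bs) dvd N"
proof
  assume dvd: "Poly (1 # bs) dvd N"
  let ?P = "map_poly of_int (Poly (1 # bs)) :: real poly" and ?x = "of_int p / of_int q :: real"
  have "of_int (homogenized p q (1 # bs)) * of_int q \<le> (0 :: real)"
    using assms by (intro mult_nonpos_nonneg) (auto simp del: homogenized.simps)
  then have "poly ?P ?x \<le> 0"
    using zero_less_power[of "real_of_int q" "length (1 # bs)"] assms(3)
    unfolding ieval_homogenized[OF assms(3)] ieval_def mult_le_0_iff by linarith
  moreover have "poly ?P 0 = 1"
    using ieval_pCons[of 1 "Poly bs" "0 :: real"] by (simp add: ieval_def)
  moreover have "?x > 0" using assms by simp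
  \<comment> \<open>The intermediate value theorem is applied to a negative value; if P(p / q) = 0,
    the point itself is the root.\<close>
  ultimately obtain t where "t > 0" "poly ?P t = 0"
    using poly_IVT_neg[of 0 ?x ?P] by (cases "poly ?P ?x = 0") (auto simp del: Poly.simps)
  then have "ieval N t = 0"
    using dvd by (intro ieval_dvd[OF dvd]) (simp add: ieval_def)
  then show False using newman_eval_pos[OF assms(4), of t] \<open>t > 0\<close> by simp
qed

section \<open>Certificates\<close>

definition newman_imp_littlewood :: "int poly \<Rightarrow> bool" where
  "newman_imp_littlewood P \<longleftrightarrow>
    ((\<exists>N. newman_poly N \<and> P dvd N) \<longrightarrow> (\<exists>L. littlewood_poly L \<and> P dvd L))"

lemma newman_imp_littlewood_uminus:
  "newman_imp_littlewood (- P) \<longleftrightarrow> newman_imp_littlewood P"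
  by (simp add: newman_imp_littlewood_def)

section \<open>Symmetry under reversal of the coefficients\<close>

lemma newman_reflect:
  assumes "newman_poly N"
  shows "newman_poly (reflect_poly N)"
proof -
  have 0: "coeff N 0 = 1" using assms by (simp add: newman_poly_def poly_0_coeff_0)
  have "lead_coeff N = 1" using assms newman_coeff[OF assms, of "degree N"] by (auto simp: newman_poly_def)
  then show ?thesis
    using newman_coeff[OF assms] 0 by (auto simp: newman_poly_def coeff_reflect_poly)
qed

lemma littlewood_reflect:
  assumes "littlewood_poly L"
  shows "littlewood_poly (reflect_poly L)"
proof -
  have L: "coeff L j \<in> {-1, 1}" if "j \<le> degree L" for j
    using assms that unfolding littlewood_poly_def by blast
  have "coeff L 0 \<noteq> 0" using L[of 0] by auto
  then show ?thesis
    using L by (auto simp: littlewood_poly_def coeff_reflect_poly)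
qed

lemma reflect_dvd:
  "(P :: int poly) dvd Q \<Longrightarrow> reflect_poly P dvd reflect_poly Q"
  by (auto simp: dvd_def reflect_poly_mult)

text \<open>Reversal is multiplicative, preserves Newman and Littlewood polynomials, and is an
  involution when the constant term is nonzero. So one of P and its reciprocal can stand for
  both.\<close>

lemma newman_imp_littlewood_reflect:
  assumes "newman_imp_littlewood (reflect_poly P)" "coeff P 0 \<noteq> 0"
  shows "newman_imp_littlewood P"
  unfolding newman_imp_littlewood_def
proof
  assume "\<exists>N. newman_poly N \<and> P dvd N"
  then have "\<exists>N. newman_poly N \<and> reflect_poly P dvd N"
    using newman_reflect reflect_dvd by blast
  then obtain L where "littlewood_poly L" "reflect_poly P dvd L"
    using assms(1) by (auto simp: newman_imp_littlewood_def)
  then have "littlewood_poly (reflect_poly L)" "P dvd reflect_poly L"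
    using littlewood_reflect reflect_dvd[of "reflect_poly P" L] assms(2) by auto
  then show "\<exists>L. littlewood_poly L \<and> P dvd L" by blast
qed

text \<open>Constant and leading coefficient are normalised to 1; \<open>xs\<close> lists the inner
  coefficients, so the degree is \<open>length xs + 1\<close>.\<close>

definition framed_poly :: "int list \<Rightarrow> int poly" where
  "framed_poly xs = Poly (1 # xs @ [1])"

lemma reflect_framed_poly: "reflect_poly (framed_poly xs) = framed_poly (rev xs)"
  unfolding framed_poly_def by (subst reflect_poly_Poly_nz) simp_all

lemma newman_imp_littlewood_rev:
  "newman_imp_littlewood (framed_poly (rev xs)) \<Longrightarrow> newman_imp_littlewood (framed_poly xs)"
  by (rule newman_imp_littlewood_reflect)
    (simp_all add: reflect_framed_poly, simp add: framed_poly_def)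

text \<open>
  \<open>Nonpos p q\<close> asserts a nonpositive value at \<open>p / q\<close>, and the number in \<open>Search\<close> bounds the number of steps.
\<close>

datatype certificate =
  Nonpos int int
| Multiple int
| Search nat "root_data list"
| Reversed certificate

text \<open>P = 1 + X B has \<open>xs @ [1]\<close> as the coefficient list of B.
  \<open>Reversed\<close> exists because only roots inside the disc can prune: the reciprocal
  polynomial offers the inverses of the outer roots.\<close>

fun check :: "int list \<Rightarrow> certificate \<Rightarrow> bool" where
  "check xs (Nonpos p q) \<longleftrightarrow> 0 < p \<and> 0 < q \<and> homogenized p q (1 # xs @ [1]) \<le> 0"
| "check xs (Multiple k) \<longleftrightarrow> has_littlewood (xs @ [1]) (num_of_int k)"
| "check xs (Search n rs) \<longleftrightarrow> no_newman (xs @ [1]) n rs"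
| "check xs (Reversed c) \<longleftrightarrow> check (rev xs) c"

text \<open>\<open>Nonpos\<close> and \<open>Search\<close> refute the premise of the implication,
  \<open>Multiple\<close> supplies its conclusion.\<close>

lemma check_sound: "check xs c \<Longrightarrow> newman_imp_littlewood (framed_poly xs)"
proof (induction xs c rule: check.induct)
  case (1 xs p q)
  then show ?case
    using homogenized_sound[of p q "xs @ [1]"]
    by (auto simp: newman_imp_littlewood_def framed_poly_def simp del: Poly.simps homogenized.simps)
next
  case (2 xs k)
  then show ?case
    using has_littlewood_sound[of "xs @ [1]"]
    by (auto simp: newman_imp_littlewood_def framed_poly_def simp del: Poly.simps)
next
  case (3 xs n rs)
  then show ?case
    using no_newman_sound[of "xs @ [1]" n rs]
    by (auto simp: newman_imp_littlewood_def framed_poly_def simp del: Poly.simps)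
next
  case (4 xs c)
  then show ?case by (auto intro: newman_imp_littlewood_rev)
qed

text \<open>Selects one member of each pair \<open>xs\<close>, \<open>rev xs\<close>. A palindrome
  is below itself in neither direction, so it must have a certificate of its own.\<close>

fun lex_less :: "int list \<Rightarrow> int list \<Rightarrow> bool" where
  "lex_less (x # xs) (y # ys) \<longleftrightarrow> x < y \<or> x = y \<and> lex_less xs ys"
| "lex_less _ _ \<longleftrightarrow> False"

lemma lex_less_asym: "lex_less xs ys \<Longrightarrow> \<not> lex_less ys xs"
  by (induction xs ys rule: lex_less.induct) auto

text \<open>
  A leaf \<open>Mirror\<close> leaves a polynomial to its reciprocal, which is lexicographically smaller.
\<close>

datatype ctree = Mirror | Leaf certificate | Node ctree ctree ctree

text \<open>Coefficients are prepended on the way down: the root decides the coefficient next to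
  those already fixed at the top, the leaves the coefficient of X. Starting with some top
  coefficients in \<open>xs\<close> allows a large tree to be checked in pieces.\<close>

fun check_tree :: "nat \<Rightarrow> int list \<Rightarrow> ctree \<Rightarrow> bool" where
  "check_tree 0 xs (Leaf c) = check xs c"
| "check_tree 0 xs Mirror = lex_less (rev xs) xs"
| "check_tree (Suc n) xs (Node s t u) =
    (check_tree n (- 1 # xs) s \<and> check_tree n (0 # xs) t \<and> check_tree n (1 # xs) u)"
| "check_tree _ _ _ = False"

definition covered :: "nat \<Rightarrow> int list \<Rightarrow> bool" where
  "covered n xs \<longleftrightarrow> (\<forall>ys. length ys = n \<longrightarrow> set ys \<subseteq> {-1, 0, 1} \<longrightarrow>
     lex_less (rev (ys @ xs)) (ys @ xs) \<or> newman_imp_littlewood (framed_poly (ys @ xs)))"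

lemma covered_Suc:
  assumes "covered n (- 1 # xs)" "covered n (0 # xs)" "covered n (1 # xs)"
  shows "covered (Suc n) xs"
  unfolding covered_def
proof (intro allI impI)
  fix ys :: "int list"
  assume "length ys = Suc n" and ys: "set ys \<subseteq> {-1, 0, 1}"
  \<comment> \<open>The coefficient decided at this node is adjacent to \<open>xs\<close>, hence the
    last entry of \<open>ys\<close>.\<close>
  then obtain zs z where zs: "ys = zs @ [z]" "length zs = n"
    by (cases ys rule: rev_cases) auto
  with ys have "z = -1 \<or> z = 0 \<or> z = 1" "set zs \<subseteq> {-1, 0, 1}" by auto
  with assms zs show "lex_less (rev (ys @ xs)) (ys @ xs) \<or> newman_imp_littlewood (framed_poly (ys @ xs))"
    unfolding covered_def by auto
qed

lemma check_tree_covered: "check_tree n xs t \<Longrightarrow> covered n xs"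
proof (induction n xs t rule: check_tree.induct)
  case (1 xs c)
  then show ?case by (simp add: covered_def check_sound)
next
  case (2 xs)
  then show ?case by (simp add: covered_def)
next
  case (3 n xs s t u)
  then show ?case by (auto intro: covered_Suc)
qed simp_all

text \<open>Deferring to the reciprocal is not circular: by asymmetry, the reversal of a deferred
  list is not itself deferred and so has a certificate.\<close>

lemma covered_newman_imp_littlewood:
  assumes "covered n []" "length xs = n" "set xs \<subseteq> {-1, 0, 1}"
  shows "newman_imp_littlewood (framed_poly xs)"
proof (cases "lex_less (rev xs) xs")
  case True
  then have "\<not> lex_less (rev (rev xs)) (rev xs)"
    using lex_less_asym by auto
  then have "newman_imp_littlewood (framed_poly (rev xs))"
    using assms unfolding covered_def by (metis append_Nil2 length_rev set_rev)
  then show ?thesis by (rule newman_imp_littlewood_rev)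
next
  case False
  then show ?thesis using assms unfolding covered_def by (metis append_Nil2)
qed

section \<open>Reduction to constant and leading coefficient 1\<close>

lemma lead_coeff_neg_newman_imp_littlewood:
  assumes "coeff P 0 > 0" "lead_coeff P < 0"
  shows "newman_imp_littlewood P"
proof -
  let ?Q = "map_poly of_int P :: real poly"
  have lead: "lead_coeff (- ?Q) > 0"
    using assms(2) by (simp add: degree_map_poly coeff_map_poly)
  obtain t where t: "\<And>x. x \<ge> t \<Longrightarrow> poly (- ?Q) x \<ge> lead_coeff (- ?Q)"
    using poly_pinfty_gt_lc[OF lead] by blast
  \<comment> \<open>The maximum with 1 keeps the point of negative value to the right of 0.\<close>
  define u where "u = max t 1"
  have "poly ?Q u < 0" using t[of u] lead by (simp add: u_def)
  moreover have "poly ?Q 0 > 0" using assms(1) by (simp add: poly_0_coeff_0 coeff_map_poly)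
  moreover have "u > 0" by (simp add: u_def)
  ultimately obtain x where "x > 0" "poly ?Q x = 0"
    using poly_IVT_neg[of 0 u ?Q] by blast
  then have "\<not> P dvd N" if "newman_poly N" for N
    using newman_eval_pos[OF that, of x] ieval_dvd[of P N x] by (auto simp: ieval_def)
  then show ?thesis by (auto simp: newman_imp_littlewood_def)
qed

lemma newman_imp_littlewood_degree_le_8:
  assumes covered: "\<And>n. n \<le> 7 \<Longrightarrow> covered n []"
    and P: "borwein_poly P" "degree P \<le> 8" "coeff P 0 = 1"
  shows "newman_imp_littlewood P"
proof -
  have coeffs: "coeff P j \<in> {-1, 0, 1}" for j
    using P(1) coeff_eq_0[of P j] unfolding borwein_poly_def by (cases "j \<le> degree P") auto
  consider "degree P = 0" | "lead_coeff P < 0" | "degree P > 0" "lead_coeff P = 1"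
    using coeffs[of "degree P"] P(1) by (auto simp: borwein_poly_def)
  then show ?thesis
  proof cases
    case 1
    then obtain c where "P = [:c:]" by (rule degree_eq_zeroE)
    with P(3) have "P = 1" by simp
    \<comment> \<open>The constant P is 1, its own Littlewood multiple.\<close>
    moreover have "littlewood_poly 1" by (simp add: littlewood_poly_def)
    ultimately show ?thesis by (auto simp: newman_imp_littlewood_def)
  next
    case 2
    then show ?thesis using P(3) by (intro lead_coeff_neg_newman_imp_littlewood) simp_all
  next
    case 3
    \<comment> \<open>The number of inner coefficients, 7 for degree 8.\<close>
    define n where "n = degree P - 1"
    define xs where "xs = map (\<lambda>i. coeff P (Suc i)) [0..<n]"
    have deg: "degree P = Suc n" using 3 by (simp add: n_def)
    have "P = framed_poly xs"
      unfolding poly_eq_iff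
    proof
      fix i
      consider "i = 0" | "0 < i" "i < Suc n" | "i = Suc n" | "i > Suc n" by linarith
      then show "coeff P i = coeff (framed_poly xs) i"
        by cases (use P(3) 3 deg in \<open>auto simp: framed_poly_def xs_def nth_default_def nth_append
            nth_Cons' coeff_eq_0 simp del: Poly.simps\<close>)
    qed
    moreover have "newman_imp_littlewood (framed_poly xs)"
      using P(2) deg coeffs by (intro covered_newman_imp_littlewood[OF covered[of n]]) (auto simp: xs_def)
    ultimately show ?thesis by simp
  qed
qed

lemma newman_imp_littlewood_if_covered:
  assumes covered: "\<And>n. n \<le> 7 \<Longrightarrow> covered n []" and "borwein_poly P" "degree P \<le> 8"
  shows "newman_imp_littlewood P"
proof -
  have "coeff P 0 \<in> {-1, 0, 1}" "coeff P 0 \<noteq> 0"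
    using assms(2) by (auto simp: borwein_poly_def poly_0_coeff_0)
  then consider "coeff P 0 = 1" | "coeff (- P) 0 = 1" by auto
  then show ?thesis
  proof cases
    case 1
    then show ?thesis by (intro newman_imp_littlewood_degree_le_8 assms)
  next
    case 2
    have "borwein_poly (- P)" using assms(2) by (auto simp: borwein_poly_def)
    then have "newman_imp_littlewood (- P)"
      using 2 assms by (intro newman_imp_littlewood_degree_le_8) auto
    then show ?thesis by (simp add: newman_imp_littlewood_uminus)
  qed
qed

section \<open>The certificates\<close>

text \<open>4 is 100 in binary; without the marker this leaves the digits -1, -1, that is, -(1 +
  X).\<close>

lemma check_degree_1: "check_tree 0 []
   (Leaf (Multiple 4))"
  by code_simp

text \<open>10 is 1010 in binary and, read from the lowest bit, gives -1 + X - X^2, the negative of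
  1 - X + X^2; 16 gives -(1 + X + X^2 + X^3), a multiple of 1 + X^2.\<close>

lemma check_degree_2: "check_tree 1 []
   (Node (Leaf (Multiple 10)) (Leaf (Multiple 16)) (Leaf (Multiple 8)))"
  by code_simp

text \<open>The first search concerns 1 - X + X^2 + X^3. Its reversal 1 + X - X^2 + X^3 has a real
  root near -570099 / 2^20, about -0.5437, and the step bound 1 means that both continuations of the
  first carry already leave the disc.\<close>

lemma check_degree_3: "check_tree 2 []
   (Node (Node (Leaf (Nonpos 1 1)) Mirror Mirror) (Node (Leaf (Multiple 153)) (Leaf (Multiple
    64)) Mirror) (Node (Leaf (Reversed (Search 1 [(-570099, 0, 5, 570104, 3547353)]))) (Leaf
    (Multiple 224)) (Leaf (Multiple 16))))"
  by code_simp

text \<open>A power of two 2^k stands for -(1 + X + ... + X^(k-1)); thus 256 serves 1 + X^4. Root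
  data with q > 0 stand for a conjugate pair, both members of which impose the same condition on
  integer residues.\<close>

lemma check_degree_4: "check_tree 3 []
   (Node (Node (Node (Leaf (Nonpos 1 1)) Mirror Mirror) (Node (Leaf (Nonpos 1 1)) Mirror Mirror)
    (Node (Leaf (Multiple 53)) Mirror Mirror)) (Node (Node (Leaf (Nonpos 1 1)) (Leaf (Multiple
    102)) Mirror) (Node (Leaf (Multiple 35734)) (Leaf (Multiple 256)) Mirror) (Node (Leaf
    (Multiple 30722)) (Leaf (Multiple 64)) Mirror)) (Node (Node (Leaf (Multiple 57)) (Leaf
    (Multiple 29101)) (Leaf (Search 1 [(-608900, 0, 14, 608914, 3953047)]))) (Node (Leaf (Search
    3 [(593621, 481109, 20, 764122, 2440962)])) (Leaf (Multiple 32789)) (Leaf (Multiple 5671)))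
    (Node (Leaf (Search 1 [(454432, 551370, 18, 714523, 2544382)])) (Leaf (Multiple 30738))
    (Leaf (Multiple 32)))))"
  by code_simp

lemma check_degree_5: "check_tree 4 []
   (Node (Node (Node (Node (Leaf (Nonpos 1 1)) Mirror Mirror) (Node Mirror Mirror Mirror) (Node
    Mirror Mirror Mirror)) (Node (Node (Leaf (Nonpos 1 1)) Mirror Mirror) (Node (Leaf (Nonpos 1
    1)) Mirror Mirror) (Node Mirror Mirror Mirror)) (Node (Node (Leaf (Nonpos 1 1)) Mirror
    Mirror) (Node (Leaf (Multiple 2273420185)) Mirror Mirror) (Node (Leaf (Multiple 82)) Mirror
    Mirror))) (Node (Node (Node (Leaf (Nonpos 1 1)) (Leaf (Nonpos 1 1)) Mirror) (Node (Leaf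
    (Nonpos 1 1)) Mirror Mirror) (Node (Leaf (Multiple 2668728400)) Mirror Mirror)) (Node (Node
    (Leaf (Nonpos 1 1)) (Leaf (Multiple 4261909104)) Mirror) (Node (Leaf (Multiple 3673177))
    (Leaf (Multiple 1024)) Mirror) (Node (Leaf (Multiple 309592541)) Mirror Mirror)) (Node (Node
    (Leaf (Search 1 [(752207, 280011, 71, 802706, 1739157)])) (Leaf (Multiple 4571)) Mirror)
    (Node (Leaf (Search 4 [(651946, 461999, 33, 799081, 2559218)])) (Leaf (Multiple 2819627827))
    Mirror) (Node (Leaf (Search 5 [(509082, 587709, 27, 777566, 3086835)])) (Leaf (Multiple
    6166)) Mirror))) (Node (Node (Node (Leaf (Nonpos 1 1)) (Leaf (Multiple 3759090346)) (Leaf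
    (Multiple 115))) (Node (Leaf (Reversed (Search 1 [(-578555, 0, 15, 578570, 3630138)])))
    (Leaf (Reversed (Search 1 [(-615036, 0, 12, 615048, 4023815)]))) Mirror) (Node (Leaf
    (Reversed (Search 1 [(-533369, 0, 14, 533383, 3219773)]))) (Leaf (Reversed (Search 1
    [(-555237, 0, 13, 555250, 3408970)]))) Mirror)) (Node (Node (Leaf (Search 1 [(747834,
    210467, 99, 776986, 1417604)])) (Leaf (Multiple 1191187018)) (Leaf (Multiple 4054357412)))
    (Node (Leaf (Multiple 501)) (Leaf (Multiple 2589014)) (Leaf (Multiple 256))) (Node (Leaf
    (Reversed (Search 1 [(-622250, 0, 14, 622264, 4109673)]))) (Leaf (Multiple 1310195989))
    Mirror)) (Node (Node (Leaf (Search 1 [(655161, 314827, 59, 726938, 1642886)])) (Leaf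
    (Reversed (Search 3 [(-377067, 628006, 16, 732527, 5168582)]))) (Leaf (Search 1 [(-585012,
    0, 21, 585033, 3695371)]))) (Node (Leaf (Search 1 [(575811, 431154, 38, 719380, 2038194)]))
    (Leaf (Multiple 506137909)) (Leaf (Multiple 2165052931))) (Node (Leaf (Search 1 [(477329,
    515483, 33, 702576, 2331955)])) (Leaf (Multiple 4173728546)) (Leaf (Multiple 64))))))"
  by code_simp

text \<open>\<open>Nonpos 1 1\<close> applies when the coefficients add up to at most 0. The point
  3/4 handles 1 - X - X^2 - X^3 + X^4 + X^5 + X^6, which takes the value 1 at 1 but is negative at
  3/4. For 1 - X^2 + X^3 + X^5 + X^6 the search prunes at two roots at once.\<close>

lemma check_degree_6: "check_tree 5 []
   (Node (Node (Node (Node (Node (Leaf (Nonpos 1 1)) Mirror Mirror) (Node Mirror Mirror Mirror)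
    (Node Mirror Mirror Mirror)) (Node (Node (Leaf (Nonpos 1 1)) Mirror Mirror) (Node Mirror
    Mirror Mirror) (Node Mirror Mirror Mirror)) (Node (Node (Leaf (Nonpos 1 1)) Mirror Mirror)
    (Node Mirror Mirror Mirror) (Node Mirror Mirror Mirror))) (Node (Node (Node (Leaf (Nonpos 1
    1)) Mirror Mirror) (Node (Leaf (Nonpos 1 1)) Mirror Mirror) (Node Mirror Mirror Mirror))
    (Node (Node (Leaf (Nonpos 1 1)) Mirror Mirror) (Node (Leaf (Nonpos 1 1)) Mirror Mirror)
    (Node Mirror Mirror Mirror)) (Node (Node (Leaf (Nonpos 1 1)) Mirror Mirror) (Node (Leaf
    (Multiple 4096)) Mirror Mirror) (Node Mirror Mirror Mirror))) (Node (Node (Node (Leaf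
    (Nonpos 1 1)) Mirror Mirror) (Node (Leaf (Nonpos 1 1)) Mirror Mirror) (Node (Leaf (Multiple
    170)) Mirror Mirror)) (Node (Node (Leaf (Nonpos 1 1)) Mirror Mirror) (Node (Leaf (Multiple
    15801857860540971084)) Mirror Mirror) (Node (Leaf (Multiple 18711136)) Mirror Mirror)) (Node
    (Node (Leaf (Multiple 217)) Mirror Mirror) (Node (Leaf (Reversed (Search 5 [(378578, 672555,
    52, 771837, 3597250)]))) Mirror Mirror) (Node (Leaf (Multiple 221)) Mirror Mirror)))) (Node
    (Node (Node (Node (Leaf (Nonpos 1 1)) (Leaf (Nonpos 1 1)) Mirror) (Node (Leaf (Nonpos 1 1))
    Mirror Mirror) (Node (Leaf (Nonpos 1 1)) Mirror Mirror)) (Node (Node (Leaf (Nonpos 1 1))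
    (Leaf (Nonpos 1 1)) Mirror) (Node (Leaf (Nonpos 1 1)) Mirror Mirror) (Node (Leaf (Multiple
    2132026)) Mirror Mirror)) (Node (Node (Leaf (Nonpos 1 1)) (Leaf (Multiple 57552)) Mirror)
    (Node (Leaf (Multiple 11062653803470954834)) Mirror Mirror) (Node (Leaf (Multiple
    1376350212043396114)) Mirror Mirror))) (Node (Node (Node (Leaf (Nonpos 1 1)) (Leaf (Nonpos 1
    1)) Mirror) (Node (Leaf (Nonpos 1 1)) (Leaf (Multiple 796)) Mirror) (Node (Leaf (Multiple
    35493)) Mirror Mirror)) (Node (Node (Leaf (Nonpos 1 1)) (Leaf (Multiple 18323)) Mirror)
    (Node (Leaf (Multiple 17296901268593732710)) (Leaf (Multiple 4096)) Mirror) (Node (Leaf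
    (Multiple 8096932822060714057)) Mirror Mirror)) (Node (Node (Leaf (Search 1 [(773982,
    242998, 102, 811334, 1621099)])) (Leaf (Multiple 8380081535244077221)) Mirror) (Node (Leaf
    (Multiple 528615029)) (Leaf (Multiple 512)) Mirror) (Node (Leaf (Multiple 45589)) Mirror
    Mirror))) (Node (Node (Node (Leaf (Nonpos 1 1)) (Leaf (Reversed (Search 3 [(-93086, 754926,
    20, 760664, 4984835)]))) Mirror) (Node (Leaf (Search 5 [(802571, 250002, 104, 840712,
    1769850)])) (Leaf (Multiple 4802163775098734737)) Mirror) (Node (Leaf (Multiple
    1162781515031006476)) (Leaf (Multiple 54272)) Mirror)) (Node (Node (Leaf (Search 1 [(761679,
    175816, 133, 781841, 1323291)])) (Leaf (Multiple 499)) Mirror) (Node (Leaf (Search 4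
    [(708282, 376653, 43, 802247, 2160982)])) (Leaf (Multiple 26641)) Mirror) (Node (Leaf
    (Multiple 4073709)) (Leaf (Multiple 256)) Mirror)) (Node (Node (Leaf (Search 1 [(677817,
    301892, 76, 742084, 1636022)])) (Leaf (Reversed (Search 3 [(93086, 754926, 24, 760668,
    4435136)]))) Mirror) (Node (Leaf (Search 1 [(604027, 438490, 46, 746453, 2167321)])) (Leaf
    (Multiple 7497961388023767611)) Mirror) (Node (Leaf (Search 2 [(490161, 548115, 51, 735366,
    2619749)])) (Leaf (Multiple 49384)) Mirror)))) (Node (Node (Node (Node (Leaf (Nonpos 1 1))
    (Leaf (Nonpos 1 1)) (Leaf (Multiple 227))) (Node (Leaf (Nonpos 1 1)) (Leaf (Multiple 39333))
    Mirror) (Node (Leaf (Multiple 229)) (Leaf (Search 1 [(-123049, 722670, 30, 733101,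
    4575559)])) Mirror)) (Node (Node (Leaf (Nonpos 1 1)) (Leaf (Reversed (Search 1 [(-611669, 0,
    22, 611691, 3984839)]))) (Leaf (Search 1 [(-588544, 0, 24, 588568, 3731827)]))) (Node (Leaf
    (Search 10 [(822438, 257540, 114, 861933, 1926138)])) (Leaf (Multiple 5742757480510013968))
    Mirror) (Node (Leaf (Reversed (Search 3 [(-693568, 219413, 32, 727479, 5734202)]))) (Leaf
    (Search 3 [(-48729, 761877, 31, 763465, 4913134)])) Mirror)) (Node (Node (Leaf (Search 1
    [(776613, 191105, 202, 799983, 1402900)])) (Leaf (Reversed (Search 1 [(-550386, 0, 24,
    550410, 3365662)]))) (Leaf (Search 1 [(-538600, 0, 28, 538628, 3263674)]))) (Node (Leaf
    (Reversed (Search 1 [(-604474, 0, 30, 604504, 3903377)]))) (Leaf (Reversed (Search 1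
    [(-580124, 0, 19, 580143, 3645849)]))) Mirror) (Node (Leaf (Multiple 237)) (Leaf (Reversed
    (Search 1 [(-629283, 0, 32, 629315, 4196423)]))) Mirror))) (Node (Node (Node (Leaf (Nonpos 1
    1)) (Leaf (Multiple 18374687577186911514)) (Leaf (Multiple 9026478098235050212))) (Node
    (Leaf (Search 1 [(799760, 200989, 135, 824764, 1499169)])) (Leaf (Multiple 528550581)) (Leaf
    (Multiple 4096))) (Node (Leaf (Reversed (Search 2 [(-576004, 404605, 27, 703935,
    5093882)]))) (Leaf (Reversed (Search 3 [(-604027, 438490, 23, 746430, 5933772)]))) Mirror))
    (Node (Node (Leaf (Search 1 [(763604, 123112, 184, 773649, 1184680)])) (Leaf (Multiple
    5672714520277)) (Leaf (Search 1 [(-633055, 0, 22, 633077, 4243912)]))) (Node (Leaf (Search 3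
    [(726076, 333602, 56, 799104, 1950514)])) (Leaf (Multiple 16491362839748588874)) (Leaf
    (Multiple 1417879))) (Node (Leaf (Reversed (Search 3 [(-649725, 359491, 24, 742572,
    5948556)]))) (Leaf (Multiple 5327789664784)) Mirror)) (Node (Node (Leaf (Search 1 [(693957,
    268460, 90, 744165, 1532388)])) (Leaf (Search 3 [(-772586, 0, 20, 772606, 6919766), (728473,
    457018, 39, 860004, 3102877)])) (Leaf (Search 1 [(-562780, 0, 22, 562802, 3478269)]))) (Node
    (Leaf (Search 2 [(640169, 412073, 50, 761379, 2118434)])) (Leaf (Multiple 427034026)) (Leaf
    (Multiple 4271))) (Node (Leaf (Search 6 [(560058, 552539, 54, 786797, 2954447)])) (Leaf
    (Multiple 11393074581558597807)) Mirror))) (Node (Node (Node (Leaf (Nonpos 3 4)) (Leaf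
    (Reversed (Search 14 [(-297787, 744475, 22, 801845, 6538464)]))) (Leaf (Multiple 243)))
    (Node (Leaf (Search 1 [(719809, 281503, 87, 772984, 1647124)])) (Leaf (Multiple 61489))
    (Leaf (Reversed (Search 8 [(-378578, 672555, 33, 771818, 5977642)])))) (Node (Leaf (Multiple
    245)) (Leaf (Reversed (Search 4 [(-490161, 548115, 27, 735342, 5468178)]))) (Leaf (Multiple
    247)))) (Node (Node (Leaf (Search 1 [(693568, 219413, 103, 727550, 1363506)])) (Leaf
    (Multiple 4100077)) (Leaf (Reversed (Search 6 [(-220211, 747639, 20, 779416, 5737247)]))))
    (Node (Leaf (Search 1 [(649725, 359491, 57, 742605, 1840349)])) (Leaf (Multiple
    4638760908231884885)) (Leaf (Multiple 17429441543343215104))) (Node (Leaf (Search 3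
    [(593621, 481109, 47, 764149, 2441294)])) (Leaf (Multiple 2150701)) (Leaf (Multiple
    27724026)))) (Node (Node (Leaf (Search 1 [(631048, 297059, 77, 697548, 1530908)])) (Leaf
    (Search 4 [(651946, 461999, 47, 799095, 2559420)])) (Leaf (Search 1 [(-597521, 0, 34,
    597555, 3827081)]))) (Node (Leaf (Search 1 [(576004, 404605, 60, 703968, 1893166)])) (Leaf
    (Multiple 34329)) (Leaf (Multiple 6079364836985872393))) (Node (Leaf (Search 1 [(499752,
    500615, 59, 707426, 2283437)])) (Leaf (Multiple 1184570955814446276)) (Leaf (Multiple
    128)))))))"
  by code_simp

text \<open>Degree 7 is split by the coefficient of X^6, with \<open>n\<close>, \<open>z\<close>,
  \<open>p\<close> for -1, 0, 1; the other five inner coefficients form a tree of depth 5.\<close>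

lemma check_degree_7_n: "check_tree 5 [- 1]
   (Node (Node (Node (Node (Node (Leaf (Nonpos 1 1)) Mirror Mirror) (Node Mirror Mirror Mirror)
    (Node Mirror Mirror Mirror)) (Node (Node Mirror Mirror Mirror) (Node Mirror Mirror Mirror)
    (Node Mirror Mirror Mirror)) (Node (Node Mirror Mirror Mirror) (Node Mirror Mirror Mirror)
    (Node Mirror Mirror Mirror))) (Node (Node (Node (Leaf (Nonpos 1 1)) Mirror Mirror) (Node
    Mirror Mirror Mirror) (Node Mirror Mirror Mirror)) (Node (Node (Leaf (Nonpos 1 1)) Mirror
    Mirror) (Node Mirror Mirror Mirror) (Node Mirror Mirror Mirror)) (Node (Node Mirror Mirror
    Mirror) (Node Mirror Mirror Mirror) (Node Mirror Mirror Mirror))) (Node (Node (Node (Leaf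
    (Nonpos 1 1)) Mirror Mirror) (Node Mirror Mirror Mirror) (Node Mirror Mirror Mirror)) (Node
    (Node (Leaf (Nonpos 1 1)) Mirror Mirror) (Node Mirror Mirror Mirror) (Node Mirror Mirror
    Mirror)) (Node (Node (Leaf (Nonpos 1 1)) Mirror Mirror) (Node Mirror Mirror Mirror) (Node
    Mirror Mirror Mirror)))) (Node (Node (Node (Node (Leaf (Nonpos 1 1)) Mirror Mirror) (Node
    (Leaf (Nonpos 1 1)) Mirror Mirror) (Node Mirror Mirror Mirror)) (Node (Node (Leaf (Nonpos 1
    1)) Mirror Mirror) (Node Mirror Mirror Mirror) (Node Mirror Mirror Mirror)) (Node (Node
    (Leaf (Nonpos 1 1)) Mirror Mirror) (Node Mirror Mirror Mirror) (Node Mirror Mirror Mirror)))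
    (Node (Node (Node (Leaf (Nonpos 1 1)) Mirror Mirror) (Node (Leaf (Nonpos 1 1)) Mirror
    Mirror) (Node Mirror Mirror Mirror)) (Node (Node (Leaf (Nonpos 1 1)) Mirror Mirror) (Node
    (Leaf (Nonpos 1 1)) Mirror Mirror) (Node Mirror Mirror Mirror)) (Node (Node (Leaf (Nonpos 1
    1)) Mirror Mirror) (Node Mirror Mirror Mirror) (Node Mirror Mirror Mirror))) (Node (Node
    (Node (Leaf (Nonpos 1 1)) Mirror Mirror) (Node (Leaf (Nonpos 1 1)) Mirror Mirror) (Node
    Mirror Mirror Mirror)) (Node (Node (Leaf (Nonpos 1 1)) Mirror Mirror) (Node (Leaf (Multiple
    171408132430811319802567150682257867235)) Mirror Mirror) (Node Mirror Mirror Mirror)) (Node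
    (Node (Leaf (Search 5 [(766287, 322709, 206, 831673, 2073715)])) Mirror Mirror) (Node (Leaf
    (Multiple 438325)) Mirror Mirror) (Node Mirror Mirror Mirror)))) (Node (Node (Node (Node
    (Leaf (Nonpos 1 1)) Mirror Mirror) (Node (Leaf (Nonpos 1 1)) Mirror Mirror) (Node (Leaf
    (Nonpos 1 1)) Mirror Mirror)) (Node (Node (Leaf (Nonpos 1 1)) Mirror Mirror) (Node (Leaf
    (Nonpos 1 1)) Mirror Mirror) (Node Mirror Mirror Mirror)) (Node (Node (Leaf (Nonpos 1 1))
    Mirror Mirror) (Node (Leaf (Multiple 11122267779817669836195246697)) Mirror Mirror) (Node
    Mirror Mirror Mirror))) (Node (Node (Node (Leaf (Nonpos 1 1)) Mirror Mirror) (Node (Leaf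
    (Nonpos 1 1)) Mirror Mirror) (Node (Leaf (Multiple 335027600862274940045427389196390376213))
    Mirror Mirror)) (Node (Node (Leaf (Nonpos 1 1)) Mirror Mirror) (Node (Leaf (Multiple
    51470927274377070669877386790505)) Mirror Mirror) (Node (Leaf (Multiple 1640514448)) Mirror
    Mirror)) (Node (Node (Leaf (Search 1 [(779112, 257711, 226, 820855, 1717939)])) Mirror
    Mirror) (Node (Leaf (Multiple 35286190157992622768244241404338342637)) Mirror Mirror) (Node
    Mirror Mirror Mirror))) (Node (Node (Node (Leaf (Nonpos 1 1)) Mirror Mirror) (Node (Leaf
    (Reversed (Search 2 [(334908, 662811, 72, 742691, 3339064)]))) Mirror Mirror) (Node (Leaf
    (Multiple 437)) Mirror Mirror)) (Node (Node (Leaf (Search 1 [(764928, 187804, 287, 787933,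
    1369736)])) Mirror Mirror) (Node (Leaf (Reversed (Search 2 [(400020, 626005, 65, 742964,
    3092961)]))) Mirror Mirror) (Node (Leaf (Reversed (Search 5 [(470141, 620002, 93, 778191,
    3288715)]))) Mirror Mirror)) (Node (Node (Leaf (Search 1 [(673975, 314178, 158, 743765,
    1682439)])) Mirror Mirror) (Node (Leaf (Search 1 [(586716, 448246, 97, 738447, 2176450)]))
    Mirror Mirror) (Node (Leaf (Search 1 [(466227, 532949, 84, 708182, 2432013)])) Mirror
    Mirror)))))"
  by code_simp

lemma check_degree_7_z: "check_tree 5 [0]
   (Node (Node (Node (Node (Node (Leaf (Nonpos 1 1)) (Leaf (Nonpos 1 1)) Mirror) (Node (Leaf
    (Nonpos 1 1)) Mirror Mirror) (Node (Leaf (Nonpos 1 1)) Mirror Mirror)) (Node (Node (Leaf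
    (Nonpos 1 1)) Mirror Mirror) (Node (Leaf (Nonpos 1 1)) Mirror Mirror) (Node (Leaf (Nonpos 1
    1)) Mirror Mirror)) (Node (Node (Leaf (Nonpos 1 1)) Mirror Mirror) (Node (Leaf (Nonpos 1 1))
    Mirror Mirror) (Node (Leaf (Search 1 [(296003, 651526, 58, 715673, 3135538)])) Mirror
    Mirror))) (Node (Node (Node (Leaf (Nonpos 1 1)) (Leaf (Nonpos 1 1)) Mirror) (Node (Leaf
    (Nonpos 1 1)) Mirror Mirror) (Node (Leaf (Nonpos 1 1)) Mirror Mirror)) (Node (Node (Leaf
    (Nonpos 1 1)) (Leaf (Nonpos 1 1)) Mirror) (Node (Leaf (Nonpos 1 1)) Mirror Mirror) (Node
    (Leaf (Multiple 208216953359390738727221365083437585485)) Mirror Mirror)) (Node (Node (Leaf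
    (Nonpos 1 1)) Mirror Mirror) (Node (Leaf (Multiple 337663746174812757248990536515750339066))
    Mirror Mirror) (Node (Leaf (Search 2 [(356299, 640332, 58, 732844, 3132027)])) Mirror
    Mirror))) (Node (Node (Node (Leaf (Nonpos 1 1)) (Leaf (Nonpos 1 1)) Mirror) (Node (Leaf
    (Nonpos 1 1)) Mirror Mirror) (Node (Leaf (Multiple 194599828659688702412609343516572193087))
    Mirror Mirror)) (Node (Node (Leaf (Nonpos 1 1)) (Leaf (Multiple
    40888733991937099060928908953139)) Mirror) (Node (Leaf (Multiple
    11299370402518171031890959388)) Mirror Mirror) (Node (Leaf (Multiple
    157597283994895445075818103102053048098)) Mirror Mirror)) (Node (Node (Leaf (Search 6
    [(794014, 274025, 201, 840171, 1882872)])) (Leaf (Multiple 4096)) Mirror) (Node (Leaf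
    (Multiple 89220034270971466)) Mirror Mirror) (Node (Leaf (Search 2 [(412350, 594472, 80,
    723565, 2809494)])) Mirror Mirror)))) (Node (Node (Node (Node (Leaf (Nonpos 1 1)) (Leaf
    (Nonpos 1 1)) Mirror) (Node (Leaf (Nonpos 1 1)) (Leaf (Nonpos 1 1)) Mirror) (Node (Leaf
    (Nonpos 1 1)) Mirror Mirror)) (Node (Node (Leaf (Nonpos 1 1)) (Leaf (Nonpos 1 1)) Mirror)
    (Node (Leaf (Nonpos 1 1)) Mirror Mirror) (Node (Leaf (Multiple 8736251190368)) Mirror
    Mirror)) (Node (Node (Leaf (Nonpos 1 1)) (Leaf (Multiple
    328531528709687693348635849744425183268)) Mirror) (Node (Leaf (Multiple 66317156964)) Mirror
    Mirror) (Node (Leaf (Search 5 [(312614, 694690, 49, 761838, 3701139)])) Mirror Mirror)))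
    (Node (Node (Node (Leaf (Nonpos 1 1)) (Leaf (Nonpos 1 1)) Mirror) (Node (Leaf (Nonpos 1 1))
    (Leaf (Multiple 329649677504266876432451354795357804992)) Mirror) (Node (Leaf (Multiple
    338289090299504953984721369135413503565)) Mirror Mirror)) (Node (Node (Leaf (Nonpos 1 1))
    (Leaf (Multiple 10212703627606691514751271000)) Mirror) (Node (Leaf (Multiple
    204067673320110663933854789893840855494)) (Leaf (Multiple 16384)) Mirror) (Node (Leaf
    (Multiple 1217110719908353613)) Mirror Mirror)) (Node (Node (Leaf (Search 1 [(792187,
    215579, 132, 821129, 1544920)])) (Leaf (Multiple 41886178856251774311871162993376167091))
    Mirror) (Node (Leaf (Multiple 1148730418)) Mirror Mirror) (Node (Leaf (Search 10 [(411597,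
    678179, 58, 793367, 3823024)])) Mirror Mirror))) (Node (Node (Node (Leaf (Nonpos 1 1)) (Leaf
    (Reversed (Search 17 [(220863, 794089, 32, 824264, 5362110), (-888342, 0, 17, 888359,
    12676705)]))) Mirror) (Node (Leaf (Search 5 [(817194, 220490, 154, 846572, 1659877)])) (Leaf
    (Multiple 32561015)) Mirror) (Node (Leaf (Multiple 5073430590150)) Mirror Mirror)) (Node
    (Node (Leaf (Search 1 [(774105, 149341, 201, 788580, 1261014)])) (Leaf (Multiple
    109465357694698138550636034595521831436)) Mirror) (Node (Leaf (Search 6 [(739390, 369048,
    67, 826442, 2272977)])) (Leaf (Multiple 337701833429112764218596715624007102919)) Mirror)
    (Node (Leaf (Multiple 5382332355835)) Mirror Mirror)) (Node (Node (Leaf (Search 1 [(697480,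
    296274, 109, 757907, 1657653)])) (Leaf (Multiple 172149338575392834920997448649697964329))
    Mirror) (Node (Leaf (Search 3 [(623939, 457374, 68, 773690, 2380963)])) (Leaf (Multiple
    20580337)) Mirror) (Node (Leaf (Search 2 [(468111, 573806, 66, 740594, 2779136)])) Mirror
    Mirror)))) (Node (Node (Node (Node (Leaf (Nonpos 1 1)) (Leaf (Nonpos 1 1)) Mirror) (Node
    (Leaf (Nonpos 1 1)) (Leaf (Multiple 175473110797097162736128938303610458801)) Mirror) (Node
    (Leaf (Reversed (Search 6 [(-201204, 746771, 44, 773446, 5548861)]))) (Leaf (Multiple 8047))
    Mirror)) (Node (Node (Leaf (Nonpos 1 1)) (Leaf (Search 13 [(-738222, 0, 18, 738240,
    6037368), (899649, 251132, 124, 934167, 2677088)])) Mirror) (Node (Leaf (Search 7 [(834373,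
    225810, 149, 864539, 1774207)])) (Leaf (Multiple 23884888185836122929683339168977031756))
    Mirror) (Node (Leaf (Reversed (Search 7 [(-275183, 722856, 36, 773500, 5749563)]))) Mirror
    Mirror)) (Node (Node (Leaf (Search 1 [(788391, 163855, 282, 805521, 1327738)])) (Leaf
    (Multiple 8155)) Mirror) (Node (Leaf (Reversed (Search 8 [(-364206, 680209, 26, 771603,
    5936315)]))) (Leaf (Multiple 191326790363374741243556933147848086052)) Mirror) (Node (Leaf
    (Reversed (Search 4 [(-321067, 679272, 34, 751363, 5393890)]))) Mirror Mirror))) (Node (Node
    (Node (Leaf (Nonpos 1 1)) (Leaf (Reversed (Search 5 [(90983, 767738, 30, 773141,
    4672642)]))) Mirror) (Node (Leaf (Search 1 [(809279, 173669, 176, 827880, 1405657)])) (Leaf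
    (Reversed (Search 19 [(46652, 807610, 23, 808980, 5632089)]))) Mirror) (Node (Leaf (Multiple
    28674393894425185998948301)) (Leaf (Search 23 [(-254826, 767961, 29, 809165, 6625995)]))
    Mirror)) (Node (Node (Leaf (Search 1 [(772363, 90556, 319, 777973, 1127605)])) (Leaf
    (Multiple 1720051)) Mirror) (Node (Leaf (Search 4 [(748591, 320695, 68, 814460, 1967119)]))
    (Leaf (Multiple 16096547344965839900259173574)) Mirror) (Node (Leaf (Multiple
    323959876100920320933653072330684402086)) (Leaf (Multiple 1475101)) Mirror)) (Node (Node
    (Leaf (Search 1 [(710215, 258782, 110, 756003, 1527088)])) (Leaf (Search 4 [(-715473, 0, 19,
    715492, 5553433), (762457, 450903, 55, 885863, 3441757)])) Mirror) (Node (Leaf (Search 3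
    [(664864, 419157, 69, 786032, 2269881)])) (Leaf (Multiple
    167711817484333920722234086340932373718)) Mirror) (Node (Leaf (Multiple
    37346980697211521466692317)) Mirror Mirror))) (Node (Node (Node (Leaf (Nonpos 2 3)) (Leaf
    (Reversed (Search 1 [(148860, 710616, 35, 726076, 3727845)]))) Mirror) (Node (Leaf (Search 1
    [(735973, 269324, 120, 783824, 1634701)])) (Leaf (Reversed (Search 5 [(134346, 749374, 34,
    761356, 4315734)]))) Mirror) (Node (Leaf (Search 11 [(710029, 423266, 76, 826693,
    2561765)])) (Leaf (Multiple 4327)) Mirror)) (Node (Node (Leaf (Search 1 [(705934, 208383,
    146, 736194, 1346640)])) (Leaf (Reversed (Search 4 [(201820, 727705, 30, 755203,
    3990675)]))) Mirror) (Node (Leaf (Search 1 [(668186, 359935, 73, 759037, 1896822)])) (Leaf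
    (Multiple 34644651090849423534658451186686990549)) Mirror) (Node (Leaf (Search 4 [(614531,
    501882, 74, 793506, 2728059)])) (Leaf (Multiple 42944022760868400317375590474282)) Mirror))
    (Node (Node (Leaf (Search 1 [(643944, 295952, 106, 708804, 1547438)])) (Leaf (Reversed
    (Search 7 [(267040, 724574, 38, 772255, 4044396)]))) Mirror) (Node (Leaf (Search 1 [(587817,
    414920, 77, 719582, 1976470)])) (Leaf (Multiple 174871934387127621354587359493051651474))
    Mirror) (Node (Leaf (Search 1 [(496517, 522267, 79, 720699, 2430649)])) (Leaf (Multiple
    4159)) Mirror)))))"
  by code_simp

lemma check_degree_7_p: "check_tree 5 [1]
   (Node (Node (Node (Node (Node (Leaf (Nonpos 1 1)) (Leaf (Nonpos 1 1)) (Leaf (Nonpos 1 1)))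
    (Node (Leaf (Nonpos 1 1)) (Leaf (Nonpos 1 1)) Mirror) (Node (Leaf (Nonpos 1 1)) (Leaf
    (Reversed (Search 1 [(-636375, 0, 32, 636407, 4286671)]))) Mirror)) (Node (Node (Leaf
    (Nonpos 1 1)) (Leaf (Nonpos 1 1)) Mirror) (Node (Leaf (Nonpos 1 1)) (Leaf (Multiple
    297785993648202354504914600473433091824)) Mirror) (Node (Leaf (Search 4 [(216412, 722395,
    47, 754162, 3924933)])) (Leaf (Search 3 [(65966, 747065, 38, 750010, 4335234)])) Mirror))
    (Node (Node (Leaf (Nonpos 1 1)) (Leaf (Reversed (Search 4 [(-661932, 342184, 37, 745184,
    6029077)]))) Mirror) (Node (Leaf (Reversed (Search 27 [(-682768, 478119, 28, 833557,
    8759355), (-843006, 0, 37, 843043, 9650549)]))) (Leaf (Multiple 5327041182778)) Mirror)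
    (Node (Leaf (Search 2 [(275724, 667899, 64, 722638, 3286362)])) (Leaf (Search 1 [(126239,
    706210, 45, 717450, 3678748)])) Mirror))) (Node (Node (Node (Leaf (Nonpos 1 1)) (Leaf
    (Nonpos 1 1)) (Leaf (Reversed (Search 1 [(-632286, 0, 49, 632335, 4234477)])))) (Node (Leaf
    (Nonpos 1 1)) (Leaf (Reversed (Search 1 [(-590907, 0, 22, 590929, 3756489)]))) Mirror) (Node
    (Leaf (Reversed (Search 1 [(-566017, 0, 34, 566051, 3508750)]))) (Leaf (Reversed (Search 1
    [(-573770, 0, 29, 573799, 3583122)]))) Mirror)) (Node (Node (Leaf (Nonpos 1 1)) (Leaf
    (Multiple 208369216251428642654841320779375745817)) (Leaf (Multiple 1135500304))) (Node
    (Leaf (Reversed (Search 1 [(-616789, 0, 28, 616817, 4044597)]))) (Leaf (Reversed (Search 1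
    [(-634104, 0, 19, 634123, 4257269)]))) Mirror) (Node (Leaf (Reversed (Search 1 [(-594815, 0,
    29, 594844, 3797949)]))) (Leaf (Reversed (Search 1 [(-606729, 0, 24, 606753, 3928583)])))
    Mirror)) (Node (Node (Leaf (Search 1 [(797889, 175350, 295, 817225, 1387924)])) (Leaf
    (Multiple 164999763053156448683782620069224520373)) Mirror) (Node (Leaf (Multiple
    37340625692186199178856730925574812597)) (Leaf (Multiple 7729383581983)) Mirror) (Node (Leaf
    (Reversed (Search 1 [(-635570, 0, 40, 635610, 4276374)]))) (Leaf (Search 5 [(170995, 734114,
    44, 753810, 4070249)])) Mirror))) (Node (Node (Node (Leaf (Nonpos 1 1)) (Leaf (Reversed
    (Search 1 [(-552967, 0, 32, 552999, 3388723)]))) (Leaf (Reversed (Search 1 [(-560453, 0, 43,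
    560496, 3456881)])))) (Node (Leaf (Search 1 [(818890, 182367, 268, 839219, 1470254)])) (Leaf
    (Reversed (Search 1 [(-540983, 0, 24, 541007, 3283886)]))) Mirror) (Node (Leaf (Reversed
    (Search 1 [(-526403, 0, 35, 526438, 3162999)]))) (Leaf (Reversed (Search 1 [(-530913, 0, 28,
    530941, 3199637)]))) Mirror)) (Node (Node (Leaf (Search 1 [(779200, 107112, 455, 786983,
    1163828)])) (Leaf (Reversed (Search 1 [(-582892, 0, 31, 582923, 3673875)]))) (Leaf (Reversed
    (Search 1 [(-595486, 0, 45, 595531, 3805298)])))) (Node (Leaf (Reversed (Search 1 [(-557740,
    0, 27, 557767, 3431830)]))) (Leaf (Reversed (Search 1 [(-565408, 0, 20, 565428, 3502873)])))
    Mirror) (Node (Leaf (Reversed (Search 1 [(-545529, 0, 34, 545563, 3323127)]))) (Leaf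
    (Reversed (Search 1 [(-551670, 0, 28, 551698, 3377105)]))) Mirror)) (Node (Node (Leaf
    (Search 1 [(716783, 273349, 174, 767310, 1603308)])) (Leaf (Reversed (Search 1 [(-630831, 0,
    50, 630881, 4216087)]))) (Leaf (Multiple 292))) (Node (Leaf (Reversed (Search 1 [(-587570,
    0, 40, 587610, 3721892)]))) (Leaf (Reversed (Search 1 [(-600058, 0, 30, 600088, 3854618)])))
    Mirror) (Node (Leaf (Reversed (Search 1 [(-570099, 0, 41, 570140, 3547699)]))) (Leaf
    (Reversed (Search 1 [(-579189, 0, 37, 579226, 3636677)]))) Mirror)))) (Node (Node (Node
    (Node (Leaf (Nonpos 1 1)) (Leaf (Nonpos 1 1)) (Leaf (Multiple
    19498488765760096790829193691))) (Node (Leaf (Nonpos 1 1)) (Leaf (Multiple 34435124058))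
    (Leaf (Multiple 327808))) (Node (Leaf (Search 10 [(102834, 783017, 36, 789777, 4974908)]))
    (Leaf (Search 7 [(-70742, 773808, 42, 777077, 5255630)])) Mirror)) (Node (Node (Leaf (Nonpos
    1 1)) (Leaf (Reversed (Search 12 [(-616669, 489399, 29, 787298, 6965810)]))) (Leaf (Search 1
    [(-603090, 0, 33, 603123, 3888024)]))) (Node (Leaf (Search 1 [(833016, 188438, 181, 854245,
    1545871)])) (Leaf (Multiple 2118226522)) Mirror) (Node (Leaf (Reversed (Search 4 [(-497182,
    605552, 26, 783533, 6568025), (-819089, 0, 23, 819112, 8534728)]))) (Leaf (Search 3 [(26884,
    767881, 29, 768381, 4783089)])) Mirror)) (Node (Node (Leaf (Search 1 [(791704, 123877, 353,
    801690, 1212727)])) (Leaf (Reversed (Search 2 [(-560304, 442422, 35, 713953, 5228848)])))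
    (Leaf (Search 1 [(-546949, 0, 32, 546981, 3335486)]))) (Node (Leaf (Reversed (Search 3
    [(-535563, 505222, 29, 736288, 5583157)]))) (Leaf (Reversed (Search 3 [(-564027, 487215, 24,
    745347, 5825476)]))) Mirror) (Node (Leaf (Reversed (Search 5 [(-509596, 540610, 34, 742966,
    5658984)]))) (Leaf (Search 3 [(105450, 735483, 43, 743048, 4104844)])) Mirror))) (Node (Node
    (Node (Leaf (Nonpos 1 1)) (Leaf (Search 9 [(865380, 186104, 159, 885325, 1678365)])) (Leaf
    (Multiple 17164))) (Node (Leaf (Search 1 [(810067, 137100, 237, 821824, 1273274)])) (Leaf
    (Multiple 24400448670075361469674608393838003526)) (Leaf (Multiple
    180547596026598083603663918998615274752))) (Node (Leaf (Multiple 20181)) (Leaf (Multiple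
    17403100863940014303852424402)) Mirror)) (Node (Node (Leaf (Nonpos 3 4)) (Leaf (Multiple
    87646579578063176818296192932540090566)) (Leaf (Multiple 40790953485906894568113266017316)))
    (Node (Leaf (Multiple 8149)) (Leaf (Multiple 208098219984928739850627086756202425709)) (Leaf
    (Multiple 4096))) (Node (Leaf (Reversed (Search 9 [(-715473, 0, 25, 715498, 5553551),
    (-544120, 698991, 21, 885829, 11206608)]))) (Leaf (Multiple
    149414153309430883539410184204618414095)) Mirror)) (Node (Node (Leaf (Search 1 [(723847,
    235450, 135, 761313, 1464621)])) (Leaf (Reversed (Search 12 [(-663304, 431534, 27, 791352,
    7196916)]))) (Leaf (Search 1 [(-574391, 0, 31, 574422, 3589207)]))) (Node (Leaf (Search 4
    [(697664, 399324, 78, 803941, 2278927)])) (Leaf (Multiple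
    32795685171258226988394740031747606601)) Mirror) (Node (Leaf (Multiple 29549)) (Leaf
    (Multiple 19663444176899966962000111290)) Mirror))) (Node (Node (Node (Leaf (Nonpos 2 3))
    (Leaf (Search 8 [(807553, 280223, 95, 854886, 2001506)])) (Leaf (Reversed (Search 4
    [(-699254, 0, 49, 699303, 5247426), (64104, 852761, 26, 855194, 7062443)])))) (Node (Leaf
    (Search 1 [(747087, 244606, 119, 786231, 1552233)])) (Leaf (Reversed (Search 1 [(-637497, 0,
    23, 637520, 4301117)]))) (Leaf (Search 3 [(-584302, 456724, 41, 741665, 5793065)]))) (Node
    (Leaf (Reversed (Search 1 [(-604474, 0, 31, 604505, 3903388)]))) (Leaf (Reversed (Search 1
    [(-615036, 0, 28, 615064, 4024002)]))) Mirror)) (Node (Node (Leaf (Search 1 [(716312,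
    186043, 167, 740245, 1295610)])) (Leaf (Multiple 332713653487593924453928505573212342259))
    (Leaf (Multiple 42046816234446377591766317862467109517))) (Node (Leaf (Search 1 [(689998,
    343373, 80, 770796, 1874402)])) (Leaf (Multiple 1333923174)) (Leaf (Multiple
    315088490408774358821790343989746230816))) (Node (Leaf (Reversed (Search 1 [(-638376, 0, 27,
    638403, 4312634)]))) (Leaf (Multiple 300864338580274415455282869095887946752)) Mirror))
    (Node (Node (Leaf (Search 1 [(660460, 283653, 117, 718913, 1529428)])) (Leaf (Multiple
    141911956391281333)) (Leaf (Search 1 [(-616343, 0, 46, 616389, 4039554)]))) (Node (Leaf
    (Search 1 [(614925, 414150, 82, 741468, 2047680)])) (Leaf (Multiple 35499549654)) (Leaf
    (Multiple 360475))) (Node (Leaf (Search 3 [(525073, 561341, 103, 768742, 2876564)])) (Leaf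
    (Multiple 75309829182894202)) Mirror)))) (Node (Node (Node (Node (Leaf (Nonpos 1 1)) (Leaf
    (Search 1 [(853535, 153531, 278, 867512, 1439095)])) (Leaf (Multiple 483))) (Node (Leaf
    (Search 1 [(802668, 85313, 525, 807715, 1135430)])) (Leaf (Multiple 4693857691363)) (Leaf
    (Multiple 10987619827502378129183950473))) (Node (Leaf (Reversed (Search 1 [(-340452,
    623601, 45, 710528, 4722991)]))) (Leaf (Search 2 [(-116127, 743425, 47, 752488, 4893518)]))
    (Leaf (Multiple 487)))) (Node (Node (Leaf (Nonpos 2 3)) (Leaf (Reversed (Search 5 [(-483196,
    565392, 32, 743771, 5617149)]))) (Leaf (Search 1 [(-582770, 0, 37, 582807, 3672699)])))
    (Node (Leaf (Search 1 [(761713, 253614, 133, 802958, 1635208)])) (Leaf (Reversed (Search 5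
    [(-441132, 600790, 34, 745384, 5555412)]))) (Leaf (Multiple 31644))) (Node (Leaf (Reversed
    (Search 1 [(-378099, 587017, 42, 698289, 4618228)]))) (Leaf (Reversed (Search 2 [(-391219,
    609738, 33, 724487, 5059011)]))) Mirror)) (Node (Node (Leaf (Search 1 [(727716, 199806, 204,
    754852, 1350116)])) (Leaf (Reversed (Search 1 [(-463493, 508375, 37, 687984, 4638960)])))
    (Leaf (Search 1 [(-535859, 0, 37, 535896, 3240695)]))) (Node (Leaf (Reversed (Search 1
    [(-423577, 532482, 40, 680448, 4459268)]))) (Leaf (Reversed (Search 1 [(-444329, 536328, 35,
    696509, 4724710)]))) (Leaf (Search 1 [(-627715, 0, 34, 627749, 4176905)]))) (Node (Leaf
    (Reversed (Search 1 [(-398378, 545499, 46, 675527, 4346694)]))) (Leaf (Reversed (Search 1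
    [(-415307, 556249, 44, 694230, 4634227)]))) Mirror))) (Node (Node (Node (Leaf (Nonpos 2 3))
    (Leaf (Search 5 [(802571, 250002, 109, 840717, 1769918)])) (Leaf (Multiple
    334365625435378508383714252396843595739))) (Node (Leaf (Search 1 [(747834, 210467, 149,
    777036, 1418059)])) (Leaf (Multiple 8021392893529)) (Leaf (Multiple
    21945257886725924490258404900493138355))) (Node (Leaf (Search 5 [(739231, 356288, 90,
    820702, 2171627)])) (Leaf (Reversed (Search 14 [(-816537, 0, 18, 816555, 8429115), (-301541,
    780562, 36, 836818, 7722541)]))) (Leaf (Search 7 [(-410530, 645476, 49, 765016,
    5900189)])))) (Node (Node (Leaf (Search 1 [(719762, 150434, 193, 735508, 1211748)])) (Leaf
    (Search 7 [(764417, 340757, 66, 836995, 2199219)])) (Leaf (Search 1 [(-621696, 0, 38,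
    621734, 4103268)]))) (Node (Leaf (Search 1 [(700190, 310234, 87, 765928, 1730942)])) (Leaf
    (Multiple 1414556824790729926)) (Leaf (Multiple 45010280040581945177065649493718))) (Node
    (Leaf (Search 9 [(683918, 444273, 69, 815620, 2587426)])) (Leaf (Multiple
    186486931462279723335529956664923478373)) (Leaf (Multiple 1380993769)))) (Node (Node (Leaf
    (Search 1 [(671721, 256247, 121, 719059, 1450565)])) (Leaf (Reversed (Search 6 [(-548354,
    528009, 32, 761272, 6138770)]))) (Leaf (Search 1 [(-558625, 0, 36, 558661, 3440006)])))
    (Node (Leaf (Search 1 [(639906, 385066, 82, 746913, 1952066)])) (Leaf (Multiple
    8493047591977)) (Leaf (Multiple 23647000106877722362248388837822388636))) (Node (Leaf
    (Reversed (Search 5 [(-443840, 608503, 36, 753210, 5721814)]))) (Leaf (Multiple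
    159959833945007906438580952225978405087)) Mirror))) (Node (Node (Node (Leaf (Search 1
    [(713529, 91520, 405, 719780, 1108949)])) (Leaf (Search 4 [(751191, 306199, 101, 811302,
    1886782)])) (Leaf (Multiple 499))) (Node (Leaf (Search 1 [(693957, 268460, 122, 744197,
    1532659)])) (Leaf (Reversed (Search 7 [(-770822, 0, 19, 770841, 6869128), (-21407, 841591,
    26, 841890, 6906391)]))) (Leaf (Reversed (Search 11 [(-41910, 795284, 32, 796420,
    5612699)])))) (Node (Leaf (Multiple 501)) (Leaf (Reversed (Search 7 [(-723531, 0, 25,
    723556, 5717234), (-119252, 869920, 41, 878097, 8957131)]))) (Leaf (Search 2 [(-439654,
    567603, 61, 718023, 5052844)])))) (Node (Node (Leaf (Search 1 [(670572, 215333, 145, 704443,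
    1325997)])) (Leaf (Search 4 [(708282, 376653, 65, 802269, 2161268)])) (Leaf (Search 6
    [(-690451, 0, 56, 690507, 5092764), (759578, 482870, 48, 900116, 3975027)]))) (Node (Leaf
    (Search 1 [(642432, 339489, 84, 726701, 1724726)])) (Leaf (Multiple
    180694623056500899327097876118855835929)) (Leaf (Multiple 31744))) (Node (Leaf (Search 2
    [(608341, 457499, 83, 761256, 2317415)])) (Leaf (Multiple 23129879051970709964719306)) (Leaf
    (Multiple 330282234914977357484533497497894171511)))) (Node (Node (Leaf (Search 1 [(622208,
    284773, 118, 684398, 1476622)])) (Leaf (Search 3 [(656619, 435483, 71, 787976, 2357761)]))
    (Leaf (Search 1 [(-590119, 0, 47, 590166, 3748491)]))) (Node (Leaf (Search 1 [(581555,
    389971, 86, 700289, 1832037)])) (Leaf (Multiple 4472185135498)) (Leaf (Multiple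
    9937588006529739937231955183))) (Node (Leaf (Search 1 [(519698, 498151, 100, 719990,
    2318850)])) (Leaf (Multiple 337891902899876040174862679490353599085)) (Leaf (Multiple
    256)))))))"
  by code_simp

text \<open>Degree 8 is split into nine trees; the two letters give the coefficients of X^6 and X^7,
  in this order. With both equal to -1 the reversal starts with two smallest entries, so a list is
  deferred unless X and X^2 also have coefficient -1. The numeral 825 encodes P itself: 1 - X - X^2
  + X^3 + X^4 + X^5 - X^6 - X^7 + X^8 has no zero coefficient.\<close>

lemma check_degree_8_nn: "check_tree 5 [- 1, - 1]
   (Node (Node (Node (Node (Node (Leaf (Nonpos 1 1)) Mirror Mirror) (Node Mirror Mirror Mirror)
    (Node Mirror Mirror Mirror)) (Node (Node Mirror Mirror Mirror) (Node Mirror Mirror Mirror)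
    (Node Mirror Mirror Mirror)) (Node (Node Mirror Mirror Mirror) (Node Mirror Mirror Mirror)
    (Node Mirror Mirror Mirror))) (Node (Node (Node (Leaf (Nonpos 1 1)) Mirror Mirror) (Node
    Mirror Mirror Mirror) (Node Mirror Mirror Mirror)) (Node (Node Mirror Mirror Mirror) (Node
    Mirror Mirror Mirror) (Node Mirror Mirror Mirror)) (Node (Node Mirror Mirror Mirror) (Node
    Mirror Mirror Mirror) (Node Mirror Mirror Mirror))) (Node (Node (Node (Leaf (Nonpos 1 1))
    Mirror Mirror) (Node Mirror Mirror Mirror) (Node Mirror Mirror Mirror)) (Node (Node Mirror
    Mirror Mirror) (Node Mirror Mirror Mirror) (Node Mirror Mirror Mirror)) (Node (Node Mirror
    Mirror Mirror) (Node Mirror Mirror Mirror) (Node Mirror Mirror Mirror)))) (Node (Node (Node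
    (Node (Leaf (Nonpos 1 1)) Mirror Mirror) (Node Mirror Mirror Mirror) (Node Mirror Mirror
    Mirror)) (Node (Node (Leaf (Nonpos 1 1)) Mirror Mirror) (Node Mirror Mirror Mirror) (Node
    Mirror Mirror Mirror)) (Node (Node Mirror Mirror Mirror) (Node Mirror Mirror Mirror) (Node
    Mirror Mirror Mirror))) (Node (Node (Node (Leaf (Nonpos 1 1)) Mirror Mirror) (Node Mirror
    Mirror Mirror) (Node Mirror Mirror Mirror)) (Node (Node (Leaf (Nonpos 1 1)) Mirror Mirror)
    (Node Mirror Mirror Mirror) (Node Mirror Mirror Mirror)) (Node (Node Mirror Mirror Mirror)
    (Node Mirror Mirror Mirror) (Node Mirror Mirror Mirror))) (Node (Node (Node (Leaf (Nonpos 1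
    1)) Mirror Mirror) (Node Mirror Mirror Mirror) (Node Mirror Mirror Mirror)) (Node (Node
    (Leaf (Nonpos 1 1)) Mirror Mirror) (Node Mirror Mirror Mirror) (Node Mirror Mirror Mirror))
    (Node (Node Mirror Mirror Mirror) (Node Mirror Mirror Mirror) (Node Mirror Mirror Mirror))))
    (Node (Node (Node (Node (Leaf (Nonpos 1 1)) Mirror Mirror) (Node Mirror Mirror Mirror) (Node
    Mirror Mirror Mirror)) (Node (Node (Leaf (Nonpos 1 1)) Mirror Mirror) (Node Mirror Mirror
    Mirror) (Node Mirror Mirror Mirror)) (Node (Node (Leaf (Nonpos 1 1)) Mirror Mirror) (Node
    Mirror Mirror Mirror) (Node Mirror Mirror Mirror))) (Node (Node (Node (Leaf (Nonpos 1 1))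
    Mirror Mirror) (Node Mirror Mirror Mirror) (Node Mirror Mirror Mirror)) (Node (Node (Leaf
    (Nonpos 1 1)) Mirror Mirror) (Node Mirror Mirror Mirror) (Node Mirror Mirror Mirror)) (Node
    (Node (Leaf (Nonpos 1 1)) Mirror Mirror) (Node Mirror Mirror Mirror) (Node Mirror Mirror
    Mirror))) (Node (Node (Node (Leaf (Nonpos 1 1)) Mirror Mirror) (Node Mirror Mirror Mirror)
    (Node Mirror Mirror Mirror)) (Node (Node (Leaf (Nonpos 1 1)) Mirror Mirror) (Node Mirror
    Mirror Mirror) (Node Mirror Mirror Mirror)) (Node (Node (Leaf (Multiple 825)) Mirror Mirror)
    (Node Mirror Mirror Mirror) (Node Mirror Mirror Mirror)))))"
  by code_simp

lemma check_degree_8_nz: "check_tree 5 [- 1, 0]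
   (Node (Node (Node (Node (Node (Leaf (Nonpos 1 1)) (Leaf (Nonpos 1 1)) Mirror) (Node (Leaf
    (Nonpos 1 1)) Mirror Mirror) (Node (Leaf (Nonpos 1 1)) Mirror Mirror)) (Node (Node (Leaf
    (Nonpos 1 1)) Mirror Mirror) (Node (Leaf (Nonpos 1 1)) Mirror Mirror) (Node (Leaf (Nonpos 1
    1)) Mirror Mirror)) (Node (Node (Leaf (Nonpos 1 1)) Mirror Mirror) (Node (Leaf (Nonpos 1 1))
    Mirror Mirror) (Node (Leaf (Nonpos 1 1)) Mirror Mirror))) (Node (Node (Node (Leaf (Nonpos 1
    1)) (Leaf (Nonpos 1 1)) Mirror) (Node (Leaf (Nonpos 1 1)) Mirror Mirror) (Node (Leaf (Nonpos
    1 1)) Mirror Mirror)) (Node (Node (Leaf (Nonpos 1 1)) Mirror Mirror) (Node (Leaf (Nonpos 1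
    1)) Mirror Mirror) (Node (Leaf (Nonpos 1 1)) Mirror Mirror)) (Node (Node (Leaf (Nonpos 1 1))
    Mirror Mirror) (Node (Leaf (Nonpos 1 1)) Mirror Mirror) (Node (Leaf (Search 1 [(359606,
    597884, 72, 697770, 2726885)])) Mirror Mirror))) (Node (Node (Node (Leaf (Nonpos 1 1)) (Leaf
    (Nonpos 1 1)) Mirror) (Node (Leaf (Nonpos 1 1)) Mirror Mirror) (Node (Leaf (Nonpos 1 1))
    Mirror Mirror)) (Node (Node (Leaf (Nonpos 1 1)) Mirror Mirror) (Node (Leaf (Nonpos 1 1))
    Mirror Mirror) (Node (Leaf (Search 3 [(418916, 639230, 81, 764350, 3310524)])) Mirror
    Mirror)) (Node (Node (Leaf (Nonpos 1 1)) Mirror Mirror) (Node (Leaf (Search 5 [(515244,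
    583436, 96, 778476, 3069112)])) Mirror Mirror) (Node (Leaf (Search 1 [(390061, 561314, 80,
    683616, 2486299)])) Mirror Mirror)))) (Node (Node (Node (Node (Leaf (Nonpos 1 1)) (Leaf
    (Nonpos 1 1)) Mirror) (Node (Leaf (Nonpos 1 1)) Mirror Mirror) (Node (Leaf (Nonpos 1 1))
    Mirror Mirror)) (Node (Node (Leaf (Nonpos 1 1)) (Leaf (Nonpos 1 1)) Mirror) (Node (Leaf
    (Nonpos 1 1)) Mirror Mirror) (Node (Leaf (Nonpos 1 1)) Mirror Mirror)) (Node (Node (Leaf
    (Nonpos 1 1)) Mirror Mirror) (Node (Leaf (Nonpos 1 1)) Mirror Mirror) (Node (Leaf (Search 2
    [(346915, 645224, 75, 732649, 3164054)])) Mirror Mirror))) (Node (Node (Node (Leaf (Nonpos 1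
    1)) (Leaf (Nonpos 1 1)) Mirror) (Node (Leaf (Nonpos 1 1)) Mirror Mirror) (Node (Leaf (Nonpos
    1 1)) Mirror Mirror)) (Node (Node (Leaf (Nonpos 1 1)) (Leaf (Nonpos 1 1)) Mirror) (Node
    (Leaf (Nonpos 1 1)) Mirror Mirror) (Node (Leaf (Multiple
    255277605013671521333522511229067033491622128618071204716684699170)) Mirror Mirror)) (Node
    (Node (Leaf (Nonpos 1 1)) Mirror Mirror) (Node (Leaf (Multiple 2198587)) Mirror Mirror)
    (Node (Leaf (Search 2 [(396133, 605927, 67, 723994, 2876723)])) Mirror Mirror))) (Node (Node
    (Node (Leaf (Nonpos 1 1)) (Leaf (Nonpos 1 1)) Mirror) (Node (Leaf (Nonpos 1 1)) Mirror
    Mirror) (Node (Leaf (Multiple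
    69123936855150093132434589712314442590211084184665244535379411593376105236202)) Mirror
    Mirror)) (Node (Node (Leaf (Nonpos 1 1)) (Leaf (Multiple 1433)) Mirror) (Node (Leaf
    (Multiple 211778413697066173901376769781526927943999878737263975890283921540)) Mirror
    Mirror) (Node (Leaf (Search 9 [(479684, 638207, 78, 798455, 3584530)])) Mirror Mirror))
    (Node (Node (Leaf (Multiple
    57899703193171102981266474413221975317327897060322750799439510902379455976490)) Mirror
    Mirror) (Node (Leaf (Search 6 [(572867, 538660, 135, 786476, 2875612)])) Mirror Mirror)
    (Node (Leaf (Search 1 [(422007, 553260, 81, 695917, 2485581)])) Mirror Mirror)))) (Node
    (Node (Node (Node (Leaf (Nonpos 1 1)) (Leaf (Nonpos 1 1)) Mirror) (Node (Leaf (Nonpos 1 1))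
    Mirror Mirror) (Node (Leaf (Nonpos 1 1)) Mirror Mirror)) (Node (Node (Leaf (Nonpos 1 1))
    (Leaf (Nonpos 1 1)) Mirror) (Node (Leaf (Nonpos 1 1)) Mirror Mirror) (Node (Leaf (Multiple
    48206171600905540842355680)) Mirror Mirror)) (Node (Node (Leaf (Nonpos 1 1)) (Leaf (Multiple
    3872164)) Mirror) (Node (Leaf (Multiple 44353655668995402604264310)) Mirror Mirror) (Node
    (Leaf (Search 5 [(394499, 672149, 103, 779471, 3654843)])) Mirror Mirror))) (Node (Node
    (Node (Leaf (Nonpos 1 1)) (Leaf (Nonpos 1 1)) Mirror) (Node (Leaf (Nonpos 1 1)) Mirror
    Mirror) (Node (Leaf (Multiple 1277009269)) Mirror Mirror)) (Node (Node (Leaf (Nonpos 1 1))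
    (Leaf (Multiple
    81909253600782360083166205465220727440320241212934449783925247379651952984732)) Mirror)
    (Node (Leaf (Multiple
    66468849619435261226390948486872883691819053226381152265154896417072774781980)) Mirror
    Mirror) (Node (Leaf (Multiple 85573995725390208)) Mirror Mirror)) (Node (Node (Leaf (Search
    5 [(802674, 239246, 284, 837855, 1708644)])) (Leaf (Multiple 120774694204)) Mirror) (Node
    (Leaf (Multiple 1355268438553307119876)) Mirror Mirror) (Node (Leaf (Search 2 [(446428,
    600664, 95, 748491, 2972263)])) Mirror Mirror))) (Node (Node (Node (Leaf (Nonpos 1 1)) (Leaf
    (Multiple 3010503)) Mirror) (Node (Leaf (Search 9 [(830678, 239657, 283, 864842, 1850157)]))
    Mirror Mirror) (Node (Leaf (Reversed (Search 20 [(-735971, 291650, 38, 791691, 7381118)])))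
    Mirror Mirror)) (Node (Node (Leaf (Search 1 [(779818, 170058, 377, 798523, 1335263)])) (Leaf
    (Multiple 53647310172450716806539282746373852193824822782441563079255345842606383948259))
    Mirror) (Node (Leaf (Multiple 2304401487097848757)) Mirror Mirror) (Node (Leaf (Search 11
    [(552865, 591786, 115, 809974, 3393063), (-267126, 876683, 21, 916498, 12552042)])) Mirror
    Mirror)) (Node (Node (Leaf (Search 1 [(689285, 318991, 193, 759712, 1744783)])) (Leaf
    (Multiple 3921275)) Mirror) (Node (Leaf (Search 2 [(582906, 465581, 129, 746149, 2283580)]))
    Mirror Mirror) (Node (Leaf (Search 1 [(452395, 531781, 96, 698274, 2391640)])) Mirror
    Mirror)))))"
  by code_simp

lemma check_degree_8_np: "check_tree 5 [- 1, 1]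
   (Node (Node (Node (Node (Node (Leaf (Nonpos 1 1)) (Leaf (Nonpos 1 1)) (Leaf (Nonpos 1 1)))
    (Node (Leaf (Nonpos 1 1)) (Leaf (Nonpos 1 1)) Mirror) (Node (Leaf (Nonpos 1 1)) (Leaf
    (Nonpos 1 1)) Mirror)) (Node (Node (Leaf (Nonpos 1 1)) (Leaf (Nonpos 1 1)) Mirror) (Node
    (Leaf (Nonpos 1 1)) (Leaf (Nonpos 1 1)) Mirror) (Node (Leaf (Nonpos 1 1)) (Leaf (Search 55
    [(150016, 772600, 49, 787079, 4752087)])) Mirror)) (Node (Node (Leaf (Nonpos 1 1)) (Leaf
    (Nonpos 1 1)) Mirror) (Node (Leaf (Nonpos 1 1)) (Leaf (Search 6 [(263726, 754629, 46,
    799431, 4582564), (-864261, 0, 34, 864295, 10884414)])) Mirror) (Node (Leaf (Search 1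
    [(305030, 623410, 98, 694133, 2870832)])) (Leaf (Search 1 [(181270, 700033, 57, 723179,
    3591831)])) Mirror))) (Node (Node (Node (Leaf (Nonpos 1 1)) (Leaf (Nonpos 1 1)) (Leaf
    (Nonpos 1 1))) (Node (Leaf (Nonpos 1 1)) (Leaf (Nonpos 1 1)) Mirror) (Node (Leaf (Nonpos 1
    1)) (Leaf (Reversed (Search 3 [(-681280, 254529, 53, 727327, 5707321)]))) Mirror)) (Node
    (Node (Leaf (Nonpos 1 1)) (Leaf (Nonpos 1 1)) Mirror) (Node (Leaf (Nonpos 1 1)) (Leaf
    (Multiple 261224864527356232169519185779518199587238194466397616525321027615)) Mirror) (Node
    (Leaf (Reversed (Search 4 [(-703285, 226535, 53, 738923, 5981888)]))) (Leaf (Reversed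
    (Search 16 [(-736352, 227782, 47, 770826, 6793378)]))) Mirror)) (Node (Node (Leaf (Nonpos 1
    1)) (Leaf (Reversed (Search 23 [(-701191, 0, 53, 701244, 5282610), (-568264, 728176, 23,
    923692, 14889101)]))) Mirror) (Node (Leaf (Search 19 [(446333, 673361, 68, 807923,
    3936554)])) (Leaf (Multiple
    51005579675032131682432403519983160643998124546623221164776663830438980112210)) Mirror)
    (Node (Leaf (Search 1 [(348049, 606469, 98, 699343, 2782349)])) (Leaf (Search 3 [(229601,
    698549, 50, 735365, 3603852)])) Mirror))) (Node (Node (Node (Leaf (Nonpos 1 1)) (Leaf
    (Nonpos 1 1)) (Leaf (Multiple 915))) (Node (Leaf (Nonpos 1 1)) (Leaf (Reversed (Search 3
    [(-653389, 298656, 46, 718456, 5488781)]))) Mirror) (Node (Leaf (Reversed (Search 2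
    [(-619507, 276674, 72, 678554, 4791834)]))) (Leaf (Reversed (Search 2 [(-628969, 286711, 58,
    691293, 4994922)]))) Mirror)) (Node (Node (Leaf (Nonpos 1 1)) (Leaf (Multiple
    71833964045094011444742111704624255616302338313757699965865015595109516841609)) Mirror)
    (Node (Leaf (Reversed (Search 4 [(-685687, 277230, 57, 739668, 5961822)]))) (Leaf (Reversed
    (Search 7 [(-714590, 295871, 46, 773467, 6814432)]))) Mirror) (Node (Leaf (Reversed (Search
    3 [(-653786, 271964, 66, 708163, 5310494)]))) (Leaf (Reversed (Search 3 [(-670850, 284300,
    48, 728654, 5712264)]))) Mirror)) (Node (Node (Leaf (Multiple 921)) (Leaf (Multiple
    57114974387308866916196499073712138410137268362891944195353051787058190910389)) Mirror)
    (Node (Leaf (Search 16 [(515615, 623551, 111, 809231, 3594163)])) (Leaf (Multiple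
    45998474333342734309142093)) Mirror) (Node (Leaf (Search 1 [(385290, 574017, 116, 691451,
    2575880)])) (Leaf (Search 2 [(275999, 682819, 60, 736550, 3465174)])) Mirror)))) (Node (Node
    (Node (Node (Leaf (Nonpos 1 1)) (Leaf (Nonpos 1 1)) (Leaf (Nonpos 1 1))) (Node (Leaf (Nonpos
    1 1)) (Leaf (Nonpos 1 1)) Mirror) (Node (Leaf (Nonpos 1 1)) (Leaf (Reversed (Search 8
    [(-662052, 0, 86, 662138, 4641919), (-891742, 0, 45, 891787, 12976791)]))) Mirror)) (Node
    (Node (Leaf (Nonpos 1 1)) (Leaf (Nonpos 1 1)) (Leaf (Search 1 [(-583816, 0, 48, 583864,
    3683438)]))) (Node (Leaf (Nonpos 1 1)) (Leaf (Reversed (Search 1 [(-601788, 0, 30, 601818,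
    3873604)]))) Mirror) (Node (Leaf (Reversed (Search 1 [(-630092, 0, 69, 630161, 4207028)])))
    (Leaf (Reversed (Search 1 [(-617595, 0, 46, 617641, 4054336)]))) Mirror)) (Node (Node (Leaf
    (Nonpos 1 1)) (Leaf (Reversed (Search 1 [(-572488, 0, 41, 572529, 3570765)]))) Mirror) (Node
    (Leaf (Reversed (Search 1 [(-587176, 0, 49, 587225, 3717911)]))) (Leaf (Reversed (Search 1
    [(-581438, 0, 34, 581472, 3659205)]))) Mirror) (Node (Leaf (Reversed (Search 1 [(-599411, 0,
    67, 599478, 3847958)]))) (Leaf (Reversed (Search 1 [(-592156, 0, 49, 592205, 3769924)])))
    Mirror))) (Node (Node (Node (Leaf (Nonpos 1 1)) (Leaf (Nonpos 1 1)) (Leaf (Multiple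
    66253745867345449519020662812840926935183433818276284897559503890807193181260))) (Node (Leaf
    (Nonpos 1 1)) (Leaf (Multiple 11527730546488375927)) Mirror) (Node (Leaf (Reversed (Search 4
    [(-698928, 155163, 60, 716005, 5531639)]))) (Leaf (Reversed (Search 6 [(-727689, 139917, 55,
    741074, 6075980)]))) Mirror)) (Node (Node (Leaf (Nonpos 1 1)) (Leaf (Reversed (Search 1
    [(-633487, 0, 39, 633526, 4249637)]))) (Leaf (Search 1 [(-622333, 0, 47, 622380,
    4111077)]))) (Node (Leaf (Search 31 [(865522, 210846, 228, 891062, 1860307)])) (Leaf
    (Multiple 33033358144130683465616438540579972725630858079448043409315546849719492051093))
    Mirror) (Node (Leaf (Multiple 7597)) (Leaf (Reversed (Search 25 [(-715473, 0, 95, 715568,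
    5554939), (-848015, 0, 67, 848082, 9919450)]))) Mirror)) (Node (Node (Leaf (Search 1
    [(814624, 162209, 400, 831017, 1374032)])) (Leaf (Reversed (Search 1 [(-605566, 0, 40,
    605606, 3915696)]))) Mirror) (Node (Leaf (Reversed (Search 1 [(-632353, 0, 50, 632403,
    4235341)]))) (Leaf (Reversed (Search 1 [(-620720, 0, 33, 620753, 4091455)]))) Mirror) (Node
    (Leaf (Search 2 [(382754, 622897, 96, 731192, 3012622)])) (Leaf (Reversed (Search 1
    [(-641643, 0, 52, 641695, 4356010)]))) Mirror))) (Node (Node (Node (Leaf (Nonpos 1 1)) (Leaf
    (Search 15 [(-570238, 649148, 35, 864075, 9912566), (891683, 198892, 278, 913874,
    1974149)])) (Leaf (Multiple
    1664712549022917454634509004631093892919773848950375112749698777))) (Node (Leaf (Search 1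
    [(833893, 167371, 371, 850895, 1445910)])) (Leaf (Reversed (Search 5 [(-716630, 201812, 45,
    744550, 6127954)]))) Mirror) (Node (Leaf (Reversed (Search 3 [(-659744, 210225, 61, 692490,
    5068663)]))) (Leaf (Reversed (Search 3 [(-678434, 212128, 51, 710876, 5402915)]))) Mirror))
    (Node (Node (Leaf (Search 1 [(791453, 93009, 690, 797590, 1145218)])) (Leaf (Multiple
    102034441225776846843728802172742307025682808515582823466)) (Leaf (Multiple 242000))) (Node
    (Leaf (Reversed (Search 8 [(-734909, 160555, 50, 752293, 6337639)]))) (Leaf (Multiple
    57745)) Mirror) (Node (Leaf (Reversed (Search 3 [(-696104, 184608, 55, 720223, 5602812)])))
    (Leaf (Reversed (Search 6 [(-725869, 177421, 50, 747288, 6206588)]))) Mirror)) (Node (Node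
    (Leaf (Search 1 [(735968, 281097, 230, 788053, 1693004)])) (Leaf (Multiple
    44645514448287833969489060)) Mirror) (Node (Leaf (Multiple 5385855571181)) (Leaf (Multiple
    8256847093044959218828428016658439989236349827695459607039052170084834549981)) Mirror) (Node
    (Leaf (Search 1 [(422934, 570963, 117, 710661, 2628701)])) (Leaf (Search 7 [(307999, 706138,
    59, 770445, 3858039)])) Mirror)))) (Node (Node (Node (Node (Leaf (Nonpos 1 1)) (Leaf (Nonpos
    1 1)) (Leaf (Search 1 [(-626112, 0, 58, 626170, 4157372)]))) (Node (Leaf (Nonpos 1 1)) (Leaf
    (Reversed (Search 1 [(-559000, 0, 41, 559041, 3443490)]))) Mirror) (Node (Leaf (Reversed
    (Search 1 [(-573177, 0, 72, 573249, 3577762)]))) (Leaf (Reversed (Search 1 [(-567683, 0, 57,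
    567740, 3524758)]))) Mirror)) (Node (Node (Leaf (Nonpos 1 1)) (Leaf (Reversed (Search 1
    [(-539757, 0, 38, 539795, 3273566)]))) (Leaf (Search 1 [(-568185, 0, 52, 568237,
    3529490)]))) (Node (Leaf (Search 1 [(846886, 171898, 362, 864518, 1511794)])) (Leaf
    (Reversed (Search 1 [(-545644, 0, 29, 545673, 3324083)]))) Mirror) (Node (Leaf (Reversed
    (Search 1 [(-556254, 0, 57, 556311, 3418578)]))) (Leaf (Reversed (Search 1 [(-552314, 0, 42,
    552356, 3382974)]))) Mirror)) (Node (Node (Leaf (Search 1 [(804020, 109832, 715, 812203,
    1192436)])) (Leaf (Reversed (Search 1 [(-529797, 0, 44, 529841, 3190628)]))) (Leaf (Search 1
    [(-527508, 0, 54, 527562, 3172085)]))) (Node (Leaf (Reversed (Search 1 [(-537375, 0, 48,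
    537423, 3253509)]))) (Leaf (Reversed (Search 1 [(-534678, 0, 34, 534712, 3230812)])))
    Mirror) (Node (Leaf (Reversed (Search 1 [(-543131, 0, 59, 543190, 3302600)]))) (Leaf
    (Reversed (Search 1 [(-540083, 0, 47, 540130, 3276413)]))) Mirror))) (Node (Node (Node (Leaf
    (Nonpos 1 1)) (Leaf (Reversed (Search 1 [(-581370, 0, 47, 581417, 3658651)]))) (Leaf
    (Reversed (Search 1 [(-575612, 0, 59, 575671, 3601456)])))) (Node (Leaf (Search 1 [(821461,
    122679, 507, 831079, 1246919)])) (Leaf (Reversed (Search 1 [(-593901, 0, 44, 593945,
    3788365)]))) Mirror) (Node (Leaf (Reversed (Search 1 [(-624781, 0, 98, 624879, 4141509)])))
    (Leaf (Reversed (Search 1 [(-610759, 0, 68, 610827, 3974904)]))) Mirror)) (Node (Node (Leaf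
    (Nonpos 3 4)) (Leaf (Reversed (Search 1 [(-564001, 0, 39, 564040, 3489835)]))) (Leaf (Search
    1 [(-598438, 0, 49, 598487, 3837177)]))) (Node (Leaf (Reversed (Search 1 [(-578555, 0, 44,
    578599, 3630426)]))) (Leaf (Reversed (Search 1 [(-572892, 0, 28, 572920, 3574562)])))
    Mirror) (Node (Leaf (Reversed (Search 1 [(-590988, 0, 60, 591048, 3757739)]))) (Leaf
    (Reversed (Search 1 [(-583680, 0, 41, 583721, 3681982)]))) Mirror)) (Node (Node (Leaf
    (Search 1 [(739367, 238066, 256, 777005, 1507756)])) (Leaf (Reversed (Search 1 [(-550386, 0,
    44, 550430, 3365840)]))) (Leaf (Search 1 [(-547131, 0, 48, 547179, 3337217)]))) (Node (Leaf
    (Reversed (Search 1 [(-561354, 0, 49, 561403, 3465269)]))) (Leaf (Reversed (Search 1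
    [(-557258, 0, 33, 557291, 3427489)]))) Mirror) (Node (Leaf (Reversed (Search 1 [(-570099, 0,
    61, 570160, 3547891)]))) (Leaf (Reversed (Search 1 [(-565196, 0, 46, 565242, 3501122)])))
    Mirror))) (Node (Node (Node (Leaf (Nonpos 2 3)) (Leaf (Reversed (Search 1 [(-629928, 0, 75,
    630003, 4205044)]))) (Leaf (Reversed (Search 1 [(-617216, 0, 84, 617300, 4050301)])))) (Node
    (Leaf (Search 1 [(763641, 244393, 238, 802034, 1597587)])) (Leaf (Reversed (Search 6
    [(-664250, 0, 86, 664336, 4674471), (-868792, 0, 51, 868843, 11186369)]))) Mirror) (Node
    (Leaf (Multiple 949)) (Leaf (Search 3 [(-309303, 672509, 45, 740273, 5153839)])) Mirror))
    (Node (Node (Leaf (Search 1 [(727745, 186592, 302, 751588, 1311471)])) (Leaf (Reversed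
    (Search 1 [(-598629, 0, 53, 598682, 3839294)]))) (Leaf (Search 1 [(-642868, 0, 63, 642931,
    4372478)]))) (Node (Leaf (Reversed (Search 1 [(-628241, 0, 69, 628310, 4183880)]))) (Leaf
    (Reversed (Search 1 [(-615036, 0, 47, 615083, 4024224)]))) Mirror) (Node (Leaf (Reversed
    (Search 7 [(-667820, 0, 151, 667971, 4729129), (-791547, 0, 106, 791653, 7510500)]))) (Leaf
    (Reversed (Search 1 [(-639674, 0, 72, 639746, 4330245)]))) Mirror)) (Node (Node (Leaf
    (Search 1 [(669049, 294850, 208, 731347, 1589277)])) (Leaf (Reversed (Search 1 [(-577770, 0,
    52, 577822, 3622703)]))) (Leaf (Search 1 [(-572656, 0, 65, 572721, 3572629)]))) (Node (Leaf
    (Reversed (Search 1 [(-596009, 0, 63, 596072, 3811101)]))) (Leaf (Reversed (Search 1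
    [(-588643, 0, 50, 588693, 3733126)]))) Mirror) (Node (Leaf (Search 1 [(464495, 547690, 135,
    718272, 2542303)])) (Leaf (Reversed (Search 1 [(-602410, 0, 64, 602474, 3880843)])))
    Mirror)))))"
  by code_simp

lemma check_degree_8_zn: "check_tree 5 [0, - 1]
   (Node (Node (Node (Node (Node (Leaf (Nonpos 1 1)) Mirror Mirror) (Node (Leaf (Nonpos 1 1))
    Mirror Mirror) (Node Mirror Mirror Mirror)) (Node (Node (Leaf (Nonpos 1 1)) Mirror Mirror)
    (Node Mirror Mirror Mirror) (Node Mirror Mirror Mirror)) (Node (Node (Leaf (Nonpos 1 1))
    Mirror Mirror) (Node Mirror Mirror Mirror) (Node Mirror Mirror Mirror))) (Node (Node (Node
    (Leaf (Nonpos 1 1)) Mirror Mirror) (Node (Leaf (Nonpos 1 1)) Mirror Mirror) (Node Mirror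
    Mirror Mirror)) (Node (Node (Leaf (Nonpos 1 1)) Mirror Mirror) (Node Mirror Mirror Mirror)
    (Node Mirror Mirror Mirror)) (Node (Node (Leaf (Nonpos 1 1)) Mirror Mirror) (Node Mirror
    Mirror Mirror) (Node Mirror Mirror Mirror))) (Node (Node (Node (Leaf (Nonpos 1 1)) Mirror
    Mirror) (Node (Leaf (Nonpos 1 1)) Mirror Mirror) (Node Mirror Mirror Mirror)) (Node (Node
    (Leaf (Nonpos 1 1)) Mirror Mirror) (Node Mirror Mirror Mirror) (Node Mirror Mirror Mirror))
    (Node (Node (Leaf (Nonpos 1 1)) Mirror Mirror) (Node Mirror Mirror Mirror) (Node Mirror
    Mirror Mirror)))) (Node (Node (Node (Node (Leaf (Nonpos 1 1)) Mirror Mirror) (Node (Leaf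
    (Nonpos 1 1)) Mirror Mirror) (Node Mirror Mirror Mirror)) (Node (Node (Leaf (Nonpos 1 1))
    Mirror Mirror) (Node (Leaf (Nonpos 1 1)) Mirror Mirror) (Node Mirror Mirror Mirror)) (Node
    (Node (Leaf (Nonpos 1 1)) Mirror Mirror) (Node Mirror Mirror Mirror) (Node Mirror Mirror
    Mirror))) (Node (Node (Node (Leaf (Nonpos 1 1)) Mirror Mirror) (Node (Leaf (Nonpos 1 1))
    Mirror Mirror) (Node Mirror Mirror Mirror)) (Node (Node (Leaf (Nonpos 1 1)) Mirror Mirror)
    (Node (Leaf (Nonpos 1 1)) Mirror Mirror) (Node Mirror Mirror Mirror)) (Node (Node (Leaf
    (Nonpos 1 1)) Mirror Mirror) (Node Mirror Mirror Mirror) (Node Mirror Mirror Mirror))) (Node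
    (Node (Node (Leaf (Nonpos 1 1)) Mirror Mirror) (Node (Leaf (Nonpos 1 1)) Mirror Mirror)
    (Node Mirror Mirror Mirror)) (Node (Node (Leaf (Nonpos 1 1)) Mirror Mirror) (Node (Leaf
    (Multiple 1337923390)) Mirror Mirror) (Node Mirror Mirror Mirror)) (Node (Node (Leaf (Search
    7 [(758946, 342450, 272, 832901, 2181884)])) Mirror Mirror) (Node Mirror Mirror Mirror)
    (Node Mirror Mirror Mirror)))) (Node (Node (Node (Node (Leaf (Nonpos 1 1)) Mirror Mirror)
    (Node (Leaf (Nonpos 1 1)) Mirror Mirror) (Node Mirror Mirror Mirror)) (Node (Node (Leaf
    (Nonpos 1 1)) Mirror Mirror) (Node (Leaf (Nonpos 1 1)) Mirror Mirror) (Node Mirror Mirror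
    Mirror)) (Node (Node (Leaf (Nonpos 1 1)) Mirror Mirror) (Node (Leaf (Multiple 32768)) Mirror
    Mirror) (Node Mirror Mirror Mirror))) (Node (Node (Node (Leaf (Nonpos 1 1)) Mirror Mirror)
    (Node (Leaf (Nonpos 1 1)) Mirror Mirror) (Node Mirror Mirror Mirror)) (Node (Node (Leaf
    (Nonpos 1 1)) Mirror Mirror) (Node (Leaf (Multiple 49009721218777000284738730)) Mirror
    Mirror) (Node Mirror Mirror Mirror)) (Node (Node (Leaf (Search 5 [(779285, 271421, 291,
    825491, 1798517)])) Mirror Mirror) (Node (Leaf (Multiple 28806674)) Mirror Mirror) (Node
    Mirror Mirror Mirror))) (Node (Node (Node (Leaf (Nonpos 1 1)) Mirror Mirror) (Node (Leaf
    (Reversed (Search 6 [(546711, 564614, 129, 786057, 3017874)]))) Mirror Mirror) (Node Mirror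
    Mirror Mirror)) (Node (Node (Leaf (Search 1 [(765198, 197594, 343, 790642, 1405812)]))
    Mirror Mirror) (Node (Leaf (Reversed (Search 3 [(581382, 501170, 120, 767699, 2558295)])))
    Mirror Mirror) (Node Mirror Mirror Mirror)) (Node (Node (Leaf (Search 1 [(666911, 320711,
    181, 740199, 1695741)])) Mirror Mirror) (Node (Leaf (Search 1 [(574050, 444102, 113, 725896,
    2112352)])) Mirror Mirror) (Node Mirror Mirror Mirror)))))"
  by code_simp

text \<open>1 - X^3 + X^5 + X^8 has the largest step bound of all certificates, 96, although its
  search prunes at two roots. The numeral 65536, sixteen digits -1, serves 1 + X^8.\<close>

lemma check_degree_8_zz: "check_tree 5 [0, 0]
   (Node (Node (Node (Node (Node (Leaf (Nonpos 1 1)) (Leaf (Nonpos 1 1)) Mirror) (Node (Leaf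
    (Nonpos 1 1)) (Leaf (Nonpos 1 1)) Mirror) (Node (Leaf (Nonpos 1 1)) Mirror Mirror)) (Node
    (Node (Leaf (Nonpos 1 1)) (Leaf (Nonpos 1 1)) Mirror) (Node (Leaf (Nonpos 1 1)) Mirror
    Mirror) (Node (Leaf (Nonpos 1 1)) Mirror Mirror)) (Node (Node (Leaf (Nonpos 1 1)) (Leaf
    (Nonpos 1 1)) Mirror) (Node (Leaf (Nonpos 1 1)) Mirror Mirror) (Node (Leaf (Search 1
    [(309883, 643152, 70, 713984, 3069696)])) Mirror Mirror))) (Node (Node (Node (Leaf (Nonpos 1
    1)) (Leaf (Nonpos 1 1)) Mirror) (Node (Leaf (Nonpos 1 1)) (Leaf (Nonpos 1 1)) Mirror) (Node
    (Leaf (Nonpos 1 1)) Mirror Mirror)) (Node (Node (Leaf (Nonpos 1 1)) (Leaf (Nonpos 1 1))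
    Mirror) (Node (Leaf (Nonpos 1 1)) Mirror Mirror) (Node (Leaf (Multiple 9290932804653990989))
    Mirror Mirror)) (Node (Node (Leaf (Nonpos 1 1)) (Leaf (Multiple
    63450307822141146299401191237875519140658494636606037547252600239315044273088)) Mirror)
    (Node (Leaf (Multiple
    65062494284240172316196101657280731355216796825607481651528889042322694950549)) Mirror
    Mirror) (Node (Leaf (Search 2 [(363030, 622382, 60, 720581, 2960299)])) Mirror Mirror)))
    (Node (Node (Node (Leaf (Nonpos 1 1)) (Leaf (Nonpos 1 1)) Mirror) (Node (Leaf (Nonpos 1 1))
    (Leaf (Multiple 190899)) Mirror) (Node (Leaf (Multiple 69675674062147993429357610)) Mirror
    Mirror)) (Node (Node (Leaf (Nonpos 1 1)) (Leaf (Multiple 9313312197748889107)) Mirror) (Node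
    (Leaf (Multiple 234026466320380191637079546898466262085970024256262649884856353362)) Mirror
    Mirror) (Node (Leaf (Multiple
    13668386778497568398610036803586345843975079946462145199858530474758469789394)) Mirror
    Mirror)) (Node (Node (Leaf (Search 8 [(819453, 250817, 258, 857237, 1863122)])) (Leaf
    (Multiple 23919180701251264612431244400745790336)) Mirror) (Node (Leaf (Multiple
    8261946619925)) Mirror Mirror) (Node (Leaf (Search 1 [(404812, 578872, 81, 706456,
    2653721)])) Mirror Mirror)))) (Node (Node (Node (Node (Leaf (Nonpos 1 1)) (Leaf (Nonpos 1
    1)) Mirror) (Node (Leaf (Nonpos 1 1)) (Leaf (Nonpos 1 1)) Mirror) (Node (Leaf (Nonpos 1 1))
    Mirror Mirror)) (Node (Node (Leaf (Nonpos 1 1)) (Leaf (Nonpos 1 1)) Mirror) (Node (Leaf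
    (Nonpos 1 1)) (Leaf (Multiple 7228)) Mirror) (Node (Leaf (Multiple 34693)) Mirror Mirror))
    (Node (Node (Leaf (Nonpos 1 1)) (Leaf (Multiple
    63444115753177881545898318777480670815569627333467174291376508065276412138779)) Mirror)
    (Node (Leaf (Multiple 4488212886393930)) Mirror Mirror) (Node (Leaf (Search 5 [(337125,
    679308, 67, 758429, 3555202)])) Mirror Mirror))) (Node (Node (Node (Leaf (Nonpos 1 1)) (Leaf
    (Nonpos 1 1)) Mirror) (Node (Leaf (Nonpos 1 1)) (Leaf (Multiple
    217206401287484274306548973147396306535408644801228626505542969674)) Mirror) (Node (Leaf
    (Multiple 381090230767128248953947726250119978407220431219502080115368534369)) Mirror
    Mirror)) (Node (Node (Leaf (Nonpos 1 1)) (Leaf (Multiple 1084200569)) Mirror) (Node (Leaf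
    (Multiple 9288111348932447014)) (Leaf (Multiple 65536)) Mirror) (Node (Leaf (Multiple
    50690636071936102855810474987118621454481073232343706865964893349860371929362)) Mirror
    Mirror)) (Node (Node (Leaf (Search 1 [(807620, 194292, 196, 830859, 1491716)])) (Leaf
    (Multiple 110148301194480818657716927280335388699594016412411243705)) Mirror) (Node (Leaf
    (Multiple 38667204917537229353067594)) Mirror Mirror) (Node (Leaf (Search 3 [(411691,
    640016, 64, 761057, 3293121)])) Mirror Mirror))) (Node (Node (Node (Leaf (Nonpos 1 1)) (Leaf
    (Multiple 77505510785281167580192946379963362390096582495581809352243172421881457595993))
    Mirror) (Node (Leaf (Search 1 [(830004, 197849, 186, 853445, 1585267)])) (Leaf (Multiple
    57444926638189373900305203397091579193713427892688430639641468482153511374513)) Mirror)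
    (Node (Leaf (Multiple 36458681200642283706543388)) Mirror Mirror)) (Node (Node (Leaf (Search
    1 [(785034, 128041, 312, 795720, 1216344)])) (Leaf (Multiple 532676620)) Mirror) (Node (Leaf
    (Multiple 57670110023338968325855276802092371639137094479216198868394096233560187040985))
    (Leaf (Multiple 4096)) Mirror) (Node (Leaf (Multiple 45714)) Mirror Mirror)) (Node (Node
    (Leaf (Search 1 [(714590, 295871, 131, 773552, 1701679)])) (Leaf (Multiple
    95922455015626394765720049201325369258180973857705777547337462088325538938099)) Mirror)
    (Node (Leaf (Search 4 [(626656, 486657, 97, 793529, 2648448)])) Mirror Mirror) (Node (Leaf
    (Search 1 [(447851, 565310, 70, 721282, 2642991)])) Mirror Mirror)))) (Node (Node (Node
    (Node (Leaf (Nonpos 1 1)) (Leaf (Nonpos 1 1)) Mirror) (Node (Leaf (Nonpos 1 1)) (Leaf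
    (Multiple 259015)) Mirror) (Node (Leaf (Search 28 [(-32813, 848675, 40, 849350, 7235315),
    (894770, 234637, 184, 925208, 2386159)])) Mirror Mirror)) (Node (Node (Leaf (Nonpos 1 1))
    (Leaf (Multiple 18371024006146752051)) Mirror) (Node (Leaf (Search 8 [(845284, 201766, 209,
    869240, 1675925)])) (Leaf (Multiple
    37095685801546806640938229743425641626996720383614582042565255852682879330058)) Mirror)
    (Node (Leaf (Multiple
    8636819107218425433004451817849714979899561159199615144452382472249308173781)) Mirror
    Mirror)) (Node (Node (Leaf (Search 1 [(798916, 142411, 391, 811901, 1275138)])) (Leaf
    (Search 36 [(-691553, 0, 26, 691579, 5111205), (880503, 364751, 87, 953150, 4414012)]))
    Mirror) (Node (Leaf (Multiple 4924249513273)) (Leaf (Multiple 156003)) Mirror) (Node (Leaf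
    (Multiple 75103353604928594849660493)) Mirror Mirror))) (Node (Node (Node (Leaf (Nonpos 1
    1)) (Leaf (Search 34 [(876352, 194389, 177, 897830, 1807737)])) Mirror) (Node (Leaf (Search
    1 [(818297, 152388, 246, 832612, 1341921)])) (Leaf (Search 96 [(-337363, 780546, 28, 850361,
    8414690), (892587, 349310, 62, 958566, 4457343)])) Mirror) (Node (Leaf (Search 40 [(-134229,
    865389, 28, 875766, 8893015), (828473, 353354, 100, 900782, 2954284)])) Mirror Mirror))
    (Node (Node (Leaf (Search 1 [(780367, 58550, 618, 783179, 1087084)])) (Leaf (Multiple
    2116105221362940399497531801923097841783446437819086461616688918)) Mirror) (Node (Leaf
    (Search 5 [(769386, 313498, 97, 830902, 2022699)])) (Leaf (Multiple
    263653709872442566843255886161807483362533155584234031384960004778)) Mirror) (Node (Leaf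
    (Multiple 17956739297911581661)) Mirror Mirror)) (Node (Node (Leaf (Search 1 [(724397,
    253981, 151, 767783, 1538452)])) (Leaf (Search 21 [(-751132, 0, 24, 751156, 6345088),
    (797889, 452425, 65, 917298, 4131909)])) Mirror) (Node (Leaf (Search 9 [(684219, 436072, 97,
    811463, 2513407)])) (Leaf (Multiple 1540126183028668885)) Mirror) (Node (Leaf (Search 12
    [(499497, 629445, 101, 803655, 3576493)])) Mirror Mirror))) (Node (Node (Node (Leaf (Nonpos
    2 3)) (Leaf (Reversed (Search 17 [(395072, 695232, 46, 799690, 4020130)]))) Mirror) (Node
    (Leaf (Search 1 [(750574, 262307, 145, 795234, 1643779)])) (Leaf (Search 37 [(-406661,
    737487, 33, 842209, 8289723), (823660, 431523, 62, 929916, 4300720)])) Mirror) (Node (Leaf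
    (Search 12 [(736617, 431222, 106, 853662, 2863811), (-216384, 841522, 24, 868921,
    8867721)])) Mirror Mirror)) (Node (Node (Leaf (Search 1 [(716630, 201812, 186, 744691,
    1341117)])) (Leaf (Multiple 15306226646935168918)) Mirror) (Node (Leaf (Search 2 [(682651,
    366264, 94, 774796, 1983286)])) (Leaf (Multiple
    53389927735327740295429207901828382994276575108279647614683493905138393459018)) Mirror)
    (Node (Leaf (Search 38 [(616178, 534834, 99, 816018, 3101479), (-241484, 938979, 18, 969552,
    21172375)])) Mirror Mirror)) (Node (Node (Leaf (Search 1 [(653389, 298656, 135, 718545,
    1574247)])) (Leaf (Multiple 36322377899617081517057243365446748909)) Mirror) (Node (Leaf
    (Search 1 [(590495, 427621, 94, 729165, 2057522)])) (Leaf (Multiple 163899)) Mirror) (Node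
    (Leaf (Search 1 [(480847, 528251, 88, 714415, 2433676)])) Mirror Mirror)))))"
  by code_simp

text \<open>1 - X - X^2 - X^3 + X^4 + X^5 + X^7 + X^8 has a conjugate pair of roots near 0.692 +-
  0.039 i, almost a double real root. There P' is small, which drives the certified error radius up
  to 1174 units.\<close>

lemma check_degree_8_zp: "check_tree 5 [0, 1]
   (Node (Node (Node (Node (Node (Leaf (Nonpos 1 1)) (Leaf (Nonpos 1 1)) (Leaf (Nonpos 1 1)))
    (Node (Leaf (Nonpos 1 1)) (Leaf (Nonpos 1 1)) (Leaf (Multiple 57592))) (Node (Leaf (Nonpos 1
    1)) (Leaf (Multiple 69165525330120163570770085)) Mirror)) (Node (Node (Leaf (Nonpos 1 1))
    (Leaf (Nonpos 1 1)) (Leaf (Search 1 [(-619508, 0, 58, 619566, 4077233)]))) (Node (Leaf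
    (Nonpos 1 1)) (Leaf (Multiple 4222429569486496)) Mirror) (Node (Leaf (Search 4 [(257006,
    706516, 66, 751876, 3749989)])) (Leaf (Search 7 [(111381, 770684, 41, 778732, 4715180)]))
    Mirror)) (Node (Node (Leaf (Nonpos 1 1)) (Leaf (Reversed (Search 4 [(-409633, 686240, 31,
    799234, 6777567), (-800485, 0, 41, 800526, 7816666)]))) (Leaf (Search 1 [(-554955, 0, 50,
    555005, 3406758)]))) (Node (Leaf (Multiple 65101)) (Leaf (Multiple 4941990252013)) Mirror)
    (Node (Leaf (Search 1 [(294281, 640888, 83, 705306, 3023756)])) (Leaf (Search 1 [(159042,
    705642, 52, 723395, 3661467)])) Mirror))) (Node (Node (Node (Leaf (Nonpos 1 1)) (Leaf
    (Nonpos 1 1)) (Leaf (Multiple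
    216373267675951657756244805698648375305375062887185204314365913484))) (Node (Leaf (Nonpos 1
    1)) (Leaf (Multiple
    68868563815825116522435304487918798894856295870176857537407894847562357481834)) (Leaf
    (Multiple 33230624))) (Node (Leaf (Reversed (Search 3 [(-644007, 369040, 40, 742291,
    5930882)]))) (Leaf (Reversed (Search 8 [(-651383, 393501, 37, 761052, 6363669)]))) Mirror))
    (Node (Node (Leaf (Nonpos 1 1)) (Leaf (Multiple 3963958)) (Leaf (Multiple
    55898308066206255728908775494717121715627582252096432757041164325163073824804))) (Node (Leaf
    (Search 8 [(856400, 176269, 248, 874601, 1573215)])) (Leaf (Multiple
    38667934584179827161650085)) Mirror) (Node (Leaf (Search 12 [(319567, 715578, 57, 783751,
    4044946)])) (Leaf (Multiple 2132026)) Mirror)) (Node (Node (Leaf (Search 1 [(812402, 121286,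
    465, 821871, 1230150)])) (Leaf (Multiple 2221917709818793214290)) (Leaf (Search 1 [(-586512,
    0, 53, 586565, 3711102)]))) (Node (Leaf (Search 21 [(439146, 722840, 47, 845829, 4890038),
    (839469, 337070, 131, 904744, 2892745)])) (Leaf (Multiple
    61943901503588065157317192149913880680800769900698988818466015254662702565549)) Mirror)
    (Node (Leaf (Search 2 [(345717, 630527, 94, 719180, 3006103)])) (Leaf (Search 4 [(209615,
    714811, 47, 744959, 3806682)])) Mirror))) (Node (Node (Node (Leaf (Nonpos 1 1)) (Leaf
    (Reversed (Search 3 [(-582906, 465581, 65, 746085, 5881488)]))) (Leaf (Reversed (Search 2
    [(-557172, 472671, 64, 730721, 5522167)])))) (Node (Leaf (Search 1 [(829510, 131039, 434,
    840231, 1286913)])) (Leaf (Reversed (Search 2 [(-590495, 427621, 42, 729113, 5560153)])))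
    (Leaf (Search 2 [(-574050, 444102, 62, 725845, 5466123)]))) (Node (Leaf (Reversed (Search 2
    [(-588468, 382440, 53, 701876, 5084628)]))) (Leaf (Reversed (Search 2 [(-585471, 398509, 44,
    708272, 5182682)]))) Mirror)) (Node (Node (Leaf (Multiple 4905048429622)) (Leaf (Multiple
    23647581969126665214627630905688772786)) (Leaf (Reversed (Search 6 [(-541714, 521395, 48,
    751917, 5915640)])))) (Node (Leaf (Search 10 [(800501, 297925, 145, 854289, 2093143)]))
    (Leaf (Reversed (Search 14 [(-626656, 486657, 43, 793475, 7170780)]))) Mirror) (Node (Leaf
    (Reversed (Search 3 [(-626005, 400020, 45, 742944, 5907027)]))) (Leaf (Reversed (Search 4
    [(-622938, 428314, 47, 756027, 6184899)]))) Mirror)) (Node (Node (Leaf (Search 1 [(748720,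
    250198, 232, 789650, 1582469)])) (Leaf (Multiple 41367636138254273008513060)) (Leaf (Search
    1 [(-640530, 0, 84, 640614, 4341689)]))) (Node (Leaf (Multiple 36589)) (Leaf (Multiple
    8305714182829)) Mirror) (Node (Leaf (Search 1 [(397036, 596811, 115, 716929, 2793953)]))
    (Leaf (Search 4 [(264703, 707055, 53, 755033, 3771094)])) Mirror)))) (Node (Node (Node (Node
    (Leaf (Nonpos 1 1)) (Leaf (Nonpos 1 1)) (Leaf (Multiple 4431544399657563))) (Node (Leaf
    (Nonpos 1 1)) (Leaf (Multiple
    250815509418348139961992338763747739227807012144614828905718319324)) (Leaf (Multiple
    56086985853353360452416496741586747570652617586885631520082052514281935614344))) (Node (Leaf
    (Search 3 [(172584, 833299, 62, 851046, 6418382), (879676, 176107, 256, 897387, 1694115)]))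
    (Leaf (Multiple 1376203327527987911)) Mirror)) (Node (Node (Leaf (Nonpos 1 1)) (Leaf (Search
    3 [(-812893, 0, 31, 812924, 8283080), (890521, 171859, 203, 907156, 1732735)])) (Leaf
    (Search 1 [(-594542, 0, 40, 594582, 3795152)]))) (Node (Leaf (Search 1 [(840791, 137913,
    302, 852329, 1334133)])) (Leaf (Multiple
    36072191897026880513634614598968687207503547057618368306599071848560941283019)) (Leaf
    (Multiple 2111451791))) (Node (Leaf (Search 8 [(257149, 755845, 53, 798444, 4587945),
    (869576, 315486, 99, 925137, 3082113)])) (Leaf (Multiple
    408219764612330534959968588769716001018515392922057667508188549775)) Mirror)) (Node (Node
    (Leaf (Search 1 [(802564, 56555, 966, 805521, 1093185)])) (Leaf (Reversed (Search 4
    [(-685341, 0, 40, 685381, 5006087), (-391616, 774827, 28, 868199, 9507106)]))) (Leaf (Search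
    1 [(-542513, 0, 42, 542555, 3297140)]))) (Node (Leaf (Reversed (Search 6 [(-750045, 0, 57,
    750102, 6318978), (-317279, 798681, 24, 859418, 8771046)]))) (Leaf (Reversed (Search 9
    [(-715473, 0, 35, 715508, 5553750), (-357349, 823576, 19, 897781, 11330324)]))) Mirror)
    (Node (Leaf (Search 2 [(311075, 675620, 69, 743864, 3442078)])) (Leaf (Search 6 [(152529,
    745088, 47, 760588, 4243283)])) Mirror))) (Node (Node (Node (Leaf (Nonpos 1 1)) (Leaf
    (Search 1 [(867915, 142331, 248, 879757, 1430080)])) (Leaf (Multiple
    101143586917511547517636695322733463809917620475821899083))) (Node (Leaf (Search 1 [(818378,
    80733, 494, 822845, 1135478)])) (Leaf (Multiple 2409184075702499415844910154654023399))
    (Leaf (Multiple 38760902715562646073812551))) (Node (Leaf (Reversed (Search 5 [(-689959,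
    294785, 42, 750337, 6199895)]))) (Leaf (Reversed (Search 8 [(-713446, 308544, 34, 777340,
    6915610)]))) Mirror)) (Node (Node (Leaf (Nonpos 2 3)) (Leaf (Multiple
    29343913398802259473095219263492035391554829029487240952740382477185115382300)) (Leaf
    (Search 1 [(-642168, 0, 42, 642210, 4362860)]))) (Node (Leaf (Search 5 [(790090, 258795,
    105, 831500, 1767358)])) (Leaf (Multiple 11060873670192442069)) (Leaf (Multiple 359279191)))
    (Node (Leaf (Reversed (Search 16 [(-737307, 273781, 37, 786535, 7229977)]))) (Leaf (Multiple
    30514355100796799240190390286746456136525199680080066835173349338050852296735)) Mirror))
    (Node (Node (Leaf (Search 1 [(747834, 210467, 189, 777076, 1418422)])) (Leaf (Search 17
    [(-780874, 0, 32, 780906, 7166851), (828434, 382123, 75, 912392, 3396141)])) (Leaf (Search 1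
    [(-567886, 0, 39, 567925, 3526518)]))) (Node (Leaf (Search 17 [(751843, 386703, 97, 845560,
    2518082), (486856, 794520, 38, 931860, 8742057)])) (Leaf (Multiple
    2640029493043782840676368738186724429)) Mirror) (Node (Leaf (Search 5 [(384521, 661429, 76,
    765155, 3467876)])) (Leaf (Multiple
    112967096002515728818950349939704751164964146728438844356159488821726347493613)) Mirror)))
    (Node (Node (Node (Leaf (Nonpos 2 3)) (Leaf (Search 8 [(825919, 247683, 130, 862389,
    1876424)])) (Leaf (Multiple 4437516163054067))) (Node (Leaf (Search 1 [(769013, 217212, 186,
    799287, 1489923)])) (Leaf (Reversed (Search 13 [(-682651, 366264, 35, 774737, 6776030)])))
    (Leaf (Search 7 [(-581382, 501170, 46, 767625, 6364633)]))) (Node (Leaf (Reversed (Search 2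
    [(-641716, 326966, 45, 720258, 5498640)]))) (Leaf (Reversed (Search 3 [(-651870, 343509, 42,
    736882, 5836202)]))) Mirror)) (Node (Node (Leaf (Search 1 [(734909, 160555, 239, 752482,
    1248718)])) (Leaf (Multiple
    362037525333995344961037358033568520661399241764387866157312648917)) (Leaf (Multiple
    21916766020845814269855719206088117590))) (Node (Leaf (Search 3 [(726076, 333602, 106,
    799154, 1951116)])) (Leaf (Multiple
    34465466243737948764869441317632877470666004239479862557516759683934850688491)) (Leaf
    (Multiple 1391088762))) (Node (Leaf (Reversed (Search 6 [(-683972, 323763, 40, 756770,
    6333655)]))) (Leaf (Multiple
    380399573217623454617032807705178436902087325595561668399322401055)) Mirror)) (Node (Node
    (Leaf (Search 1 [(685687, 277230, 159, 739770, 1551191)])) (Leaf (Multiple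
    2209122498650209066)) (Leaf (Search 1 [(-604946, 0, 54, 605000, 3908914)]))) (Node (Leaf
    (Search 3 [(650814, 438808, 126, 785054, 2357138)])) (Leaf (Multiple
    408818674862628355899229196845728120896231126214985445656851231890)) Mirror) (Node (Leaf
    (Search 2 [(453350, 594249, 114, 747549, 2930177)])) (Leaf (Multiple 2242895993490199629))
    Mirror)))) (Node (Node (Node (Node (Leaf (Nonpos 1 1)) (Leaf (Search 1 [(855972, 110148,
    437, 863467, 1259323)])) (Leaf (Search 1 [(-643232, 0, 56, 643288, 4377253)]))) (Node (Leaf
    (Nonpos 3 4)) (Leaf (Reversed (Search 17 [(-704252, 0, 49, 704301, 5338828), (164728,
    905837, 26, 920720, 10379636)]))) (Leaf (Reversed (Search 6 [(-679860, 0, 54, 679914,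
    4916301), (142576, 860504, 31, 872267, 7431558)])))) (Node (Leaf (Search 10 [(822438,
    257540, 164, 861983, 1926935)])) (Leaf (Search 5 [(-175859, 745430, 55, 765949, 5318621)]))
    Mirror)) (Node (Node (Leaf (Nonpos 2 3)) (Leaf (Reversed (Search 1 [(-637132, 0, 37, 637169,
    4296553)]))) (Leaf (Search 1 [(-576339, 0, 44, 576383, 3608468)]))) (Node (Leaf (Search 1
    [(782557, 223855, 188, 814134, 1555864)])) (Leaf (Multiple 2575554660734150)) (Leaf
    (Reversed (Search 1 [(-643726, 0, 37, 643763, 4383620)])))) (Node (Leaf (Search 19 [(244093,
    831051, 70, 866227, 6651578), (802039, 369593, 107, 883207, 2817744)])) (Leaf (Multiple
    24268181579520687995077110662037275941)) Mirror)) (Node (Node (Leaf (Search 1 [(746466,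
    173365, 296, 766630, 1296522)])) (Leaf (Reversed (Search 1 [(-614224, 0, 39, 614263,
    4014647)]))) (Leaf (Search 1 [(-532142, 0, 46, 532188, 3209895)]))) (Node (Leaf (Reversed
    (Search 1 [(-636480, 0, 47, 636527, 4288225)]))) (Leaf (Reversed (Search 1 [(-627096, 0, 33,
    627129, 4169218)]))) (Leaf (Search 1 [(-619174, 0, 41, 619215, 4073043)]))) (Node (Leaf
    (Reversed (Search 7 [(-656576, 0, 65, 656641, 4562108), (-203079, 869593, 39, 893031,
    10274576)]))) (Leaf (Reversed (Search 1 [(-643443, 0, 47, 643490, 4379959)]))) Mirror)))
    (Node (Node (Node (Leaf (Nonpos 2 3)) (Leaf (Search 5 [(817194, 220490, 163, 846581,
    1659997)])) (Leaf (Reversed (Search 6 [(-726529, 0, 63, 726592, 5781029), (244093, 831051,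
    33, 866190, 6650016)])))) (Node (Leaf (Search 1 [(765055, 183157, 210, 786884, 1353318)]))
    (Leaf (Search 17 [(-380861, 768155, 30, 857420, 8901732), (829617, 339126, 82, 896336,
    2780904)])) (Leaf (Multiple 284718632291959))) (Node (Leaf (Reversed (Search 6 [(-724268,
    207389, 51, 753427, 6341514)]))) (Leaf (Search 8 [(-252831, 738651, 43, 780767, 5859223)]))
    Mirror)) (Node (Node (Leaf (Search 1 [(734892, 121019, 326, 745116, 1162899)])) (Leaf
    (Multiple 3895529)) (Leaf (Search 1 [(-611399, 0, 42, 611441, 3981960)]))) (Node (Leaf
    (Search 1 [(728376, 296618, 107, 786564, 1747208)])) (Leaf (Multiple
    22084172513655367001074489)) (Leaf (Multiple 67929059405940402167917363))) (Node (Leaf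
    (Reversed (Search 20 [(-767577, 158016, 50, 783724, 7217697)]))) (Leaf (Multiple 3694922))
    Mirror)) (Node (Node (Leaf (Search 1 [(693351, 245667, 174, 735761, 1448338)])) (Leaf
    (Search 3 [(-727558, 0, 31, 727589, 5802242), (759320, 407459, 81, 861818, 2806037)])) (Leaf
    (Search 1 [(-553517, 0, 43, 553560, 3393752)]))) (Node (Leaf (Search 3 [(674507, 392524,
    107, 780514, 2121417)])) (Leaf (Multiple
    103023483420735897236401662020339718297288091362992525815764872517272487420339)) (Leaf
    (Multiple 20447260))) (Node (Leaf (Search 74 [(461834, 719657, 110, 855211, 5035824),
    (694534, 589593, 146, 911188, 5249986)])) (Leaf (Multiple 1235509767605885946208)) Mirror)))
    (Node (Node (Node (Leaf (Search 1 [(726023, 40745, 1174, 728340, 1068401)])) (Leaf (Search 5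
    [(773645, 287435, 122, 825438, 1869696)])) (Leaf (Multiple
    12086105978984017316224465225646251415903394179489950590236296980971998643338))) (Node (Leaf
    (Search 1 [(715830, 255215, 159, 760125, 1524999)])) (Leaf (Search 9 [(-430903, 705107, 40,
    826390, 7734809), (780898, 396396, 74, 875821, 2903667)])) (Leaf (Search 47 [(-546711,
    564614, 47, 785975, 6757431), (849614, 476100, 48, 973966, 7252603)]))) (Node (Leaf
    (Reversed (Search 3 [(-682601, 258193, 58, 729858, 5758726)]))) (Leaf (Reversed (Search 5
    [(-704223, 265660, 49, 752715, 6283304)]))) Mirror)) (Node (Node (Leaf (Search 1 [(687971,
    202870, 196, 717455, 1310874)])) (Leaf (Search 6 [(739390, 369048, 93, 826468, 2273366)]))
    (Leaf (Multiple 8176423048155))) (Node (Leaf (Search 1 [(667908, 340633, 117, 749872,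
    1793610)])) (Leaf (Multiple 4171693517494058)) (Leaf (Multiple
    57450480821815943574845930064452222680340444025567257015184799321363020058168))) (Node (Leaf
    (Reversed (Search 7 [(-723847, 235450, 52, 761230, 6524892)]))) (Leaf (Multiple
    25276436282633229894448259650258768202)) Mirror)) (Node (Node (Leaf (Search 1 [(640353,
    284291, 151, 700775, 1500238)])) (Leaf (Search 4 [(-805719, 0, 41, 805760, 8007760),
    (691658, 446315, 98, 823256, 2659956)])) (Leaf (Search 1 [(-582330, 0, 54, 582384,
    3668415)]))) (Node (Leaf (Search 1 [(599681, 406730, 115, 724716, 1961645)])) (Leaf
    (Multiple 5289286440565)) (Leaf (Multiple 57347))) (Node (Leaf (Search 2 [(505549, 539783,
    142, 739700, 2599774)])) (Leaf (Multiple 75997644152663902767682965)) Mirror)))))"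
  by code_simp

lemma check_degree_8_pn: "check_tree 5 [1, - 1]
   (Node (Node (Node (Node (Node (Leaf (Nonpos 1 1)) Mirror Mirror) (Node (Leaf (Nonpos 1 1))
    Mirror Mirror) (Node (Leaf (Nonpos 1 1)) Mirror Mirror)) (Node (Node (Leaf (Nonpos 1 1))
    Mirror Mirror) (Node (Leaf (Nonpos 1 1)) Mirror Mirror) (Node Mirror Mirror Mirror)) (Node
    (Node (Leaf (Nonpos 1 1)) Mirror Mirror) (Node (Leaf (Nonpos 1 1)) Mirror Mirror) (Node
    Mirror Mirror Mirror))) (Node (Node (Node (Leaf (Nonpos 1 1)) Mirror Mirror) (Node (Leaf
    (Nonpos 1 1)) Mirror Mirror) (Node (Leaf (Nonpos 1 1)) Mirror Mirror)) (Node (Node (Leaf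
    (Nonpos 1 1)) Mirror Mirror) (Node (Leaf (Nonpos 1 1)) Mirror Mirror) (Node Mirror Mirror
    Mirror)) (Node (Node (Leaf (Nonpos 1 1)) Mirror Mirror) (Node (Leaf (Multiple
    219341426810049529960740186674340235523179257111287084888343935014)) Mirror Mirror) (Node
    Mirror Mirror Mirror))) (Node (Node (Node (Leaf (Nonpos 1 1)) Mirror Mirror) (Node (Leaf
    (Nonpos 1 1)) Mirror Mirror) (Node (Leaf (Multiple 853)) Mirror Mirror)) (Node (Node (Leaf
    (Nonpos 1 1)) Mirror Mirror) (Node (Leaf (Multiple 2442874637087459)) Mirror Mirror) (Node
    Mirror Mirror Mirror)) (Node (Node (Leaf (Multiple 857)) Mirror Mirror) (Node (Leaf
    (Reversed (Search 35 [(-182920, 821243, 32, 841400, 7491923), (744855, 524296, 166, 911043,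
    4620868)]))) Mirror Mirror) (Node Mirror Mirror Mirror)))) (Node (Node (Node (Node (Leaf
    (Nonpos 1 1)) Mirror Mirror) (Node (Leaf (Nonpos 1 1)) Mirror Mirror) (Node (Leaf (Nonpos 1
    1)) Mirror Mirror)) (Node (Node (Leaf (Nonpos 1 1)) Mirror Mirror) (Node (Leaf (Nonpos 1 1))
    Mirror Mirror) (Node (Leaf (Multiple 213344)) Mirror Mirror)) (Node (Node (Leaf (Nonpos 1
    1)) Mirror Mirror) (Node (Leaf (Multiple 5997928680649)) Mirror Mirror) (Node Mirror Mirror
    Mirror))) (Node (Node (Node (Leaf (Nonpos 1 1)) Mirror Mirror) (Node (Leaf (Nonpos 1 1))
    Mirror Mirror) (Node (Leaf (Multiple
    94300116706777337230359409446571397870119853716389957347606396562464604038565)) Mirror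
    Mirror)) (Node (Node (Leaf (Nonpos 1 1)) Mirror Mirror) (Node (Leaf (Multiple
    98894819296159308334711857806676712094883544651526530645372562963952107143244)) Mirror
    Mirror) (Node (Leaf (Multiple 4096)) Mirror Mirror)) (Node (Node (Leaf (Search 1 [(794711,
    226263, 313, 826607, 1607925)])) Mirror Mirror) (Node (Leaf (Multiple
    33643273140951136777617420225693565650127272486545310524733746616115572644620)) Mirror
    Mirror) (Node Mirror Mirror Mirror))) (Node (Node (Node (Leaf (Nonpos 1 1)) Mirror Mirror)
    (Node (Leaf (Search 6 [(821382, 229819, 301, 853229, 1736274)])) Mirror Mirror) (Node (Leaf
    (Multiple 2847507571285090030857001320830214347851130248197034003846567605)) Mirror Mirror))
    (Node (Node (Leaf (Search 1 [(775381, 158405, 425, 791822, 1291442)])) Mirror Mirror) (Node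
    (Leaf (Search 10 [(733176, 384896, 152, 828218, 2368637)])) Mirror Mirror) (Node (Leaf
    (Multiple 209373)) Mirror Mirror)) (Node (Node (Leaf (Search 1 [(692370, 304614, 216,
    756633, 1684185)])) Mirror Mirror) (Node (Leaf (Search 2 [(605430, 456940, 135, 758647,
    2302610)])) Mirror Mirror) (Node Mirror Mirror Mirror)))) (Node (Node (Node (Node (Leaf
    (Nonpos 1 1)) Mirror Mirror) (Node (Leaf (Nonpos 1 1)) Mirror Mirror) (Node (Leaf (Reversed
    (Search 2 [(315157, 670440, 118, 740938, 3387323)]))) Mirror Mirror)) (Node (Node (Leaf
    (Nonpos 1 1)) Mirror Mirror) (Node (Leaf (Reversed (Search 5 [(368198, 671866, 84, 766227,
    3551408)]))) Mirror Mirror) (Node (Leaf (Multiple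
    2127400158609606575315515014497405614474907845666390600933949274)) Mirror Mirror)) (Node
    (Node (Leaf (Search 1 [(790530, 172608, 487, 809642, 1364580)])) Mirror Mirror) (Node (Leaf
    (Multiple 9701173001694506681636838340191113862777520422069698141696497469903542562921))
    Mirror Mirror) (Node (Leaf (Multiple 658)) Mirror Mirror))) (Node (Node (Node (Leaf (Nonpos
    1 1)) Mirror Mirror) (Node (Leaf (Search 1 [(812338, 181390, 380, 832724, 1448724)])) Mirror
    Mirror) (Node (Leaf (Reversed (Search 2 [(386062, 641882, 126, 749163, 3231003)]))) Mirror
    Mirror)) (Node (Node (Leaf (Search 1 [(773605, 100719, 640, 780774, 1149106)])) Mirror
    Mirror) (Node (Leaf (Reversed (Search 2 [(424353, 611593, 70, 744464, 3013441)]))) Mirror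
    Mirror) (Node (Leaf (Reversed (Search 9 [(462411, 649707, 126, 797587, 3656281)]))) Mirror
    Mirror)) (Node (Node (Leaf (Search 1 [(707570, 266528, 218, 756322, 1553649)])) Mirror
    Mirror) (Node (Leaf (Reversed (Search 2 [(479044, 586489, 95, 757362, 2943985)]))) Mirror
    Mirror) (Node (Leaf (Search 7 [(535685, 577844, 138, 788087, 3110721)])) Mirror Mirror)))
    (Node (Node (Node (Leaf (Nonpos 2 3)) Mirror Mirror) (Node (Leaf (Search 1 [(734716, 277652,
    216, 785645, 1672025)])) Mirror Mirror) (Node (Leaf (Reversed (Search 1 [(429279, 578874,
    128, 720806, 2712359)]))) Mirror Mirror)) (Node (Node (Leaf (Search 1 [(704281, 214818, 256,
    736571, 1364710)])) Mirror Mirror) (Node (Leaf (Search 1 [(660809, 366812, 141, 755932,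
    1913076)])) Mirror Mirror) (Node (Leaf (Reversed (Search 1 [(470270, 549909, 110, 723681,
    2575913)]))) Mirror Mirror)) (Node (Node (Leaf (Search 1 [(639051, 300329, 192, 706297,
    1556383)])) Mirror Mirror) (Node (Leaf (Search 1 [(577872, 414650, 135, 711381, 1951116)]))
    Mirror Mirror) (Node (Leaf (Search 1 [(489008, 508189, 127, 705383, 2309905)])) Mirror
    Mirror)))))"
  by code_simp

text \<open>The numerals of 78 decimal digits in this tree lie between 2^255 and 2^256, so they
  encode 255 coefficients: Littlewood multiples of degree 254.\<close>

lemma check_degree_8_pz: "check_tree 5 [1, 0]
   (Node (Node (Node (Node (Node (Leaf (Nonpos 1 1)) (Leaf (Nonpos 1 1)) Mirror) (Node (Leaf
    (Nonpos 1 1)) (Leaf (Nonpos 1 1)) Mirror) (Node (Leaf (Nonpos 1 1)) (Leaf (Multiple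
    4087631)) Mirror)) (Node (Node (Leaf (Nonpos 1 1)) (Leaf (Nonpos 1 1)) Mirror) (Node (Leaf
    (Nonpos 1 1)) (Leaf (Reversed (Search 9 [(-159053, 775937, 37, 792108, 5868925)]))) Mirror)
    (Node (Leaf (Reversed (Search 1 [(-120235, 738379, 60, 748165, 4825807)]))) Mirror Mirror))
    (Node (Node (Leaf (Nonpos 1 1)) (Leaf (Reversed (Search 1 [(-192476, 713316, 46, 738874,
    4846677)]))) Mirror) (Node (Leaf (Reversed (Search 1 [(-159042, 705642, 53, 723396,
    4510318)]))) (Leaf (Reversed (Search 1 [(-165355, 722727, 44, 741446, 4823558)]))) Mirror)
    (Node (Leaf (Reversed (Search 1 [(-136434, 704949, 70, 718101, 4375196)]))) Mirror Mirror)))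
    (Node (Node (Node (Leaf (Nonpos 1 1)) (Leaf (Nonpos 1 1)) Mirror) (Node (Leaf (Nonpos 1 1))
    (Leaf (Multiple
    57924643191734885705051888252372474707828074933034826838952774247549409497548)) Mirror)
    (Node (Leaf (Multiple 1080554443)) (Leaf (Multiple 98502733981)) Mirror)) (Node (Node (Leaf
    (Nonpos 1 1)) (Leaf (Reversed (Search 11 [(-278633, 737490, 31, 788402, 6119497)]))) Mirror)
    (Node (Leaf (Reversed (Search 8 [(-221949, 759811, 37, 791602, 6040835)]))) (Leaf (Multiple
    102475168138588028708491943646237382070352491474696901011)) Mirror) (Node (Leaf (Reversed
    (Search 10 [(-179777, 774141, 52, 794794, 5999361)]))) Mirror Mirror)) (Node (Node (Leaf
    (Search 1 [(808274, 153201, 401, 823066, 1326981)])) (Leaf (Reversed (Search 3 [(-246873,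
    704553, 39, 746592, 5120537)]))) Mirror) (Node (Leaf (Reversed (Search 1 [(-209615, 714811,
    48, 744960, 4997790)]))) (Leaf (Reversed (Search 4 [(-227094, 728014, 31, 762643,
    5386467)]))) Mirror) (Node (Leaf (Reversed (Search 1 [(-183604, 725431, 57, 748363,
    4994399)]))) Mirror Mirror))) (Node (Node (Node (Leaf (Nonpos 1 1)) (Leaf (Search 5
    [(-667936, 445775, 32, 803060, 7574382), (884818, 196311, 258, 906592, 1889892)])) Mirror)
    (Node (Leaf (Search 1 [(827412, 160354, 352, 843160, 1396281)])) (Leaf (Multiple
    28484844450783705597341153954190491551)) Mirror) (Node (Leaf (Multiple
    30930600875013790729749205158178654654821348447605797202188399482156646736073)) (Leaf
    (Multiple 3711758)) Mirror)) (Node (Node (Leaf (Search 1 [(787261, 79595, 737, 792012,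
    1119450)])) (Leaf (Reversed (Search 7 [(-330341, 695385, 33, 769894, 5810881)]))) Mirror)
    (Node (Leaf (Search 15 [(785089, 324634, 142, 849702, 2205240)])) (Leaf (Multiple
    108626656380872273543398946731825189346469309014606688270728344509102031241779)) Mirror)
    (Node (Leaf (Multiple 43200215570099182644642453)) Mirror Mirror)) (Node (Node (Leaf (Search
    1 [(732791, 268088, 219, 780510, 1621196)])) (Leaf (Reversed (Search 3 [(-293129, 679791,
    39, 740337, 5116790)]))) Mirror) (Node (Leaf (Reversed (Search 3 [(-264703, 707055, 47,
    755027, 5327970)]))) (Leaf (Reversed (Search 5 [(-287529, 708195, 38, 764377, 5579490)])))
    Mirror) (Node (Leaf (Search 2 [(426211, 605161, 130, 740317, 2953300)])) Mirror Mirror))))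
    (Node (Node (Node (Node (Leaf (Nonpos 1 1)) (Leaf (Nonpos 1 1)) Mirror) (Node (Leaf (Nonpos
    1 1)) (Leaf (Multiple 9732300233196837148)) Mirror) (Node (Leaf (Reversed (Search 14
    [(31204, 797312, 77, 798000, 5409316)]))) (Leaf (Search 6 [(-112363, 763343, 53, 771622,
    5260665)])) Mirror)) (Node (Node (Leaf (Nonpos 1 1)) (Leaf (Multiple 1987)) Mirror) (Node
    (Leaf (Search 1 [(840207, 166078, 233, 856697, 1457404)])) (Leaf (Multiple 520342771))
    Mirror) (Node (Leaf (Reversed (Search 9 [(-37849, 787555, 64, 788528, 5410921)]))) (Leaf
    (Multiple 1999)) Mirror)) (Node (Node (Leaf (Search 1 [(799279, 99088, 530, 805928,
    1161578)])) (Leaf (Reversed (Search 30 [(-165145, 804571, 40, 821385, 6721019)]))) Mirror)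
    (Node (Leaf (Reversed (Search 8 [(-111381, 770684, 44, 778735, 5411847)]))) (Leaf (Multiple
    18123714017527874740)) Mirror) (Node (Leaf (Reversed (Search 3 [(-79527, 755199, 62, 759437,
    4923443)]))) Mirror Mirror))) (Node (Node (Node (Leaf (Nonpos 1 1)) (Leaf (Search 9
    [(869429, 165826, 207, 885309, 1569146)])) Mirror) (Node (Leaf (Search 1 [(816487, 114426,
    344, 824811, 1214194)])) (Leaf (Multiple
    2824307712455649505566047065538233127521582786919431515190887622)) Mirror) (Node (Leaf
    (Multiple 9004211559933797220383248991060820903847168282327060587307710358439343439246))
    (Leaf (Multiple
    94102005060552906415082262266820585833120793647930873771091261017325594807367)) Mirror))
    (Node (Node (Leaf (Nonpos 3 4)) (Leaf (Search 34 [(-843705, 298967, 21, 895130, 13091475),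
    (843705, 298967, 77, 895186, 2478083)])) Mirror) (Node (Leaf (Search 5 [(778866, 280523,
    102, 827946, 1849970)])) (Leaf (Multiple 1426068070)) Mirror) (Node (Leaf (Multiple
    408355408172612341194495101599067741598708359099984239361128475946)) (Leaf (Multiple
    20712511)) Mirror)) (Node (Node (Leaf (Search 1 [(736352, 227782, 164, 770943, 1460302)]))
    (Leaf (Reversed (Search 65 [(-247508, 791923, 30, 829731, 7277688), (387501, 888657, 28,
    969497, 14686709)]))) Mirror) (Node (Leaf (Multiple 4100077)) (Leaf (Multiple
    1836732541235401532027513298848572616188873980730953095950375204)) Mirror) (Node (Leaf
    (Reversed (Search 20 [(-133829, 798225, 48, 809415, 6255075)]))) Mirror Mirror))) (Node
    (Node (Node (Leaf (Nonpos 2 3)) (Leaf (Search 11 [(819666, 267469, 118, 862320, 1982623)]))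
    Mirror) (Node (Leaf (Search 1 [(759310, 235364, 167, 795119, 1543507)])) (Leaf (Multiple
    15801857868782734386)) Mirror) (Node (Leaf (Multiple
    59701818894183334081419742538291139625072008639550149272420738233118643980486)) (Leaf
    (Multiple 29850103313578446806829404177545535845749630369950694541581706212092575855744))
    Mirror)) (Node (Node (Leaf (Search 1 [(725869, 177421, 214, 747452, 1283115)])) (Leaf
    (Multiple 2035)) Mirror) (Node (Leaf (Search 3 [(705803, 345129, 104, 785771, 1941214)]))
    (Leaf (Multiple 532677388)) Mirror) (Node (Leaf (Multiple
    119810233473354497525352723028921815317648350077060727321)) (Leaf (Multiple 1024)) Mirror))
    (Node (Node (Leaf (Search 1 [(670850, 284300, 152, 728758, 1550525)])) (Leaf (Reversed
    (Search 15 [(-312047, 757902, 31, 819659, 7134278), (452621, 789365, 51, 909976,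
    7483179)]))) Mirror) (Node (Leaf (Search 2 [(622938, 428314, 101, 756081, 2165084)])) (Leaf
    (Multiple 17429441543343215104)) Mirror) (Node (Leaf (Search 2 [(492026, 572681, 119,
    755138, 2854043)])) Mirror Mirror)))) (Node (Node (Node (Node (Leaf (Nonpos 1 1)) (Leaf
    (Search 1 [(856898, 134221, 354, 867701, 1358604)])) Mirror) (Node (Leaf (Search 1 [(807684,
    52739, 977, 810382, 1089872)])) (Leaf (Reversed (Search 3 [(165355, 722727, 47, 741449,
    3896497)]))) Mirror) (Node (Leaf (Reversed (Search 5 [(135315, 745138, 75, 757400,
    4244889)]))) (Leaf (Search 1 [(-136516, 722020, 57, 734870, 4638693)])) Mirror)) (Node (Node
    (Leaf (Nonpos 2 3)) (Leaf (Reversed (Search 16 [(206074, 759874, 49, 787371, 4554737)])))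
    Mirror) (Node (Leaf (Search 1 [(773982, 242998, 160, 811392, 1621752)])) (Leaf (Multiple
    79335051592565045128253661227153801691467092609959147933005056211790912520289)) Mirror)
    (Node (Leaf (Reversed (Search 20 [(90518, 796440, 90, 801658, 5291165)]))) (Leaf (Reversed
    (Search 5 [(112363, 763343, 56, 771625, 4573753)]))) Mirror)) (Node (Node (Leaf (Search 1
    [(737700, 190683, 265, 762211, 1336373)])) (Leaf (Search 3 [(-715473, 0, 41, 715514,
    5553869), (802039, 369593, 103, 883203, 2817650)])) Mirror) (Node (Leaf (Search 4 [(728275,
    356760, 133, 811097, 2117565)])) (Leaf (Multiple 22514605461349724454058150232767489321))
    Mirror) (Node (Leaf (Reversed (Search 15 [(9258, 802594, 74, 802722, 5600908)]))) (Leaf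
    (Multiple 4071450)) Mirror))) (Node (Node (Node (Leaf (Nonpos 2 3)) (Leaf (Reversed (Search
    4 [(246873, 704553, 45, 746598, 3706195)]))) Mirror) (Node (Leaf (Search 1 [(757508, 200564,
    184, 783794, 1400553)])) (Leaf (Reversed (Search 6 [(227094, 728014, 41, 762653,
    4025606)]))) Mirror) (Node (Leaf (Search 8 [(757086, 352026, 100, 835027, 2244683)])) (Leaf
    (Search 6 [(-195534, 746254, 48, 771494, 5490370)])) Mirror)) (Node (Node (Leaf (Search 1
    [(727689, 139917, 274, 741293, 1195500)])) (Leaf (Reversed (Search 12 [(278633, 737490, 39,
    788410, 4297233)]))) Mirror) (Node (Leaf (Search 1 [(713446, 308544, 104, 777410,
    1761915)])) (Leaf (Multiple 160079402193853435966342485236560023887272347127068700721))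
    Mirror) (Node (Leaf (Multiple 142410224306278246)) (Leaf (Multiple
    74315544628622598033071361964029577909069172825867752125663695934461191829962)) Mirror))
    (Node (Node (Leaf (Search 1 [(681280, 254529, 150, 727424, 1459536)])) (Leaf (Search 6
    [(-813200, 0, 53, 813253, 8296126), (736943, 420571, 73, 848581, 2744813)])) Mirror) (Node
    (Leaf (Search 1 [(651383, 393501, 102, 761117, 2039865)])) (Leaf (Multiple
    115173701837785202741431819308129841373431108193251628543580912350623936911475)) Mirror)
    (Node (Leaf (Multiple 1124894233)) (Leaf (Multiple 124011937911)) Mirror))) (Node (Node
    (Node (Leaf (Search 1 [(720018, 75438, 618, 724578, 1093003)])) (Leaf (Reversed (Search 2
    [(293129, 679791, 52, 740350, 3457518)]))) Mirror) (Node (Leaf (Search 1 [(704223, 265660,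
    148, 752814, 1542458)])) (Leaf (Reversed (Search 6 [(287529, 708195, 45, 764384,
    3835889)]))) Mirror) (Node (Leaf (Search 4 [(689301, 398012, 117, 796076, 2227134)])) (Leaf
    (Search 11 [(-271065, 743478, 54, 791405, 6176041)])) Mirror)) (Node (Node (Leaf (Search 1
    [(678434, 212128, 183, 711008, 1325760)])) (Leaf (Search 4 [(722234, 378428, 85, 815456,
    2248069)])) Mirror) (Node (Leaf (Search 1 [(651870, 343509, 113, 736953, 1766142)])) (Leaf
    (Multiple 98834176674926516298308606449374450102186573990378717989048826557985841490413))
    Mirror) (Node (Leaf (Search 3 [(615695, 474208, 106, 777251, 2481802)])) (Leaf (Multiple
    57101672919099041931232594134033969748158006464836394409999223416715670576821)) Mirror))
    (Node (Node (Leaf (Search 1 [(628969, 286711, 153, 691388, 1492360)])) (Leaf (Search 5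
    [(667936, 445775, 92, 803120, 2504508)])) Mirror) (Node (Leaf (Search 1 [(585471, 398509,
    114, 708342, 1883294)])) (Leaf (Multiple 28413181509231026465403449658748473709)) Mirror)
    (Node (Leaf (Search 1 [(509739, 510692, 113, 721667, 2381633)])) (Leaf (Multiple 3801619))
    Mirror)))))"
  by code_simp

text \<open>The point 5/7 belongs to 1 - X - X^2 - X^4 + X^5 + X^6 + X^7 + X^8, which is still
  positive at 2/3 and again at 3/4 but negative at 5/7.\<close>

lemma check_degree_8_pp: "check_tree 5 [1, 1]
   (Node (Node (Node (Node (Node (Leaf (Nonpos 1 1)) (Leaf (Nonpos 1 1)) (Leaf (Multiple 963)))
    (Node (Leaf (Nonpos 1 1)) (Leaf (Multiple 39180720714027719604906586)) (Leaf (Multiple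
    7307677951390074225721281616897019937711056457519537368430179142397936074976))) (Node (Leaf
    (Multiple 965)) (Leaf (Search 17 [(-9258, 802594, 67, 802715, 5663427)])) (Leaf (Multiple
    967)))) (Node (Node (Leaf (Nonpos 1 1)) (Leaf (Reversed (Search 2 [(-346915, 645224, 42,
    732616, 5102426)]))) (Leaf (Search 1 [(-641261, 0, 85, 641346, 4351378)]))) (Node (Leaf
    (Search 1 [(835356, 102478, 590, 842209, 1205030)])) (Leaf (Reversed (Search 4 [(-337125,
    679308, 35, 758397, 5576743)]))) (Leaf (Reversed (Search 5 [(-368198, 671866, 52, 766195,
    5822741)])))) (Node (Leaf (Reversed (Search 3 [(-284419, 696366, 44, 752254, 5322014)])))
    (Leaf (Search 3 [(79527, 755199, 57, 759432, 4455592)])) Mirror)) (Node (Node (Leaf (Nonpos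
    3 4)) (Leaf (Reversed (Search 1 [(-318279, 621945, 47, 698701, 4500744)]))) (Leaf (Search 1
    [(-562833, 0, 64, 562897, 3479154)]))) (Node (Leaf (Reversed (Search 1 [(-294281, 640888,
    43, 705266, 4544803)]))) (Leaf (Reversed (Search 1 [(-309883, 643152, 37, 713951,
    4709944)]))) (Leaf (Reversed (Search 1 [(-327859, 641718, 55, 720676, 4856677)])))) (Node
    (Leaf (Search 1 [(278077, 656532, 95, 713090, 3164210)])) (Leaf (Search 1 [(136434, 704949,
    64, 718095, 3657909)])) Mirror))) (Node (Node (Node (Leaf (Nonpos 1 1)) (Leaf (Search 1
    [(861629, 115031, 453, 869727, 1289580)])) (Leaf (Reversed (Search 2 [(-442822, 575624, 68,
    726315, 5201853)])))) (Node (Leaf (Nonpos 4 5)) (Leaf (Multiple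
    54426470798216466739374854168031944421171047437860258692340332205260655614805)) (Leaf
    (Reversed (Search 6 [(-479044, 586489, 60, 757327, 5891470)])))) (Node (Leaf (Search 3
    [(218035, 809881, 68, 838786, 5798500), (832494, 260568, 171, 872491, 2016810)])) (Leaf
    (Multiple 2118362989)) (Leaf (Multiple 1222246282951)))) (Node (Node (Leaf (Nonpos 2 3))
    (Leaf (Reversed (Search 2 [(-396133, 605927, 39, 723966, 5060757)]))) (Leaf (Reversed
    (Search 1 [(-403176, 588076, 52, 713063, 4895429)])))) (Node (Leaf (Search 1 [(791683,
    230543, 187, 824755, 1617971)])) (Leaf (Reversed (Search 6 [(-411691, 640016, 30, 761023,
    5814040)]))) (Leaf (Reversed (Search 4 [(-424353, 611593, 48, 744442, 5498820)])))) (Node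
    (Leaf (Search 5 [(286985, 739404, 60, 793205, 4358777), (818491, 371993, 102, 899161,
    3070329)])) (Leaf (Multiple
    8135058828506148074712448321330067140755516299721258645288155801690157061445)) Mirror))
    (Node (Node (Leaf (Search 1 [(753320, 183454, 292, 775629, 1336523)])) (Leaf (Reversed
    (Search 1 [(-359606, 597884, 47, 697745, 4572611)]))) (Leaf (Search 1 [(-600399, 0, 77,
    600476, 3858863)]))) (Node (Leaf (Reversed (Search 1 [(-345717, 630527, 46, 719132,
    4870677)]))) (Leaf (Reversed (Search 1 [(-363030, 622382, 32, 720553, 4931651)]))) (Leaf
    (Reversed (Search 1 [(-377314, 609383, 50, 716789, 4900810)])))) (Node (Leaf (Search 2
    [(335225, 658455, 99, 738976, 3288278)])) (Leaf (Search 4 [(183604, 725431, 54, 748360,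
    3943159)])) Mirror))) (Node (Node (Node (Leaf (Nonpos 2 3)) (Leaf (Reversed (Search 1
    [(-452395, 531781, 71, 698249, 4766450)]))) (Leaf (Reversed (Search 1 [(-443128, 520185, 75,
    683416, 4536699)])))) (Node (Leaf (Search 1 [(772187, 191312, 273, 795807, 1395568)])) (Leaf
    (Reversed (Search 2 [(-480847, 528251, 51, 714378, 5077032)]))) (Leaf (Reversed (Search 1
    [(-465147, 518071, 60, 696307, 4762566)])))) (Node (Leaf (Multiple 981)) (Leaf (Reversed
    (Search 2 [(-509739, 510692, 59, 721613, 5259260)]))) (Leaf (Search 2 [(-489008, 508189, 69,
    705325, 4947181)])))) (Node (Node (Leaf (Search 1 [(740064, 133111, 414, 752354, 1190861)]))
    (Leaf (Reversed (Search 1 [(-422007, 553260, 48, 695884, 4671461)]))) (Leaf (Reversed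
    (Search 1 [(-419138, 539339, 55, 683110, 4486565)])))) (Node (Leaf (Search 3 [(738374,
    307231, 160, 799902, 1841657)])) (Leaf (Reversed (Search 2 [(-447851, 565310, 41, 721253,
    5124584)]))) (Leaf (Reversed (Search 1 [(-440410, 546569, 60, 701985, 4798866)])))) (Node
    (Leaf (Search 14 [(368897, 755333, 72, 840675, 5125278), (762457, 450903, 125, 885933,
    3443689)])) (Leaf (Reversed (Search 5 [(-492026, 572681, 67, 755086, 5872462)]))) Mirror))
    (Node (Node (Leaf (Search 1 [(698925, 257602, 215, 745101, 1501342)])) (Leaf (Reversed
    (Search 1 [(-390061, 561314, 53, 683589, 4436688)]))) (Leaf (Reversed (Search 1 [(-392273,
    549499, 63, 675213, 4331037)])))) (Node (Leaf (Reversed (Search 1 [(-397036, 596811, 55,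
    716869, 4944095)]))) (Leaf (Reversed (Search 1 [(-404812, 578872, 47, 706422, 4794535)])))
    (Leaf (Reversed (Search 1 [(-407415, 562471, 55, 694577, 4623567)])))) (Node (Leaf (Search 2
    [(408611, 633296, 154, 753830, 3203574)])) (Leaf (Reversed (Search 4 [(-426211, 605161, 64,
    740251, 5421625)]))) Mirror)))) (Node (Node (Node (Node (Leaf (Nonpos 1 1)) (Leaf (Search 1
    [(850908, 78157, 634, 855124, 1155577)])) (Leaf (Search 14 [(-738222, 0, 103, 738325,
    6039309), (899649, 251132, 121, 934164, 2676990)]))) (Node (Leaf (Nonpos 3 4)) (Leaf
    (Multiple 7661086401704066389948695104996938325241366191423957651234049499713745674481))
    (Leaf (Multiple 5773036303203))) (Node (Leaf (Search 6 [(820174, 232191, 183, 852591,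
    1743565)])) (Leaf (Search 27 [(-90518, 796440, 74, 801642, 5902406), (886263, 344060, 81,
    950786, 4080059)])) (Leaf (Multiple
    3190356666062310291350665622816053630175546297435499789946513656)))) (Node (Node (Leaf
    (Nonpos 2 3)) (Leaf (Search 7 [(834373, 225810, 147, 864537, 1774176)])) (Leaf (Search 1
    [(-607868, 0, 57, 607925, 3941821)]))) (Node (Leaf (Search 1 [(784104, 198170, 195, 808954,
    1447019)])) (Leaf (Multiple 32914)) (Leaf (Multiple
    23921073260923116087090327715649454406))) (Node (Leaf (Reversed (Search 8 [(-214040, 757764,
    40, 787454, 5913417)]))) (Leaf (Search 8 [(37849, 787555, 56, 788520, 5166706)])) (Leaf
    (Multiple 254336)))) (Node (Node (Leaf (Search 1 [(750627, 146595, 336, 765144, 1229721)]))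
    (Leaf (Reversed (Search 4 [(-301622, 698508, 41, 760889, 5540979)]))) (Leaf (Search 1
    [(-548713, 0, 52, 548765, 3351134)]))) (Node (Leaf (Reversed (Search 3 [(-257006, 706516,
    38, 751848, 5246017)]))) (Leaf (Reversed (Search 7 [(-275183, 722856, 35, 773499,
    5749538)]))) (Leaf (Reversed (Search 21 [(-304697, 739297, 49, 799675, 6496577)])))) (Node
    (Leaf (Reversed (Search 3 [(-228864, 713898, 46, 749732, 5134858)]))) (Leaf (Search 3
    [(120235, 738379, 61, 748166, 4140551)])) Mirror))) (Node (Node (Node (Leaf (Nonpos 2 3))
    (Leaf (Search 1 [(816309, 198836, 166, 840343, 1540473)])) (Leaf (Search 31 [(-794711,
    226263, 68, 826362, 8763646), (867878, 316381, 82, 923830, 3063277)]))) (Node (Leaf (Search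
    1 [(767577, 158016, 243, 783917, 1278233)])) (Leaf (Multiple 13911548958255101875)) (Leaf
    (Multiple 43782031121442089706043145765479189385436625546621065511125055301679995282854)))
    (Node (Leaf (Search 5 [(777470, 307914, 121, 836346, 2027569)])) (Leaf (Multiple
    73216901619692981)) (Leaf (Multiple
    58049984055247483645609244481147464964090830845054724216989582246269082326919)))) (Node
    (Node (Leaf (Search 1 [(738891, 88848, 422, 744636, 1112953)])) (Leaf (Search 8 [(794946,
    295364, 94, 848139, 2037187)])) (Leaf (Multiple 8155))) (Node (Leaf (Search 1 [(737307,
    273781, 124, 786622, 1659864)])) (Leaf (Multiple
    32119910096629817621323486282010734202141924418957512767139867906638375854666)) (Leaf
    (Multiple 64238699015422162100173927505962614643880223163975113404785296103603337184883)))
    (Node (Leaf (Multiple 8173)) (Leaf (Multiple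
    212167636224126736799942986227351740736723785769353586644356376722)) (Leaf (Multiple
    4096)))) (Node (Node (Leaf (Search 1 [(703285, 226535, 185, 739055, 1399660)])) (Leaf
    (Reversed (Search 8 [(-364206, 680209, 34, 771611, 5936517)]))) (Leaf (Search 1 [(-577454,
    0, 52, 577506, 3619570)]))) (Node (Leaf (Search 3 [(696227, 369872, 109, 788486, 2059927)]))
    (Leaf (Multiple 10107430448725501677)) (Leaf (Multiple
    32467309373672631273922834164189891754480479926245909564860443160454013452591))) (Node (Leaf
    (Reversed (Search 12 [(-286985, 739404, 37, 793182, 6267854)]))) (Leaf (Multiple
    80298444818298746)) Mirror))) (Node (Node (Node (Leaf (Nonpos 2 3)) (Leaf (Search 4
    [(777806, 267192, 139, 822559, 1765484)])) (Leaf (Search 6 [(-692370, 304614, 68, 756485,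
    6345005)]))) (Node (Leaf (Search 1 [(723847, 235450, 182, 761360, 1465032)])) (Leaf (Search
    37 [(787458, 371207, 82, 870648, 2675123), (-576527, 702357, 48, 908723, 13274182)])) (Leaf
    (Search 3 [(-605430, 456940, 65, 758577, 6204801)]))) (Node (Leaf (Search 4 [(726217,
    365757, 128, 813252, 2172984)])) (Leaf (Reversed (Search 9 [(-615695, 474208, 37, 777182,
    6686265)]))) (Leaf (Search 2 [(-470270, 549909, 72, 723643, 5212990)])))) (Node (Node (Leaf
    (Search 1 [(696104, 184608, 228, 720396, 1272038)])) (Leaf (Search 5 [(749812, 347643, 90,
    826573, 2165487)])) (Leaf (Reversed (Search 9 [(-476554, 602926, 47, 768568, 6141593)]))))
    (Node (Leaf (Search 1 [(683972, 323763, 120, 756850, 1753072)])) (Leaf (Multiple 50314))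
    (Leaf (Multiple 42321688492460662565756075945683430796))) (Node (Leaf (Multiple 247277))
    (Leaf (Multiple 151243674248142277177926501718443133570400871157900331349)) (Leaf (Multiple
    131374)))) (Node (Node (Leaf (Search 1 [(653786, 271964, 160, 708257, 1477597)])) (Leaf
    (Reversed (Search 7 [(-418916, 639230, 41, 764310, 5904570)]))) (Leaf (Search 1 [(-623568,
    0, 78, 623646, 4126449)]))) (Node (Leaf (Search 1 [(626005, 400020, 129, 743028, 1997326)]))
    (Leaf (Multiple
    13620443624239084165261652785305975674252575965628591756286045617418223821243)) (Leaf
    (Multiple 4914907292943))) (Node (Leaf (Reversed (Search 43 [(-368897, 755333, 43, 840646,
    8099979), (-762457, 450903, 35, 885843, 12025933)]))) (Leaf (Multiple
    39272049810206697865470802)) Mirror)))) (Node (Node (Node (Node (Leaf (Nonpos 2 3)) (Leaf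
    (Search 1 [(809279, 173669, 235, 827939, 1406313)])) (Leaf (Multiple 995))) (Node (Leaf
    (Search 1 [(763604, 123112, 394, 773859, 1186387)])) (Leaf (Search 18 [(819564, 291435, 114,
    869953, 2176503), (-244111, 869576, 57, 903248, 11241377)])) (Leaf (Multiple
    11842073378140032204547402797046015831634483162042730265280334273406325520490))) (Node (Leaf
    (Multiple 997)) (Leaf (Search 3 [(-135315, 745138, 84, 757409, 5038024)])) (Leaf (Multiple
    999)))) (Node (Node (Leaf (Nonpos 5 7)) (Leaf (Search 5 [(788897, 270096, 129, 833982,
    1831439)])) (Leaf (Search 1 [(-585907, 0, 57, 585964, 3704918)]))) (Node (Leaf (Search 1
    [(736159, 243884, 182, 775688, 1523634)])) (Leaf (Multiple 34107325933711296961888966))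
    (Leaf (Multiple 4365997154410851))) (Node (Leaf (Search 3 [(176606, 809042, 67, 828161,
    5659045), (746102, 369235, 121, 832589, 2317838)])) (Leaf (Search 14 [(-31204, 797312, 80,
    798003, 5617260)])) (Leaf (Search 23 [(-254826, 767961, 56, 809192, 6626861)])))) (Node
    (Node (Leaf (Search 1 [(706030, 197080, 256, 733277, 1315131)])) (Leaf (Search 1 [(-698631,
    0, 45, 698676, 5236144), (765114, 350321, 105, 841607, 2283624)])) (Leaf (Search 1
    [(-537241, 0, 54, 537295, 3252432)]))) (Node (Leaf (Search 1 [(701195, 334523, 152, 777057,
    1863040)])) (Leaf (Reversed (Search 8 [(-766511, 0, 38, 766549, 6748633), (-208576, 809508,
    47, 835994, 7375597)]))) (Leaf (Search 1 [(-633055, 0, 53, 633108, 4244307)]))) (Node (Leaf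
    (Multiple 1005)) (Leaf (Search 7 [(86606, 776988, 77, 781877, 4862091)])) (Leaf (Multiple
    1007))))) (Node (Node (Node (Leaf (Nonpos 2 3)) (Leaf (Search 1 [(773982, 242998, 139,
    811371, 1621515)])) (Leaf (Multiple 1118594285299))) (Node (Leaf (Search 1 [(724268, 207389,
    205, 753581, 1369052)])) (Leaf (Search 23 [(781527, 344386, 88, 854130, 2350555)])) (Leaf
    (Multiple 342419704419067420437882483542796984820293135637231147014431593770))) (Node (Leaf
    (Search 3 [(726076, 333602, 126, 799174, 1951356)])) (Leaf (Search 16 [(-217810, 773918, 67,
    804051, 6364617)])) (Leaf (Search 4 [(-386062, 641882, 65, 749102, 5503320)])))) (Node (Node
    (Leaf (Search 1 [(698928, 155163, 267, 716212, 1207688)])) (Leaf (Search 4 [(748591, 320695,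
    96, 814488, 1967479)])) (Leaf (Search 1 [(-628174, 0, 64, 628238, 4182984)]))) (Node (Leaf
    (Search 1 [(689959, 294785, 131, 750426, 1633111)])) (Leaf (Multiple
    222965883261907770617038850739676721094054683771734114884658682278)) (Leaf (Multiple
    133759600339290302203326536138258616177295688422732473271))) (Node (Leaf (Search 4 [(689703,
    416732, 109, 805936, 2377138)])) (Leaf (Multiple
    8776466212766580738876061229740450584135796626467610234513120894717392035146)) (Leaf
    (Multiple 58098114261634535425554447991305709634664417065133896920329524975656959877525))))
    (Node (Node (Leaf (Search 1 [(662132, 247086, 188, 706921, 1408326)])) (Leaf (Search 5
    [(717215, 391919, 91, 817403, 2328350)])) (Leaf (Search 1 [(-560798, 0, 56, 560854,
    3460188)]))) (Node (Leaf (Search 1 [(644007, 369040, 128, 742379, 1875705)])) (Leaf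
    (Multiple 56154070486763407671213822096621789986629677749952073774370158574776117614805))
    (Leaf (Multiple 222160828145039233384424335878899809144265292376074499688420377179))) (Node
    (Leaf (Search 14 [(634278, 512497, 152, 815604, 2966807)])) (Leaf (Multiple 1081873440))
    (Leaf (Multiple 1466910124021))))) (Node (Node (Node (Leaf (Search 1 [(693425, 107451, 419,
    702120, 1124280)])) (Leaf (Search 1 [(735971, 291650, 127, 791780, 1746252)])) (Leaf
    (Multiple 1011))) (Node (Leaf (Search 1 [(682601, 258193, 170, 729970, 1474612)])) (Leaf
    (Search 12 [(738807, 386426, 94, 833858, 2419060)])) (Leaf (Search 25 [(-620369, 550565, 82,
    829528, 8413073), (799051, 463934, 66, 924035, 4435796)]))) (Node (Leaf (Search 2 [(675235,
    373075, 136, 771581, 1998508)])) (Leaf (Search 7 [(-308990, 744049, 61, 805719, 6684420),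
    (752106, 476045, 81, 890184, 3713205)])) (Leaf (Search 2 [(-429279, 578874, 75, 720753,
    5077011)])))) (Node (Node (Leaf (Search 1 [(659744, 210225, 204, 692633, 1302763)])) (Leaf
    (Search 3 [(704798, 357813, 100, 790525, 2016684)])) (Leaf (Search 4 [(-715473, 0, 116,
    715589, 5555356), (762457, 450903, 68, 885876, 3442115)]))) (Node (Leaf (Search 1 [(641716,
    326966, 128, 720341, 1667856)])) (Leaf (Multiple 38167706434841029401588717)) (Leaf
    (Multiple 3093100428396909))) (Node (Leaf (Search 3 [(623222, 444631, 120, 765694,
    2281302)])) (Leaf (Multiple
    114096123355928417925304080756048853237683902559781393030817269699033049778109)) (Leaf
    (Multiple 1695330627006004383630009172098594124700429095886128389676373169)))) (Node (Node
    (Leaf (Search 1 [(619507, 276674, 162, 678644, 1447584)])) (Leaf (Search 3 [(664864, 419157,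
    102, 786065, 2270298)])) (Leaf (Search 1 [(-594162, 0, 76, 594238, 3791485)]))) (Node (Leaf
    (Search 1 [(588468, 382440, 139, 701962, 1810389)])) (Leaf (Multiple
    39271347968607915508674165)) (Leaf (Multiple
    10901510325591873007689006306656227435582495856523497751777106850119939230934))) (Node (Leaf
    (Search 2 [(535563, 505222, 166, 736425, 2419252)])) (Leaf (Multiple
    29148593163008835933535799044035993455595682440530909777688441315633304025965)) (Leaf
    (Multiple 512)))))))"
  by code_simp

section \<open>Joining the trees for all lengths up to 7\<close>

lemma covered_le_7:
  assumes "n \<le> 7"
  shows "covered n []"
proof -
  have 6: "covered (Suc 5) []"
    by (rule covered_Suc[OF
        check_degree_7_n[THEN check_tree_covered]
        check_degree_7_z[THEN check_tree_covered]
        check_degree_7_p[THEN check_tree_covered]])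
  \<comment> \<open>The label gives the coefficient of X^7; the three trees joined share it as their
    second letter and run through the coefficient of X^6.\<close>
  have n: "covered (Suc 5) [- 1]"
    by (rule covered_Suc[OF
        check_degree_8_nn[THEN check_tree_covered]
        check_degree_8_zn[THEN check_tree_covered]
        check_degree_8_pn[THEN check_tree_covered]])
  have z: "covered (Suc 5) [0]"
    by (rule covered_Suc[OF
        check_degree_8_nz[THEN check_tree_covered]
        check_degree_8_zz[THEN check_tree_covered]
        check_degree_8_pz[THEN check_tree_covered]])
  have p: "covered (Suc 5) [1]"
    by (rule covered_Suc[OF
        check_degree_8_np[THEN check_tree_covered]
        check_degree_8_zp[THEN check_tree_covered]
        check_degree_8_pp[THEN check_tree_covered]])
  have 7: "covered (Suc (Suc 5)) []"
    by (rule covered_Suc[OF n z p])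
  have "n = 0 \<or> n = 1 \<or> n = 2 \<or> n = 3 \<or> n = 4 \<or> n = 5 \<or> n = Suc 5 \<or> n = Suc (Suc 5)"
    using assms by linarith
  then show ?thesis
    using check_degree_1[THEN check_tree_covered] check_degree_2[THEN check_tree_covered]
      check_degree_3[THEN check_tree_covered] check_degree_4[THEN check_tree_covered]
      check_degree_5[THEN check_tree_covered] check_degree_6[THEN check_tree_covered] 6 7
    by (elim disjE) (simp_all only:)
qed

theorem theorem2p1:
  fixes P :: "int poly"
  assumes "borwein_poly P"
    and "degree P \<le> 8"
    and "\<exists>N. newman_poly N \<and> P dvd N"
  shows "\<exists>L. littlewood_poly L \<and> P dvd L"
  using newman_imp_littlewood_if_covered[OF covered_le_7 assms(1,2)] assms(3)
  by (simp add: newman_imp_littlewood_def)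

end
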